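(* Let $R\to S\to T$ be homomorphisms of commutative rings such that $T$ is a semicontent $S$-algebra and $S$ is a semicontent $R$-algebra. Then $T$ is a semicontent $R$-algebra.
   Context: All rings are commutative with $1$. Let $B$ be an $A$-algebra. For $f\in B$, the (Ohm-Rush) content of $f$ (relative to $A$) is the ideal $\Omega(f)=\Omega_{BA}(f) := \bigcap\{I \subseteq A \text{ ideal} \mid f\in IB\}$ of $A$. $B$ is an Ohm-Rush algebra over $A$ if $f\in\Omega(f)B$ for all $f\in B$. A faithfully flat Ohm-Rush $A$-algebra $B$ is a semicontent algebra over $A$ if for any multiplicative set $W\subseteq A$ and any $f,g\in B$ with $\Omega(f)_W=A_W$, one has $\Omega(fg)_W=\Omega(g)_W$. (Here $I_W=IA_W$ denotes the localization of an ideal $I$ of $A$ at $W$.) *)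

theory Defs
  imports "HOL-Algebra.Algebra"
begin

text \<open>
  An \<open>A\<close>-algebra \<open>B\<close> is given by its structure homomorphism \<open>h\<close>, i.e. by
  \<^term>\<open>ring_hom_cring A B h\<close>. The zero ring is allowed throughout.
\<close>

section \<open>Modules, tensor products and faithful flatness\<close>

definition mod_hom ::
    "('a, 'u) ring_scheme \<Rightarrow> ('a, 'm) module \<Rightarrow> ('a, 'n) module \<Rightarrow> ('m \<Rightarrow> 'n) set"
  where "mod_hom A M N =
    {f \<in> carrier M \<rightarrow> carrier N.
       (\<forall>x\<in>carrier M. \<forall>y\<in>carrier M. f (x \<oplus>\<^bsub>M\<^esub> y) = f x \<oplus>\<^bsub>N\<^esub> f y) \<and>
       (\<forall>a\<in>carrier A. \<forall>x\<in>carrier M. f (a \<odot>\<^bsub>M\<^esub> x) = a \<odot>\<^bsub>N\<^esub> f x)}"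

definition algebra_module :: "('b, 'v) ring_scheme \<Rightarrow> ('a \<Rightarrow> 'b) \<Rightarrow> ('a, 'b) module"
  where "algebra_module B h =
    \<lparr>carrier = carrier B, monoid.mult = monoid.mult B, one = monoid.one B,
     ring.zero = ring.zero B, add = ring.add B, smult = (\<lambda>a b. h a \<otimes>\<^bsub>B\<^esub> b)\<rparr>"

text \<open>
  The tensor product is the free abelian group on pairs modulo the bilinearity and balancing
  relations. Only its underlying (multiplicatively written) abelian group is needed for exactness.
\<close>

definition tensor_relators ::
    "('a, 'u) ring_scheme \<Rightarrow> ('a, 'm) module \<Rightarrow> ('a, 'n) module \<Rightarrow> ('m \<times> 'n \<Rightarrow>\<^sub>0 int) set"
  where "tensor_relators A M N =
    {frag_of (x \<oplus>\<^bsub>M\<^esub> x', y) - frag_of (x, y) - frag_of (x', y) | x x' y.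
       x \<in> carrier M \<and> x' \<in> carrier M \<and> y \<in> carrier N} \<union>
    {frag_of (x, y \<oplus>\<^bsub>N\<^esub> y') - frag_of (x, y) - frag_of (x, y') | x y y'.
       x \<in> carrier M \<and> y \<in> carrier N \<and> y' \<in> carrier N} \<union>
    {frag_of (a \<odot>\<^bsub>M\<^esub> x, y) - frag_of (x, a \<odot>\<^bsub>N\<^esub> y) | a x y.
       a \<in> carrier A \<and> x \<in> carrier M \<and> y \<in> carrier N}"

definition tensor_kernel ::
    "('a, 'u) ring_scheme \<Rightarrow> ('a, 'm) module \<Rightarrow> ('a, 'n) module \<Rightarrow> ('m \<times> 'n \<Rightarrow>\<^sub>0 int) set"
  where "tensor_kernel A M N =
    generate (free_Abelian_group (carrier M \<times> carrier N)) (tensor_relators A M N)"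

definition tensor_product ::
    "('a, 'u) ring_scheme \<Rightarrow> ('a, 'm) module \<Rightarrow> ('a, 'n) module \<Rightarrow> ('m \<times> 'n \<Rightarrow>\<^sub>0 int) set monoid"
  where "tensor_product A M N =
    free_Abelian_group (carrier M \<times> carrier N) Mod tensor_kernel A M N"

text \<open>
  \<open>f \<otimes> id : M \<otimes> N \<rightarrow> M' \<otimes> N\<close> for \<open>f : M \<rightarrow> M'\<close>. All members of the coset \<open>C\<close> are sent
  to one and the same coset, so the union below is that coset.
\<close>

definition tensor_map ::
    "('a, 'u) ring_scheme \<Rightarrow> ('a, 'm') module \<Rightarrow> ('a, 'n) module \<Rightarrow> ('m \<Rightarrow> 'm')
      \<Rightarrow> ('m \<times> 'n \<Rightarrow>\<^sub>0 int) set \<Rightarrow> ('m' \<times> 'n \<Rightarrow>\<^sub>0 int) set"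
  where "tensor_map A M' N f C =
    (\<Union>c\<in>C. tensor_kernel A M' N #>\<^bsub>free_Abelian_group (carrier M' \<times> carrier N)\<^esub>
              frag_extend (\<lambda>(x, y). frag_of (f x, y)) c)"

text \<open>
  Faithful flatness: a sequence of \<open>A\<close>-modules \<open>M \<rightarrow> N \<rightarrow> P\<close> is exact if and only if the sequence
  \<open>M \<otimes>\<^sub>A B \<rightarrow> N \<otimes>\<^sub>A B \<rightarrow> P \<otimes>\<^sub>A B\<close> is. HOL has no quantification over types inside a formula, so
  the type \<^typ>\<open>'m\<close> of the elements of the test modules is a parameter. All such types that
  contain a copy of every finitely generated \<open>A\<close>-module give the same notion, e.g.
  \<^typ>\<open>nat \<Rightarrow> 'a\<close>, in which every countably generated \<open>A\<close>-module has an isomorphic copy.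
\<close>

definition faithfully_flat ::
    "'m itself \<Rightarrow> ('a, 'u) ring_scheme \<Rightarrow> ('b, 'v) ring_scheme \<Rightarrow> ('a \<Rightarrow> 'b) \<Rightarrow> bool"
  where "faithfully_flat _ A B h \<longleftrightarrow>
    (\<forall>(M :: ('a, 'm) module) (N :: ('a, 'm) module) (P :: ('a, 'm) module) f g.
       module A M \<longrightarrow> module A N \<longrightarrow> module A P \<longrightarrow>
       f \<in> mod_hom A M N \<longrightarrow> g \<in> mod_hom A N P \<longrightarrow>
       (let B' = algebra_module B h in
        f ` carrier M = a_kernel N P g \<longleftrightarrow>
        tensor_map A N B' f ` carrier (tensor_product A M B') =
          kernel (tensor_product A N B') (tensor_product A P B') (tensor_map A P B' g)))"

section \<open>Localization\<close>

definition loc_rel :: "('a, 'u) ring_scheme \<Rightarrow> 'a set \<Rightarrow> (('a \<times> 'a) \<times> ('a \<times> 'a)) set"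
  where "loc_rel A W =
    {((a, s), (b, t)). a \<in> carrier A \<and> s \<in> W \<and> b \<in> carrier A \<and> t \<in> W \<and>
       (\<exists>v\<in>W. v \<otimes>\<^bsub>A\<^esub> (a \<otimes>\<^bsub>A\<^esub> t \<ominus>\<^bsub>A\<^esub> b \<otimes>\<^bsub>A\<^esub> s) = \<zero>\<^bsub>A\<^esub>)}"

definition loc_frac :: "('a, 'u) ring_scheme \<Rightarrow> 'a set \<Rightarrow> 'a \<Rightarrow> 'a \<Rightarrow> ('a \<times> 'a) set"
  where "loc_frac A W a s = loc_rel A W `` {(a, s)}"

definition localization :: "('a, 'u) ring_scheme \<Rightarrow> 'a set \<Rightarrow> ('a \<times> 'a) set ring"
  where "localization A W =
    \<lparr>carrier = (carrier A \<times> W) // loc_rel A W,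
     monoid.mult = (\<lambda>C D. \<Union>(a, s)\<in>C. \<Union>(b, t)\<in>D. loc_frac A W (a \<otimes>\<^bsub>A\<^esub> b) (s \<otimes>\<^bsub>A\<^esub> t)),
     one = loc_frac A W \<one>\<^bsub>A\<^esub> \<one>\<^bsub>A\<^esub>,
     ring.zero = loc_frac A W \<zero>\<^bsub>A\<^esub> \<one>\<^bsub>A\<^esub>,
     add = (\<lambda>C D. \<Union>(a, s)\<in>C. \<Union>(b, t)\<in>D.
              loc_frac A W (a \<otimes>\<^bsub>A\<^esub> t \<oplus>\<^bsub>A\<^esub> b \<otimes>\<^bsub>A\<^esub> s) (s \<otimes>\<^bsub>A\<^esub> t))\<rparr>"

section \<open>Extended ideals, content and semicontent algebras\<close>

definition ext_ideal :: "('b, 'v) ring_scheme \<Rightarrow> ('a \<Rightarrow> 'b) \<Rightarrow> 'a set \<Rightarrow> 'b set"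
  where "ext_ideal B h I = Idl\<^bsub>B\<^esub> (h ` I)"

definition loc_ideal :: "('a, 'u) ring_scheme \<Rightarrow> 'a set \<Rightarrow> 'a set \<Rightarrow> ('a \<times> 'a) set set"
  where "loc_ideal A W I = ext_ideal (localization A W) (\<lambda>a. loc_frac A W a \<one>\<^bsub>A\<^esub>) I"

definition ohm_rush_content ::
    "('a, 'u) ring_scheme \<Rightarrow> ('b, 'v) ring_scheme \<Rightarrow> ('a \<Rightarrow> 'b) \<Rightarrow> 'b \<Rightarrow> 'a set"
  where "ohm_rush_content A B h f = \<Inter>{I. ideal I A \<and> f \<in> ext_ideal B h I}"

definition ohm_rush ::
    "('a, 'u) ring_scheme \<Rightarrow> ('b, 'v) ring_scheme \<Rightarrow> ('a \<Rightarrow> 'b) \<Rightarrow> bool"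
  where "ohm_rush A B h \<longleftrightarrow>
    ring_hom_cring A B h \<and> (\<forall>f\<in>carrier B. f \<in> ext_ideal B h (ohm_rush_content A B h f))"

definition semicontent ::
    "'m itself \<Rightarrow> ('a, 'u) ring_scheme \<Rightarrow> ('b, 'v) ring_scheme \<Rightarrow> ('a \<Rightarrow> 'b) \<Rightarrow> bool"
  where "semicontent U A B h \<longleftrightarrow>
    ohm_rush A B h \<and> faithfully_flat U A B h \<and>
    (\<forall>W f g. submonoid W A \<longrightarrow> f \<in> carrier B \<longrightarrow> g \<in> carrier B \<longrightarrow>
       loc_ideal A W (ohm_rush_content A B h f) = carrier (localization A W) \<longrightarrow>
       loc_ideal A W (ohm_rush_content A B h (f \<otimes>\<^bsub>B\<^esub> g)) = loc_ideal A W (ohm_rush_content A B h g))"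

end

theory Submission
  imports Defs
begin

text \<open>
  Faithful flatness of \<open>B\<close> over \<open>A\<close> is equivalent to two elementary conditions: the equational
  criterion for flatness, and \<open>1 \<in> JB \<Longrightarrow> 1 \<in> J\<close> for ideals \<open>J\<close> of \<open>A\<close>. Necessity needs only test
  modules inside some \<open>A\<^sup>n\<close>, sufficiency works for modules over any type, and both conditions
  pass to composites.

  For \<open>f \<in> T\<close> the content \<open>\<Omega>\<^bsub>TR\<^esub>(f)\<close> is the sum of the ideals \<open>\<Omega>\<^bsub>SR\<^esub>(s)\<close> with \<open>s \<in> \<Omega>\<^bsub>TS\<^esub>(f)\<close>. The semicontent
  property may be checked at primes \<open>p\<close> of \<open>R\<close> disjoint from \<open>W\<close>. There a sum of ideals that is not
  contained in \<open>p\<close> has a summand not contained in \<open>p\<close>, so \<open>\<Omega>\<^bsub>TS\<^esub>(f)\<close> meets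
  \<open>V = {s. \<not> \<Omega>\<^bsub>SR\<^esub>(s) \<subseteq> p}\<close>. This set is multiplicative because \<open>S\<close> is semicontent over \<open>R\<close>, and
  one applies the semicontent property of \<open>T\<close> over \<open>S\<close> to \<open>V\<close>.
\<close>

text \<open>The textbook route to flatness of a composite rewrites M \<otimes>_R T as (M \<otimes>_R
  S) \<otimes>_S T. Hence flatness is expressed through elements of the algebras themselves.
  Relations are recorded by maps to the base ring rather than by matrices, because maps compose.
  Their linearity is asked only on finite sets, since a flat algebra, such as the rationals over the
  integers, may have no nonzero linear functional. Primes are forced as well: a multiplicative set W
  can meet a sum of ideals without meeting any summand, so the elements of S whose content meets W
  need not meet \<Omega>_TS(f). Complements of primes do not have this defect.\<close>

section \<open>Sums over lists\<close>

text \<open>Representations of tensors are lists of pairs with repetitions allowed, so sums run over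
  lists. The fold unfolds by simplification without the closure conditions that
  \<open>finsum\<close> demands.\<close>

definition lsum :: "('a, 'u) ring_scheme \<Rightarrow> ('x \<Rightarrow> 'a) \<Rightarrow> 'x list \<Rightarrow> 'a"
  where "lsum G f xs = foldr (\<lambda>x s. f x \<oplus>\<^bsub>G\<^esub> s) xs \<zero>\<^bsub>G\<^esub>"

lemma lsum_Nil [simp]: "lsum G f [] = \<zero>\<^bsub>G\<^esub>"
  and lsum_Cons [simp]: "lsum G f (x # xs) = f x \<oplus>\<^bsub>G\<^esub> lsum G f xs"
  by (simp_all add: lsum_def)

lemma lsum_cong: "(\<And>x. x \<in> set xs \<Longrightarrow> f x = g x) \<Longrightarrow> lsum G f xs = lsum G g xs"
  by (induction xs) auto

lemma lsum_map: "lsum G f (map g xs) = lsum G (\<lambda>x. f (g x)) xs"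
  by (induction xs) auto

context abelian_monoid
begin

lemma lsum_closed [intro]: "(\<And>x. x \<in> set xs \<Longrightarrow> f x \<in> carrier G) \<Longrightarrow> lsum G f xs \<in> carrier G"
  by (induction xs) auto

lemma lsum_append:
  "(\<And>x. x \<in> set (xs @ ys) \<Longrightarrow> f x \<in> carrier G) \<Longrightarrow> lsum G f (xs @ ys) = lsum G f xs \<oplus> lsum G f ys"
  by (induction xs) (auto simp: lsum_closed a_assoc)

lemma lsum_zero: "(\<And>x. x \<in> set xs \<Longrightarrow> f x = \<zero>) \<Longrightarrow> lsum G f xs = \<zero>"
  by (induction xs) auto

lemma lsum_add:
  "\<lbrakk>\<And>x. x \<in> set xs \<Longrightarrow> f x \<in> carrier G; \<And>x. x \<in> set xs \<Longrightarrow> g x \<in> carrier G\<rbrakk>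
    \<Longrightarrow> lsum G (\<lambda>x. f x \<oplus> g x) xs = lsum G f xs \<oplus> lsum G g xs"
  by (induction xs) (auto simp: lsum_closed a_ac)

lemma lsum_delta:
  assumes "distinct xs" "j \<in> set xs" "f j \<in> carrier G"
  shows "lsum G (\<lambda>i. if i = j then f i else \<zero>) xs = f j"
  using assms
proof (induction xs)
  case (Cons x xs)
  then have "lsum G (\<lambda>i. if i = j then f i else \<zero>) xs = \<zero>" if "x = j"
    using that by (intro lsum_zero) auto
  with Cons show ?case
    by auto
qed simp

lemma lsum_concat:
  assumes "\<And>x y. \<lbrakk>x \<in> set xs; y \<in> set (l x)\<rbrakk> \<Longrightarrow> f y \<in> carrier G"
  shows "lsum G f (concat (map l xs)) = lsum G (\<lambda>x. lsum G f (l x)) xs"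
  using assms
proof (induction xs)
  case (Cons a xs)
  have "lsum G f (l a @ concat (map l xs)) = lsum G f (l a) \<oplus> lsum G f (concat (map l xs))"
    using Cons.prems by (intro lsum_append) auto
  moreover have "lsum G f (concat (map l xs)) = lsum G (\<lambda>x. lsum G f (l x)) xs"
    using Cons.prems by (intro Cons.IH) auto
  ultimately show ?case
    by simp
qed simp

end

lemma lsum_hom:
  assumes "abelian_monoid G" "\<phi> \<zero>\<^bsub>G\<^esub> = \<zero>\<^bsub>H\<^esub>"
    and "\<And>x y. \<lbrakk>x \<in> carrier G; y \<in> carrier G\<rbrakk> \<Longrightarrow> \<phi> (x \<oplus>\<^bsub>G\<^esub> y) = \<phi> x \<oplus>\<^bsub>H\<^esub> \<phi> y"
    and "\<And>x. x \<in> set xs \<Longrightarrow> f x \<in> carrier G"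
  shows "\<phi> (lsum G f xs) = lsum H (\<lambda>x. \<phi> (f x)) xs"
  using assms(4) by (induction xs) (auto simp: assms(2,3) abelian_monoid.lsum_closed[OF assms(1)])

lemma (in semiring) lsum_rdistr:
  assumes "\<And>x. x \<in> set xs \<Longrightarrow> f x \<in> carrier R" "b \<in> carrier R"
  shows "lsum R f xs \<otimes> b = lsum R (\<lambda>x. f x \<otimes> b) xs"
  using assms by (intro lsum_hom) (auto simp: l_distr abelian_monoid_axioms)

lemma sum_list_map_swap:
  "(\<Sum>x\<leftarrow>xs. \<Sum>y\<leftarrow>ys. f x y) = (\<Sum>y\<leftarrow>ys. \<Sum>x\<leftarrow>xs. f x y :: 'a :: comm_monoid_add)"
  by (induction xs) (auto simp: sum_list_addf)

section \<open>Tensoring with an algebra\<close>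

lemma algebra_module_simps [simp]:
  "carrier (algebra_module B h) = carrier B"
  "add (algebra_module B h) = add B"
  "ring.zero (algebra_module B h) = ring.zero B"
  "smult (algebra_module B h) a b = h a \<otimes>\<^bsub>B\<^esub> b"
  by (simp_all add: algebra_module_def)

text \<open>The operation of \<open>FG\<close> is addition of formal sums, so equality in the tensor
  product is written as \<open>x - y \<in> TK\<close> and handled with ordinary \<open>+\<close> and
  \<open>-\<close>; \<open>TK_trans\<close>, \<open>TK_sym\<close> and \<open>TK_cong\<close> act as
  its equational rules. Cosets enter only when the definition of exactness is unfolded.\<close>

locale algebra_tensor = ring_hom_cring A B h + M: module A M
  for A :: "('a, 'u) ring_scheme" (structure) and B :: "('b, 'v) ring_scheme" (structure)
    and h and M :: "('a, 'm) module" (structure)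
begin

abbreviation "TK \<equiv> tensor_kernel A M (algebra_module B h)"
abbreviation "FG \<equiv> free_Abelian_group (carrier M \<times> carrier B)"

lemma tensor_relators_carrier: "tensor_relators A M (algebra_module B h) \<subseteq> carrier FG"
proof -
  have two: "frag_of p - frag_of q \<in> carrier (free_Abelian_group C)" if "{p, q} \<subseteq> C"
    for p q :: "'m \<times> 'b" and C
    using that keys_diff[of "frag_of p" "frag_of q"] by (auto simp: keys_frag_of)
  have three: "frag_of p - frag_of q - frag_of r \<in> carrier (free_Abelian_group C)"
    if "{p, q, r} \<subseteq> C" for p q r :: "'m \<times> 'b" and C
    using that keys_diff[of "frag_of p - frag_of q" "frag_of r"] two[of p q C]
    by (auto simp: keys_frag_of)
  show ?thesis
    unfolding tensor_relators_def by (auto intro!: two three simp del: carrier_free_Abelian_group_iff)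
qed

lemma TK_keys: "z \<in> TK \<Longrightarrow> Poly_Mapping.keys z \<subseteq> carrier M \<times> carrier B"
  using subsetD[OF group.generate_incl[OF group_free_Abelian_group tensor_relators_carrier]]
  by (simp add: tensor_kernel_def)

lemma TK_subgroup: "subgroup TK FG"
  using group.generate_is_subgroup[OF group_free_Abelian_group tensor_relators_carrier]
  by (simp add: tensor_kernel_def)

lemma TK_zero [simp]: "0 \<in> TK"
  using subgroup.one_closed[OF TK_subgroup] by simp

lemma TK_add: "\<lbrakk>x \<in> TK; y \<in> TK\<rbrakk> \<Longrightarrow> x + y \<in> TK"
  using subgroup.m_closed[OF TK_subgroup] by simp

lemma TK_uminus: "x \<in> TK \<Longrightarrow> - x \<in> TK"
  using subgroup.m_inv_closed[OF TK_subgroup] TK_keys by force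

lemma TK_diff: "\<lbrakk>x \<in> TK; y \<in> TK\<rbrakk> \<Longrightarrow> x - y \<in> TK"
  using TK_add[OF _ TK_uminus] by force

lemma TK_trans: "\<lbrakk>x - y \<in> TK; y - z \<in> TK\<rbrakk> \<Longrightarrow> x - z \<in> TK"
  using TK_add[of "x - y" "y - z"] by simp

lemma TK_sym: "x - y \<in> TK \<Longrightarrow> y - x \<in> TK"
  using TK_uminus[of "x - y"] by simp

lemma TK_cong: "x - y \<in> TK \<Longrightarrow> x \<in> TK \<longleftrightarrow> y \<in> TK"
  using TK_diff[of x "x - y"] TK_add[of "x - y" y] by auto

lemma TK_trans_add: "\<lbrakk>x - (a + b) \<in> TK; b - c \<in> TK\<rbrakk> \<Longrightarrow> x - (a + c) \<in> TK"
  using TK_add[of "x - (a + b)" "b - c"] by (simp add: algebra_simps)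

lemma TK_sum_list:
  "(\<And>p. p \<in> set ps \<Longrightarrow> F p - F' p \<in> TK) \<Longrightarrow> (\<Sum>p\<leftarrow>ps. F p) - (\<Sum>p\<leftarrow>ps. F' p) \<in> TK"
proof (induction ps)
  case (Cons p ps)
  then have "(F p - F' p) + ((\<Sum>p\<leftarrow>ps. F p) - (\<Sum>p\<leftarrow>ps. F' p)) \<in> TK"
    by (intro TK_add) auto
  then show ?case
    by (simp add: algebra_simps)
qed simp

text \<open>An inverse is \<open>0 - r\<close> and a product is \<open>x - (0 - y)\<close>, so one
  case for differences replaces the separate cases of generation for inverses and products.\<close>

lemma TK_induct [consumes 1, case_names zero relator diff]:
  assumes "z \<in> TK" "P 0" "\<And>r. r \<in> tensor_relators A M (algebra_module B h) \<Longrightarrow> P r"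
    and diff: "\<And>x y. \<lbrakk>x \<in> TK; y \<in> TK; P x; P y\<rbrakk> \<Longrightarrow> P (x - y)"
  shows "P z"
proof -
  have "z \<in> generate FG (tensor_relators A M (algebra_module B h))"
    using assms(1) by (simp add: tensor_kernel_def)
  then have "z \<in> TK \<and> P z"
  proof (induction rule: generate.induct)
    case one
    then show ?case using assms(2) by simp
  next
    case (incl r)
    then show ?case using assms(3) by (auto simp: tensor_kernel_def generate.incl)
  next
    case (inv r)
    then have r: "r \<in> TK" "P r"
      using assms(3) by (auto simp: tensor_kernel_def generate.incl)
    then have "P (0 - r)"
      using assms(2) by (intro diff) auto
    then show ?case
      using r TK_uminus TK_keys by simp
  next
    case (eng x y)
    then have y: "P (0 - y)"
      using diff[of 0 y] assms(2) by simp
    have "P (x - (0 - y))"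
      using eng y diff[of x "0 - y"] TK_uminus by simp
    then show ?case
      using eng TK_add by simp
  qed
  then show ?thesis ..
qed

lemma TK_add_left:
  "\<lbrakk>x \<in> carrier M; x' \<in> carrier M; y \<in> carrier B\<rbrakk>
    \<Longrightarrow> frag_of (x \<oplus>\<^bsub>M\<^esub> x', y) - (frag_of (x, y) + frag_of (x', y)) \<in> TK"
  unfolding tensor_kernel_def diff_diff_add[symmetric]
  by (rule generate.incl) (fastforce simp: tensor_relators_def)

lemma TK_add_right:
  "\<lbrakk>x \<in> carrier M; y \<in> carrier B; y' \<in> carrier B\<rbrakk>
    \<Longrightarrow> frag_of (x, y \<oplus>\<^bsub>B\<^esub> y') - (frag_of (x, y) + frag_of (x, y')) \<in> TK"
  unfolding tensor_kernel_def diff_diff_add[symmetric]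
  by (rule generate.incl) (fastforce simp: tensor_relators_def)

lemma TK_smult:
  "\<lbrakk>a \<in> carrier A; x \<in> carrier M; y \<in> carrier B\<rbrakk>
    \<Longrightarrow> frag_of (a \<odot>\<^bsub>M\<^esub> x, y) - frag_of (x, h a \<otimes>\<^bsub>B\<^esub> y) \<in> TK"
  unfolding tensor_kernel_def
  by (rule generate.incl) (auto simp: tensor_relators_def)

text \<open>For x = x' = 0 the additivity relator collapses to minus the simple tensor
  itself.\<close>

lemma TK_zero_left: "y \<in> carrier B \<Longrightarrow> frag_of (\<zero>\<^bsub>M\<^esub>, y) \<in> TK"
  using TK_uminus[OF TK_add_left[of "\<zero>\<^bsub>M\<^esub>" "\<zero>\<^bsub>M\<^esub>" y]] by simp

lemma TK_zero_right: "x \<in> carrier M \<Longrightarrow> frag_of (x, \<zero>\<^bsub>B\<^esub>) \<in> TK"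
  using TK_uminus[OF TK_add_right[of x "\<zero>\<^bsub>B\<^esub>" "\<zero>\<^bsub>B\<^esub>"]] by simp

lemma TK_neg_left:
  assumes "x \<in> carrier M" "y \<in> carrier B"
  shows "frag_of (\<ominus>\<^bsub>M\<^esub> x, y) + frag_of (x, y) \<in> TK"
proof -
  have "frag_of (\<ominus>\<^bsub>M\<^esub> x \<oplus>\<^bsub>M\<^esub> x, y) - (frag_of (\<ominus>\<^bsub>M\<^esub> x, y) + frag_of (x, y)) \<in> TK"
    using assms by (intro TK_add_left) auto
  moreover have "\<ominus>\<^bsub>M\<^esub> x \<oplus>\<^bsub>M\<^esub> x = \<zero>\<^bsub>M\<^esub>"
    using assms M.l_neg by simp
  ultimately show ?thesis
    using TK_cong TK_zero_left assms by metis
qed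

text \<open>A negative coefficient is absorbed by negating the left factor, so a tensor becomes a
  plain sum of simple tensors without integer coefficients.\<close>

lemma tensor_list_repr:
  assumes "Poly_Mapping.keys z \<subseteq> carrier M \<times> carrier B"
  obtains ps where "set ps \<subseteq> carrier M \<times> carrier B" "z - (\<Sum>p\<leftarrow>ps. frag_of p) \<in> TK"
proof -
  have "\<exists>ps. set ps \<subseteq> carrier M \<times> carrier B \<and> z - (\<Sum>p\<leftarrow>ps. frag_of p) \<in> TK"
    (is "?P z")
    using assms
  proof (rule free_Abelian_group_induct[where P = ?P])
    show "?P 0" by (intro exI[of _ "[]"]) simp
  next
    fix x y
    assume "?P x" "?P y"
    then obtain ps qs where ps: "set ps \<subseteq> carrier M \<times> carrier B" "x - (\<Sum>p\<leftarrow>ps. frag_of p) \<in> TK"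
      and qs: "set qs \<subseteq> carrier M \<times> carrier B" "y - (\<Sum>p\<leftarrow>qs. frag_of p) \<in> TK"
      by auto
    define rs where "rs = map (\<lambda>(x, b). (\<ominus>\<^bsub>M\<^esub> x, b)) qs"
    have rs: "set rs \<subseteq> carrier M \<times> carrier B"
      using qs by (auto simp: rs_def)
    have "(\<Sum>p\<leftarrow>rs. frag_of p) + (\<Sum>p\<leftarrow>qs. frag_of p) \<in> TK"
      using qs(1) unfolding rs_def
    proof (induction qs)
      case (Cons q qs)
      then have "(frag_of (\<ominus>\<^bsub>M\<^esub> fst q, snd q) + frag_of q)
        + ((\<Sum>p\<leftarrow>map (\<lambda>(x, b). (\<ominus>\<^bsub>M\<^esub> x, b)) qs. frag_of p) + (\<Sum>p\<leftarrow>qs. frag_of p)) \<in> TK"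
        using TK_neg_left[of "fst q" "snd q"] by (intro TK_add[of "frag_of _ + frag_of _"]) auto
      then show ?case
        by (cases q) (simp add: algebra_simps)
    qed simp
    from TK_diff[OF TK_diff[OF ps(2) qs(2)] this]
    have "(x - y) - (\<Sum>p\<leftarrow>ps @ rs. frag_of p) \<in> TK"
      by (simp add: algebra_simps)
    then show "?P (x - y)"
      using ps rs by (intro exI[of _ "ps @ rs"]) auto
  next
    show "?P (frag_of a)" if "a \<in> carrier M \<times> carrier B" for a
      using that by (intro exI[of _ "[a]"]) auto
  qed
  then show ?thesis using that by blast
qed

lemma TK_lsum_left:
  "\<lbrakk>\<And>p. p \<in> set ps \<Longrightarrow> u p \<in> carrier M; y \<in> carrier B\<rbrakk>
    \<Longrightarrow> frag_of (lsum M u ps, y) - (\<Sum>p\<leftarrow>ps. frag_of (u p, y)) \<in> TK"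
proof (induction ps)
  case (Cons p ps)
  have "frag_of (u p \<oplus>\<^bsub>M\<^esub> lsum M u ps, y) - (frag_of (u p, y) + frag_of (lsum M u ps, y)) \<in> TK"
    using Cons by (intro TK_add_left M.lsum_closed) auto
  moreover have "frag_of (lsum M u ps, y) - (\<Sum>p\<leftarrow>ps. frag_of (u p, y)) \<in> TK"
    using Cons by auto
  ultimately show ?case
    using TK_trans_add by simp
qed (use TK_zero_left in simp)

lemma TK_lsum_right:
  "\<lbrakk>\<And>p. p \<in> set ps \<Longrightarrow> u p \<in> carrier B; x \<in> carrier M\<rbrakk>
    \<Longrightarrow> frag_of (x, lsum B u ps) - (\<Sum>p\<leftarrow>ps. frag_of (x, u p)) \<in> TK"
proof (induction ps)
  case (Cons p ps)
  have "frag_of (x, u p \<oplus>\<^bsub>B\<^esub> lsum B u ps) - (frag_of (x, u p) + frag_of (x, lsum B u ps)) \<in> TK"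
    using Cons by (intro TK_add_right S.lsum_closed) auto
  moreover have "frag_of (x, lsum B u ps) - (\<Sum>p\<leftarrow>ps. frag_of (x, u p)) \<in> TK"
    using Cons by auto
  ultimately show ?case
    using TK_trans_add by simp
qed (use TK_zero_right in simp)

lemma TK_lsum_swap_left:
  assumes "\<And>p j. \<lbrakk>p \<in> set ps; j \<in> set js\<rbrakk> \<Longrightarrow> u p j \<in> carrier M" "\<And>j. j \<in> set js \<Longrightarrow> y j \<in> carrier B"
  shows "(\<Sum>p\<leftarrow>ps. \<Sum>j\<leftarrow>js. frag_of (u p j, y j)) - (\<Sum>j\<leftarrow>js. frag_of (lsum M (\<lambda>p. u p j) ps, y j)) \<in> TK"
  unfolding sum_list_map_swap[of _ js ps]
  using assms by (auto intro!: TK_sum_list TK_sym[OF TK_lsum_left])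

lemma TK_lsum_swap_right:
  assumes "\<And>p j. \<lbrakk>p \<in> set ps; j \<in> set js\<rbrakk> \<Longrightarrow> u p j \<in> carrier B" "\<And>j. j \<in> set js \<Longrightarrow> x j \<in> carrier M"
  shows "(\<Sum>p\<leftarrow>ps. \<Sum>j\<leftarrow>js. frag_of (x j, u p j)) - (\<Sum>j\<leftarrow>js. frag_of (x j, lsum B (\<lambda>p. u p j) ps)) \<in> TK"
  unfolding sum_list_map_swap[of _ js ps]
  using assms by (auto intro!: TK_sum_list TK_sym[OF TK_lsum_right])

lemma keys_frags:
  "set ps \<subseteq> carrier M \<times> carrier B
    \<Longrightarrow> Poly_Mapping.keys (\<Sum>p\<leftarrow>ps. frag_of p) \<subseteq> carrier M \<times> carrier B"
proof (induction ps)
  case (Cons p ps)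
  then show ?case
    using keys_add[of "frag_of p" "\<Sum>p\<leftarrow>ps. frag_of p"] by (simp add: keys_frag_of) blast
qed simp

text \<open>This is freeness of \<open>FG\<close> only. Vanishing on relators is left to each use,
  because a map built from a \<open>c\<close> that is linear on finitely many elements kills some
  relators but need not kill all of \<open>TK\<close>.\<close>

lemma balanced_map_extends:
  assumes D: "abelian_group D"
    and closed: "\<And>x b. \<lbrakk>x \<in> carrier M; b \<in> carrier B\<rbrakk> \<Longrightarrow> \<beta> x b \<in> carrier D"
  obtains \<phi> where "\<phi> \<in> hom FG (add_monoid D)"
    "\<And>x b. \<lbrakk>x \<in> carrier M; b \<in> carrier B\<rbrakk> \<Longrightarrow> \<phi> (frag_of (x, b)) = \<beta> x b"
proof -
  interpret D: abelian_group D by fact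
  have "(\<lambda>(x, b). \<beta> x b) ` (carrier M \<times> carrier B) \<subseteq> carrier (add_monoid D)"
    using closed by auto
  from D.a_comm_group[THEN comm_group.free_Abelian_group_universal, OF this]
  obtain \<phi> where "\<phi> \<in> hom FG (add_monoid D)"
    "\<And>p. p \<in> carrier M \<times> carrier B \<Longrightarrow> \<phi> (frag_of p) = (\<lambda>(x, b). \<beta> x b) p"
    by blast
  then show ?thesis
    by (intro that[of \<phi>]) auto
qed

lemma free_hom_simps:
  assumes D: "abelian_group D" and \<phi>: "\<phi> \<in> hom FG (add_monoid D)"
  shows "\<phi> 0 = \<zero>\<^bsub>D\<^esub>"
    and "\<lbrakk>Poly_Mapping.keys x \<subseteq> carrier M \<times> carrier B; Poly_Mapping.keys y \<subseteq> carrier M \<times> carrier B\<rbrakk>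
      \<Longrightarrow> \<phi> (x - y) = \<phi> x \<ominus>\<^bsub>D\<^esub> \<phi> y"
    and "set ps \<subseteq> carrier M \<times> carrier B
      \<Longrightarrow> \<phi> (\<Sum>p\<leftarrow>ps. frag_of p) = lsum D (\<lambda>p. \<phi> (frag_of p)) ps"
proof -
  interpret D: abelian_group D by fact
  interpret \<phi>: group_hom FG "add_monoid D" \<phi>
    using \<phi> D.a_comm_group
    by (auto simp: group_hom_def group_hom_axioms_def comm_group_def)
  show 0: "\<phi> 0 = \<zero>\<^bsub>D\<^esub>"
    using \<phi>.hom_one by simp
  show "\<phi> (x - y) = \<phi> x \<ominus>\<^bsub>D\<^esub> \<phi> y"
    if "Poly_Mapping.keys x \<subseteq> carrier M \<times> carrier B" "Poly_Mapping.keys y \<subseteq> carrier M \<times> carrier B"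
    using \<phi>.hom_mult[of x "- y"] \<phi>.hom_inv[of y] that
    by (simp add: D.minus_eq a_inv_def)
  show "\<phi> (\<Sum>p\<leftarrow>ps. frag_of p) = lsum D (\<lambda>p. \<phi> (frag_of p)) ps"
    if "set ps \<subseteq> carrier M \<times> carrier B"
    using that
  proof (induction ps)
    case (Cons p ps)
    have "Poly_Mapping.keys (\<Sum>p\<leftarrow>ps. frag_of p) \<subseteq> carrier M \<times> carrier B"
      using Cons.prems by (intro keys_frags) auto
    with Cons \<phi>.hom_mult[of "frag_of p" "\<Sum>p\<leftarrow>ps. frag_of p"] show ?case
      by (simp add: keys_frag_of)
  qed (simp add: 0)
qed

end

lemma (in abelian_group) minus_zero_imp_eq:
  assumes "x \<ominus> y = \<zero>" "x \<in> carrier G" "y \<in> carrier G"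
  shows "x = y"
proof -
  have "x = x \<ominus> y \<oplus> y"
    using assms(2,3) by (simp add: minus_eq a_assoc l_neg)
  then show ?thesis
    using assms by simp
qed

section \<open>Linear functionals on finitely many elements\<close>

text \<open>A single equation covers additivity (a = 1) and homogeneity (b' = 0). The element h(a) b
  + b' need not lie in \<open>G\<close>, so \<open>c\<close> is a total map on B whose value there
  is prescribed by its values on \<open>G\<close>.\<close>

definition partial_linear ::
    "('a, 'u) ring_scheme \<Rightarrow> ('b, 'v) ring_scheme \<Rightarrow> ('a \<Rightarrow> 'b) \<Rightarrow> 'b set \<Rightarrow> 'a set \<Rightarrow> ('b \<Rightarrow> 'a) set"
  where "partial_linear A B h G Q = {c \<in> carrier B \<rightarrow> carrier A. \<forall>a\<in>Q. \<forall>b\<in>G. \<forall>b'\<in>G.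
    c (h a \<otimes>\<^bsub>B\<^esub> b \<oplus>\<^bsub>B\<^esub> b') = a \<otimes>\<^bsub>A\<^esub> c b \<oplus>\<^bsub>A\<^esub> c b'}"

lemma partial_linear_antimono:
  "\<lbrakk>G \<subseteq> G'; Q \<subseteq> Q'\<rbrakk> \<Longrightarrow> partial_linear A B h G' Q' \<subseteq> partial_linear A B h G Q"
  unfolding partial_linear_def by blast

lemma (in ring_hom_cring) partial_linear_add:
  assumes "c \<in> partial_linear R S h G Q" "\<one> \<in> Q" "b \<in> G" "b' \<in> G" "G \<subseteq> carrier S"
  shows "c (b \<oplus>\<^bsub>S\<^esub> b') = c b \<oplus> c b'"
proof -
  have "c (h \<one> \<otimes>\<^bsub>S\<^esub> b \<oplus>\<^bsub>S\<^esub> b') = \<one> \<otimes> c b \<oplus> c b'"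
    using assms by (auto simp: partial_linear_def)
  moreover have "c b \<in> carrier R" "b \<in> carrier S"
    using assms by (auto simp: partial_linear_def)
  ultimately show ?thesis
    by simp
qed

text \<open>The instance a = 1, b = b' = 0 gives c 0 = c 0 + c 0, hence c 0 = 0 by cancellation;
  then b' = 0 turns the defining equation into homogeneity. This is why zero and one are placed
  among the recorded elements.\<close>

lemma (in ring_hom_cring) partial_linear_mult:
  assumes "c \<in> partial_linear R S h G Q" "\<one> \<in> Q" "\<zero>\<^bsub>S\<^esub> \<in> G" "a \<in> Q" "b \<in> G"
    "G \<subseteq> carrier S" "Q \<subseteq> carrier R"
  shows "c (h a \<otimes>\<^bsub>S\<^esub> b) = a \<otimes> c b"
proof -
  have closed: "c b \<in> carrier R" "c \<zero>\<^bsub>S\<^esub> \<in> carrier R" "a \<in> carrier R" "b \<in> carrier S"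
    using assms by (auto simp: partial_linear_def)
  have "c \<zero>\<^bsub>S\<^esub> = c \<zero>\<^bsub>S\<^esub> \<oplus> c \<zero>\<^bsub>S\<^esub>"
    using partial_linear_add[OF assms(1,2,3,3,6)] by simp
  then have "c \<zero>\<^bsub>S\<^esub> = \<zero>"
    using closed by simp
  moreover have "c (h a \<otimes>\<^bsub>S\<^esub> b \<oplus>\<^bsub>S\<^esub> \<zero>\<^bsub>S\<^esub>) = a \<otimes> c b \<oplus> c \<zero>\<^bsub>S\<^esub>"
    using assms by (auto simp: partial_linear_def)
  ultimately show ?thesis
    using closed by simp
qed

context algebra_tensor
begin

lemma relator_cases [consumes 1, case_names add_left add_right smult]:
  assumes "r \<in> tensor_relators A M (algebra_module B h)"
  obtains
      x x' y where "r = frag_of (x \<oplus>\<^bsub>M\<^esub> x', y) - frag_of (x, y) - frag_of (x', y)"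
        "x \<in> carrier M" "x' \<in> carrier M" "y \<in> carrier B"
    | x y y' where "r = frag_of (x, y \<oplus>\<^bsub>B\<^esub> y') - frag_of (x, y) - frag_of (x, y')"
        "x \<in> carrier M" "y \<in> carrier B" "y' \<in> carrier B"
    | a x y where "r = frag_of (a \<odot>\<^bsub>M\<^esub> x, y) - frag_of (x, h a \<otimes>\<^bsub>B\<^esub> y)"
        "a \<in> carrier A" "x \<in> carrier M" "y \<in> carrier B"
  using assms unfolding tensor_relators_def algebra_module_simps by blast

lemma free_hom_diff_frag:
  assumes D: "abelian_group D" and \<phi>: "\<phi> \<in> hom FG (add_monoid D)"
    and p: "p \<in> carrier M \<times> carrier B" and q: "q \<in> carrier M \<times> carrier B"
  shows "\<phi> (frag_of p - frag_of q) = \<phi> (frag_of p) \<ominus>\<^bsub>D\<^esub> \<phi> (frag_of q)"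
    and "r \<in> carrier M \<times> carrier B \<Longrightarrow> \<phi> (frag_of p - frag_of q - frag_of r)
      = \<phi> (frag_of p) \<ominus>\<^bsub>D\<^esub> \<phi> (frag_of q) \<ominus>\<^bsub>D\<^esub> \<phi> (frag_of r)"
proof -
  have "Poly_Mapping.keys (frag_of p - frag_of q) \<subseteq> carrier M \<times> carrier B"
    using keys_diff[of "frag_of p" "frag_of q"] p q by (auto simp: keys_frag_of)
  then show "\<phi> (frag_of p - frag_of q) = \<phi> (frag_of p) \<ominus>\<^bsub>D\<^esub> \<phi> (frag_of q)"
    and "r \<in> carrier M \<times> carrier B \<Longrightarrow> \<phi> (frag_of p - frag_of q - frag_of r)
      = \<phi> (frag_of p) \<ominus>\<^bsub>D\<^esub> \<phi> (frag_of q) \<ominus>\<^bsub>D\<^esub> \<phi> (frag_of r)"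
    using free_hom_simps(2)[OF D \<phi>] p q by (auto simp: keys_frag_of)
qed

lemma free_hom_closed:
  assumes "\<phi> \<in> hom FG (add_monoid D)" "p \<in> carrier M \<times> carrier B"
  shows "\<phi> (frag_of p) \<in> carrier D"
  using hom_in_carrier[OF assms(1), of "frag_of p"] assms(2) by (simp add: keys_frag_of)

lemma free_hom_relators:
  assumes D: "abelian_group D" and \<phi>: "\<phi> \<in> hom FG (add_monoid D)"
  shows "\<lbrakk>x \<in> carrier M; x' \<in> carrier M; y \<in> carrier B;
      \<phi> (frag_of (x \<oplus>\<^bsub>M\<^esub> x', y)) = \<phi> (frag_of (x, y)) \<oplus>\<^bsub>D\<^esub> \<phi> (frag_of (x', y))\<rbrakk>
      \<Longrightarrow> \<phi> (frag_of (x \<oplus>\<^bsub>M\<^esub> x', y) - frag_of (x, y) - frag_of (x', y)) = \<zero>\<^bsub>D\<^esub>"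
    and "\<lbrakk>x \<in> carrier M; y \<in> carrier B; y' \<in> carrier B;
      \<phi> (frag_of (x, y \<oplus>\<^bsub>B\<^esub> y')) = \<phi> (frag_of (x, y)) \<oplus>\<^bsub>D\<^esub> \<phi> (frag_of (x, y'))\<rbrakk>
      \<Longrightarrow> \<phi> (frag_of (x, y \<oplus>\<^bsub>B\<^esub> y') - frag_of (x, y) - frag_of (x, y')) = \<zero>\<^bsub>D\<^esub>"
    and "\<lbrakk>a \<in> carrier A; x \<in> carrier M; y \<in> carrier B;
      \<phi> (frag_of (a \<odot>\<^bsub>M\<^esub> x, y)) = \<phi> (frag_of (x, h a \<otimes>\<^bsub>B\<^esub> y))\<rbrakk>
      \<Longrightarrow> \<phi> (frag_of (a \<odot>\<^bsub>M\<^esub> x, y) - frag_of (x, h a \<otimes>\<^bsub>B\<^esub> y)) = \<zero>\<^bsub>D\<^esub>"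
proof -
  interpret D: abelian_group D by fact
  have diff: "u \<oplus>\<^bsub>D\<^esub> v \<ominus>\<^bsub>D\<^esub> u \<ominus>\<^bsub>D\<^esub> v = \<zero>\<^bsub>D\<^esub>" if "u \<in> carrier D" "v \<in> carrier D" for u v
  proof -
    have "u \<oplus>\<^bsub>D\<^esub> v \<ominus>\<^bsub>D\<^esub> u = v"
      using that by (simp add: D.minus_eq D.a_comm[of u v] D.a_assoc D.r_neg)
    then show ?thesis
      using that by (simp add: D.minus_eq D.r_neg)
  qed
  note closed = free_hom_closed[OF \<phi>] and diffs = free_hom_diff_frag[OF D \<phi>]
  show "\<phi> (frag_of (x \<oplus>\<^bsub>M\<^esub> x', y) - frag_of (x, y) - frag_of (x', y)) = \<zero>\<^bsub>D\<^esub>"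
    if "x \<in> carrier M" "x' \<in> carrier M" "y \<in> carrier B"
      "\<phi> (frag_of (x \<oplus>\<^bsub>M\<^esub> x', y)) = \<phi> (frag_of (x, y)) \<oplus>\<^bsub>D\<^esub> \<phi> (frag_of (x', y))"
    using that diff closed by (simp add: diffs)
  show "\<phi> (frag_of (x, y \<oplus>\<^bsub>B\<^esub> y') - frag_of (x, y) - frag_of (x, y')) = \<zero>\<^bsub>D\<^esub>"
    if "x \<in> carrier M" "y \<in> carrier B" "y' \<in> carrier B"
      "\<phi> (frag_of (x, y \<oplus>\<^bsub>B\<^esub> y')) = \<phi> (frag_of (x, y)) \<oplus>\<^bsub>D\<^esub> \<phi> (frag_of (x, y'))"
    using that diff closed by (simp add: diffs)
  show "\<phi> (frag_of (a \<odot>\<^bsub>M\<^esub> x, y) - frag_of (x, h a \<otimes>\<^bsub>B\<^esub> y)) = \<zero>\<^bsub>D\<^esub>"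
    if "a \<in> carrier A" "x \<in> carrier M" "y \<in> carrier B"
      "\<phi> (frag_of (a \<odot>\<^bsub>M\<^esub> x, y)) = \<phi> (frag_of (x, h a \<otimes>\<^bsub>B\<^esub> y))"
    using that closed by (simp add: diffs D.minus_eq D.r_neg)
qed

lemma free_hom_diff_zero:
  assumes D: "abelian_group D" and \<phi>: "\<phi> \<in> hom FG (add_monoid D)"
    and "x \<in> TK" "y \<in> TK" "\<phi> x = \<zero>\<^bsub>D\<^esub>" "\<phi> y = \<zero>\<^bsub>D\<^esub>"
  shows "\<phi> (x - y) = \<zero>\<^bsub>D\<^esub>"
proof -
  interpret D: abelian_group D by fact
  show ?thesis
    using assms free_hom_simps(2)[OF D \<phi>, of x y] TK_keys by (simp add: D.minus_eq)
qed

text \<open>Well-definedness of the map that a balanced map induces on the tensor product, phrased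
  for lists of simple tensors. It is later applied to the coordinate maps A^n \<otimes> B
  \<rightarrow> B that send x \<otimes> b to h(x_j) b.\<close>

lemma TK_balanced:
  assumes D: "abelian_group D"
    and closed: "\<And>x b. \<lbrakk>x \<in> carrier M; b \<in> carrier B\<rbrakk> \<Longrightarrow> \<beta> x b \<in> carrier D"
    and add_left: "\<And>x x' b. \<lbrakk>x \<in> carrier M; x' \<in> carrier M; b \<in> carrier B\<rbrakk>
      \<Longrightarrow> \<beta> (x \<oplus>\<^bsub>M\<^esub> x') b = \<beta> x b \<oplus>\<^bsub>D\<^esub> \<beta> x' b"
    and add_right: "\<And>x b b'. \<lbrakk>x \<in> carrier M; b \<in> carrier B; b' \<in> carrier B\<rbrakk>
      \<Longrightarrow> \<beta> x (b \<oplus>\<^bsub>B\<^esub> b') = \<beta> x b \<oplus>\<^bsub>D\<^esub> \<beta> x b'"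
    and smult: "\<And>a x b. \<lbrakk>a \<in> carrier A; x \<in> carrier M; b \<in> carrier B\<rbrakk>
      \<Longrightarrow> \<beta> (a \<odot>\<^bsub>M\<^esub> x) b = \<beta> x (h a \<otimes>\<^bsub>B\<^esub> b)"
    and ps: "set ps \<subseteq> carrier M \<times> carrier B" and qs: "set qs \<subseteq> carrier M \<times> carrier B"
    and diff: "(\<Sum>p\<leftarrow>ps. frag_of p) - (\<Sum>q\<leftarrow>qs. frag_of q) \<in> TK"
  shows "lsum D (\<lambda>(x, b). \<beta> x b) ps = lsum D (\<lambda>(x, b). \<beta> x b) qs"
proof -
  interpret D: abelian_group D by fact
  obtain \<phi> where \<phi>: "\<phi> \<in> hom FG (add_monoid D)"
    and \<phi>_of: "\<And>x b. \<lbrakk>x \<in> carrier M; b \<in> carrier B\<rbrakk> \<Longrightarrow> \<phi> (frag_of (x, b)) = \<beta> x b"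
    using balanced_map_extends[OF D, of \<beta>] closed by blast
  have "\<phi> z = \<zero>\<^bsub>D\<^esub>" if "z \<in> TK" for z
    using that
  proof (induction rule: TK_induct)
    case zero
    show ?case using free_hom_simps(1)[OF D \<phi>] .
  next
    case (relator r)
    then show ?case
    proof (cases rule: relator_cases)
      case (add_left x x' y)
      then show ?thesis
        by (simp add: free_hom_relators[OF D \<phi>] \<phi>_of assms)
    next
      case (add_right x y y')
      then show ?thesis
        by (simp add: free_hom_relators[OF D \<phi>] \<phi>_of assms)
    next
      case (smult a x y)
      then show ?thesis
        by (simp add: free_hom_relators[OF D \<phi>] \<phi>_of assms)
    qed
  next
    case (diff x y)
    then show ?case by (intro free_hom_diff_zero[OF D \<phi>])
  qed
  from this[OF diff] have "\<phi> (\<Sum>p\<leftarrow>ps. frag_of p) \<ominus>\<^bsub>D\<^esub> \<phi> (\<Sum>q\<leftarrow>qs. frag_of q) = \<zero>\<^bsub>D\<^esub>"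
    using free_hom_simps(2)[OF D \<phi>] keys_frags ps qs by metis
  moreover have eval: "\<phi> (\<Sum>p\<leftarrow>rs. frag_of p) = lsum D (\<lambda>(x, b). \<beta> x b) rs"
      "lsum D (\<lambda>(x, b). \<beta> x b) rs \<in> carrier D"
    if "set rs \<subseteq> carrier M \<times> carrier B" for rs
  proof -
    show "\<phi> (\<Sum>p\<leftarrow>rs. frag_of p) = lsum D (\<lambda>(x, b). \<beta> x b) rs"
      unfolding free_hom_simps(3)[OF D \<phi> that]
      using that \<phi>_of by (intro lsum_cong) auto
    show "lsum D (\<lambda>(x, b). \<beta> x b) rs \<in> carrier D"
      using that closed by (intro D.lsum_closed) auto
  qed
  ultimately show ?thesis
    using ps qs D.minus_zero_imp_eq by metis
qed

text \<open>
  A relation in \<open>M \<otimes> B\<close> uses only finitely many relators, so every map \<open>c : B \<rightarrow> A\<close> that is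
  linear on the finitely many elements involved turns it into a relation in \<open>M\<close>.
\<close>

lemma TK_functional:
  assumes "z \<in> TK"
  shows "\<exists>G Q. finite G \<and> G \<subseteq> carrier B \<and> finite Q \<and> Q \<subseteq> carrier A \<and>
    (\<forall>c\<in>partial_linear A B h G Q. \<forall>\<phi>\<in>hom FG (add_monoid M).
      (\<forall>x\<in>carrier M. \<forall>b\<in>carrier B. \<phi> (frag_of (x, b)) = c b \<odot>\<^bsub>M\<^esub> x) \<longrightarrow> \<phi> z = \<zero>\<^bsub>M\<^esub>)"
    (is "\<exists>G Q. ?P G Q z")
  using assms
proof (induction rule: TK_induct)
  case zero
  show ?case
    using free_hom_simps(1)[OF M.abelian_group_axioms] by (intro exI[of _ "{}"]) auto
next
  case (relator r)
  then show ?case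
  proof (cases rule: relator_cases)
    case (add_left x x' y)
    \<comment> \<open>Scalars distribute over sums in \<open>M\<close> whatever the value of
      \<open>c\<close> is, so this relator records no linearity.\<close>
    have "?P {} {} r"
    proof (intro conjI ballI impI)
      fix c \<phi>
      assume c: "c \<in> partial_linear A B h {} {}" and \<phi>: "\<phi> \<in> hom FG (add_monoid M)"
        and eq: "\<forall>x\<in>carrier M. \<forall>b\<in>carrier B. \<phi> (frag_of (x, b)) = c b \<odot>\<^bsub>M\<^esub> x"
      have "c y \<in> carrier A"
        using c add_left by (auto simp: partial_linear_def)
      then show "\<phi> r = \<zero>\<^bsub>M\<^esub>"
        using add_left eq
        by (auto intro!: free_hom_relators[OF M.abelian_group_axioms \<phi>] simp: M.smult_r_distr)
    qed auto
    then show ?thesis by (intro exI)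
  next
    case (add_right x y y')
    have "?P {y, y'} {\<one>\<^bsub>A\<^esub>} r"
    proof (intro conjI ballI impI)
      fix c \<phi>
      assume c: "c \<in> partial_linear A B h {y, y'} {\<one>}" and \<phi>: "\<phi> \<in> hom FG (add_monoid M)"
        and eq: "\<forall>x\<in>carrier M. \<forall>b\<in>carrier B. \<phi> (frag_of (x, b)) = c b \<odot>\<^bsub>M\<^esub> x"
      have "c (y \<oplus>\<^bsub>B\<^esub> y') = c y \<oplus> c y'"
        using partial_linear_add[OF c, of y y'] add_right by auto
      moreover have "c y \<in> carrier A" "c y' \<in> carrier A"
        using c add_right by (auto simp: partial_linear_def)
      ultimately show "\<phi> r = \<zero>\<^bsub>M\<^esub>"
        using add_right eq
        by (auto intro!: free_hom_relators[OF M.abelian_group_axioms \<phi>] simp: M.smult_l_distr)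
    qed (use add_right in auto)
    then show ?thesis by (intro exI)
  next
    case (smult a x y)
    \<comment> \<open>Homogeneity of \<open>c\<close> at \<open>y\<close> is extracted through c 0 =
      0, which costs the extra entries zero and one.\<close>
    have "?P {y, \<zero>\<^bsub>B\<^esub>} {a, \<one>\<^bsub>A\<^esub>} r"
    proof (intro conjI ballI impI)
      fix c \<phi>
      assume c: "c \<in> partial_linear A B h {y, \<zero>\<^bsub>B\<^esub>} {a, \<one>}" and \<phi>: "\<phi> \<in> hom FG (add_monoid M)"
        and eq: "\<forall>x\<in>carrier M. \<forall>b\<in>carrier B. \<phi> (frag_of (x, b)) = c b \<odot>\<^bsub>M\<^esub> x"
      have "c (h a \<otimes>\<^bsub>B\<^esub> y) = a \<otimes> c y"
        using partial_linear_mult[OF c, of a y] smult by auto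
      moreover have cy: "c y \<in> carrier A"
        using c smult by (auto simp: partial_linear_def)
      moreover have "c y \<odot>\<^bsub>M\<^esub> (a \<odot>\<^bsub>M\<^esub> x) = (a \<otimes> c y) \<odot>\<^bsub>M\<^esub> x"
        unfolding R.m_comm[OF smult(2) cy] using cy smult by (simp add: M.smult_assoc1)
      ultimately show "\<phi> r = \<zero>\<^bsub>M\<^esub>"
        using smult eq
        by (auto intro!: free_hom_relators[OF M.abelian_group_axioms \<phi>])
    qed (use smult in auto)
    then show ?thesis by (intro exI)
  qed
next
  case (diff x y)
  then obtain G Q G' Q' where 1: "?P G Q x" and 2: "?P G' Q' y"
    by blast
  have "?P (G \<union> G') (Q \<union> Q') (x - y)"
  proof (intro conjI ballI impI)
    fix c \<phi>
    assume c: "c \<in> partial_linear A B h (G \<union> G') (Q \<union> Q')" and \<phi>: "\<phi> \<in> hom FG (add_monoid M)"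
      and eq: "\<forall>x\<in>carrier M. \<forall>b\<in>carrier B. \<phi> (frag_of (x, b)) = c b \<odot>\<^bsub>M\<^esub> x"
    have "c \<in> partial_linear A B h G Q" "c \<in> partial_linear A B h G' Q'"
      using c partial_linear_antimono by (metis Un_upper1 Un_upper2 subsetD)+
    then show "\<phi> (x - y) = \<zero>\<^bsub>M\<^esub>"
      using 1 2 \<phi> eq diff.hyps by (intro free_hom_diff_zero[OF M.abelian_group_axioms \<phi>]) auto
  next
    show "finite (G \<union> G')" "G \<union> G' \<subseteq> carrier B" "finite (Q \<union> Q')" "Q \<union> Q' \<subseteq> carrier A"
      using 1 2
      by (blast intro: finite_UnI)+
  qed
  then show ?case by (intro exI)
qed

text \<open>\<open>G\<close> and \<open>Q\<close> depend only on the two lists, so the functionals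
  can be chosen afterwards by the lifting criterion. The auxiliary homomorphism is built from
  \<open>c\<close> by freeness and disappears from the statement.\<close>

lemma TK_functional_lists:
  assumes ps: "set ps \<subseteq> carrier M \<times> carrier B" and qs: "set qs \<subseteq> carrier M \<times> carrier B"
    and "(\<Sum>p\<leftarrow>ps. frag_of p) - (\<Sum>q\<leftarrow>qs. frag_of q) \<in> TK"
  obtains G Q where "finite G" "G \<subseteq> carrier B" "finite Q" "Q \<subseteq> carrier A"
    "\<And>c. c \<in> partial_linear A B h G Q
      \<Longrightarrow> lsum M (\<lambda>(x, b). c b \<odot>\<^bsub>M\<^esub> x) ps = lsum M (\<lambda>(x, b). c b \<odot>\<^bsub>M\<^esub> x) qs"
proof -
  obtain G Q where GQ: "finite G" "G \<subseteq> carrier B" "finite Q" "Q \<subseteq> carrier A"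
    and vanish: "\<forall>c\<in>partial_linear A B h G Q. \<forall>\<phi>\<in>hom FG (add_monoid M).
      (\<forall>x\<in>carrier M. \<forall>b\<in>carrier B. \<phi> (frag_of (x, b)) = c b \<odot>\<^bsub>M\<^esub> x)
        \<longrightarrow> \<phi> ((\<Sum>p\<leftarrow>ps. frag_of p) - (\<Sum>q\<leftarrow>qs. frag_of q)) = \<zero>\<^bsub>M\<^esub>"
    using TK_functional[OF assms(3)] by blast
  have "lsum M (\<lambda>(x, b). c b \<odot>\<^bsub>M\<^esub> x) ps = lsum M (\<lambda>(x, b). c b \<odot>\<^bsub>M\<^esub> x) qs"
    if c: "c \<in> partial_linear A B h G Q" for c
  proof -
    have closed: "c b \<odot>\<^bsub>M\<^esub> x \<in> carrier M" if "x \<in> carrier M" "b \<in> carrier B" for x b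
      using that c by (auto simp: partial_linear_def)
    obtain \<phi> where \<phi>: "\<phi> \<in> hom FG (add_monoid M)"
      and \<phi>_of: "\<And>x b. \<lbrakk>x \<in> carrier M; b \<in> carrier B\<rbrakk> \<Longrightarrow> \<phi> (frag_of (x, b)) = c b \<odot>\<^bsub>M\<^esub> x"
      using balanced_map_extends[OF M.abelian_group_axioms, of "\<lambda>x b. c b \<odot>\<^bsub>M\<^esub> x"] closed by blast
    have eval: "\<phi> (\<Sum>p\<leftarrow>rs. frag_of p) = lsum M (\<lambda>(x, b). c b \<odot>\<^bsub>M\<^esub> x) rs"
        "lsum M (\<lambda>(x, b). c b \<odot>\<^bsub>M\<^esub> x) rs \<in> carrier M"
      if "set rs \<subseteq> carrier M \<times> carrier B" for rs
    proof -
      show "\<phi> (\<Sum>p\<leftarrow>rs. frag_of p) = lsum M (\<lambda>(x, b). c b \<odot>\<^bsub>M\<^esub> x) rs"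
        unfolding free_hom_simps(3)[OF M.abelian_group_axioms \<phi> that]
        using that \<phi>_of by (intro lsum_cong) auto
      show "lsum M (\<lambda>(x, b). c b \<odot>\<^bsub>M\<^esub> x) rs \<in> carrier M"
        using that closed by (intro M.lsum_closed) auto
    qed
    have "\<phi> ((\<Sum>p\<leftarrow>ps. frag_of p) - (\<Sum>q\<leftarrow>qs. frag_of q)) = \<zero>\<^bsub>M\<^esub>"
      using vanish c \<phi> \<phi>_of by blast
    then show ?thesis
      using free_hom_simps(2)[OF M.abelian_group_axioms \<phi> keys_frags[OF ps] keys_frags[OF qs]]
        eval[OF ps] eval[OF qs] M.minus_zero_imp_eq by metis
  qed
  with GQ show ?thesis
    using that by blast
qed

section \<open>Cosets, induced maps and exactness\<close>

lemma TK_coset: "TK #>\<^bsub>FG\<^esub> z = {k + z | k. k \<in> TK}"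
  by (auto simp: r_coset_def)

lemma TK_coset_eq: "TK #>\<^bsub>FG\<^esub> z = TK #>\<^bsub>FG\<^esub> z' \<longleftrightarrow> z - z' \<in> TK"
proof
  assume "TK #>\<^bsub>FG\<^esub> z = TK #>\<^bsub>FG\<^esub> z'"
  moreover have "z \<in> TK #>\<^bsub>FG\<^esub> z"
    unfolding TK_coset using TK_zero by force
  ultimately show "z - z' \<in> TK"
    by (auto simp: TK_coset)
next
  assume diff: "z - z' \<in> TK"
  have "\<exists>k'\<in>TK. k + z = k' + z'" if "k \<in> TK" for k
    using TK_add[OF that diff] by (intro bexI[of _ "k + (z - z')"]) auto
  moreover have "\<exists>k'\<in>TK. k + z' = k' + z" if "k \<in> TK" for k
    using TK_diff[OF that diff] by (intro bexI[of _ "k - (z - z')"]) auto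
  ultimately show "TK #>\<^bsub>FG\<^esub> z = TK #>\<^bsub>FG\<^esub> z'"
    unfolding TK_coset by blast
qed

lemma TK_coset_zero: "TK #>\<^bsub>FG\<^esub> 0 = TK"
  by (auto simp: TK_coset)

lemma carrier_tensor_product:
  "carrier (tensor_product A M (algebra_module B h))
    = {TK #>\<^bsub>FG\<^esub> z | z. Poly_Mapping.keys z \<subseteq> carrier M \<times> carrier B}"
  by (auto simp: tensor_product_def FactGroup_def RCOSETS_def)

lemma one_tensor_product: "\<one>\<^bsub>tensor_product A M (algebra_module B h)\<^esub> = TK"
  by (simp add: tensor_product_def FactGroup_def)

end

locale algebra_tensor_hom = dom: algebra_tensor A B h M + cod: algebra_tensor A B h N
  for A :: "('a, 'u) ring_scheme" (structure) and B :: "('b, 'v) ring_scheme" (structure)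
    and h and M :: "('a, 'm) module" (structure) and N :: "('a, 'n) module" (structure) +
  fixes f
  assumes f: "f \<in> mod_hom A M N"
begin

lemma f_closed: "x \<in> carrier M \<Longrightarrow> f x \<in> carrier N"
  and f_add: "\<lbrakk>x \<in> carrier M; y \<in> carrier M\<rbrakk> \<Longrightarrow> f (x \<oplus>\<^bsub>M\<^esub> y) = f x \<oplus>\<^bsub>N\<^esub> f y"
  and f_smult: "\<lbrakk>a \<in> carrier A; x \<in> carrier M\<rbrakk> \<Longrightarrow> f (a \<odot>\<^bsub>M\<^esub> x) = a \<odot>\<^bsub>N\<^esub> f x"
  using f by (auto simp: mod_hom_def)

lemma f_zero: "f \<zero>\<^bsub>M\<^esub> = \<zero>\<^bsub>N\<^esub>"
  using f_add[of "\<zero>\<^bsub>M\<^esub>" "\<zero>\<^bsub>M\<^esub>"] f_closed[of "\<zero>\<^bsub>M\<^esub>"] by simp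

lemma f_lsum:
  "(\<And>p. p \<in> set ps \<Longrightarrow> u p \<in> carrier M) \<Longrightarrow> f (lsum M u ps) = lsum N (\<lambda>p. f (u p)) ps"
  by (intro lsum_hom) (auto simp: f_zero f_add dom.M.abelian_monoid_axioms)

abbreviation "tf \<equiv> frag_extend (\<lambda>(x, y). frag_of (f x, y :: 'b))"

lemma tf_keys:
  assumes "Poly_Mapping.keys z \<subseteq> carrier M \<times> carrier B"
  shows "Poly_Mapping.keys (tf z) \<subseteq> carrier N \<times> carrier B"
proof
  fix p assume "p \<in> Poly_Mapping.keys (tf z)"
  then obtain q where "q \<in> Poly_Mapping.keys z" "p = (f (fst q), snd q)"
    using keys_frag_extend[of "\<lambda>(x, y). frag_of (f x, y)" z]
    by (auto simp: case_prod_beta keys_frag_of)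
  then show "p \<in> carrier N \<times> carrier B"
    using assms f_closed by auto
qed

lemma tf_TK: "z \<in> dom.TK \<Longrightarrow> tf z \<in> cod.TK"
proof (induction rule: dom.TK_induct)
  case (relator r)
  then show ?case
  proof (cases rule: dom.relator_cases)
    case (add_left x x' y)
    then show ?thesis
      using cod.TK_add_left[of "f x" "f x'" y] f_closed by (simp add: frag_extend_diff frag_extend_add f_add diff_diff_eq)
  next
    case (add_right x y y')
    then show ?thesis
      using cod.TK_add_right[of "f x" y y'] f_closed by (simp add: frag_extend_diff frag_extend_add diff_diff_eq)
  next
    case (smult a x y)
    then show ?thesis
      using cod.TK_smult[of a "f x" y] f_closed by (simp add: frag_extend_diff f_smult)
  qed
qed (auto simp: frag_extend_diff cod.TK_diff)

text \<open>Members of a coset differ by elements of the kernel, which \<open>tf_TK\<close> keeps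
  inside the kernel of the target, so all cosets in the union coincide; \<open>0 + z\<close> shows
  that there is at least one.\<close>

lemma tensor_map_coset:
  "tensor_map A N (algebra_module B h) f (dom.TK #>\<^bsub>dom.FG\<^esub> z) = cod.TK #>\<^bsub>cod.FG\<^esub> tf z"
proof -
  have "cod.TK #>\<^bsub>cod.FG\<^esub> tf (k + z) = cod.TK #>\<^bsub>cod.FG\<^esub> tf z" if "k \<in> dom.TK" for k
    unfolding cod.TK_coset_eq using tf_TK[OF that] by (simp add: frag_extend_add)
  moreover have "0 + z \<in> dom.TK #>\<^bsub>dom.FG\<^esub> z"
    unfolding dom.TK_coset using dom.TK_zero by blast
  ultimately show ?thesis
    unfolding tensor_map_def dom.TK_coset by auto (metis add_0 dom.TK_zero)
qed

end

lemma setcompr_subset_iff: "{F w | w. P w} \<subseteq> K \<longleftrightarrow> (\<forall>w. P w \<longrightarrow> F w \<in> K)"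
  by blast

text \<open>Moves exactness from the quotient groups to formal sums. The equality of sets splits
  into two inclusions: the composite vanishes, and cycles are boundaries.\<close>

lemma tensor_exact_iff:
  fixes B :: "('b, 'v) ring_scheme" and M :: "('a, 'm) module" and N :: "('a, 'n) module"
  assumes "algebra_tensor_hom A B h M N f" "algebra_tensor_hom A B h N P g"
  defines "tf \<equiv> frag_extend (\<lambda>(x, y). frag_of (f x, y))" and "tg \<equiv> frag_extend (\<lambda>(x, y). frag_of (g x, y))"
    and "B' \<equiv> algebra_module B h"
  shows "tensor_map A N B' f ` carrier (tensor_product A M B') =
      kernel (tensor_product A N B') (tensor_product A P B') (tensor_map A P B' g) \<longleftrightarrow>
    (\<forall>w. Poly_Mapping.keys w \<subseteq> carrier M \<times> carrier B \<longrightarrow> tg (tf w) \<in> tensor_kernel A P B') \<and>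
    (\<forall>z. Poly_Mapping.keys z \<subseteq> carrier N \<times> carrier B \<longrightarrow> tg z \<in> tensor_kernel A P B' \<longrightarrow>
      (\<exists>w. Poly_Mapping.keys w \<subseteq> carrier M \<times> carrier B \<and> z - tf w \<in> tensor_kernel A N B'))"
    (is "?L \<longleftrightarrow> ?R1 \<and> ?R2")
proof -
  interpret f: algebra_tensor_hom A B h M N f by fact
  interpret g: algebra_tensor_hom A B h N P g by fact
  let ?c = "\<lambda>z. f.cod.TK #>\<^bsub>f.cod.FG\<^esub> z"
  have L: "tensor_map A N B' f ` carrier (tensor_product A M B')
      = {?c (tf w) | w. Poly_Mapping.keys w \<subseteq> carrier M \<times> carrier B}"
  proof -
    have "tensor_map A N B' f ` carrier (tensor_product A M B')
        = {tensor_map A N B' f (f.dom.TK #>\<^bsub>f.dom.FG\<^esub> w) | w. Poly_Mapping.keys w \<subseteq> carrier M \<times> carrier B}"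
      unfolding B'_def f.dom.carrier_tensor_product by blast
    then show ?thesis
      by (simp add: B'_def tf_def f.tensor_map_coset)
  qed
  have mem: "g.cod.TK #>\<^bsub>g.cod.FG\<^esub> tg z = g.cod.TK \<longleftrightarrow> tg z \<in> g.cod.TK" for z
    using g.cod.TK_coset_eq[of "tg z" 0] by (simp add: g.cod.TK_coset_zero)
  have R: "kernel (tensor_product A N B') (tensor_product A P B') (tensor_map A P B' g)
      = {?c z | z. Poly_Mapping.keys z \<subseteq> carrier N \<times> carrier B \<and> tg z \<in> g.cod.TK}"
  proof -
    have "kernel (tensor_product A N B') (tensor_product A P B') (tensor_map A P B' g)
        = {?c z | z. Poly_Mapping.keys z \<subseteq> carrier N \<times> carrier B \<and> tensor_map A P B' g (?c z) = g.cod.TK}"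
      unfolding B'_def kernel_def f.cod.carrier_tensor_product g.cod.one_tensor_product by blast
    also have "\<dots> = {?c z | z. Poly_Mapping.keys z \<subseteq> carrier N \<times> carrier B
        \<and> g.cod.TK #>\<^bsub>g.cod.FG\<^esub> tg z = g.cod.TK}"
      by (simp add: B'_def tg_def g.tensor_map_coset)
    finally show ?thesis
      using mem by simp
  qed
  let ?I = "{?c (tf w) | w. Poly_Mapping.keys w \<subseteq> carrier M \<times> carrier B}"
  let ?K = "{?c z | z. Poly_Mapping.keys z \<subseteq> carrier N \<times> carrier B \<and> tg z \<in> g.cod.TK}"
  have I: "(\<exists>w. Poly_Mapping.keys w \<subseteq> carrier M \<times> carrier B \<and> z - tf w \<in> f.cod.TK) \<longleftrightarrow> ?c z \<in> ?I" for z
    by (simp only: mem_Collect_eq f.cod.TK_coset_eq) blast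
  \<comment> \<open>Membership in the kernel does not depend on the representative: representatives
    of one coset differ by an element that \<open>g.tf_TK\<close> sends into the tensor kernel over
    \<open>P\<close>.\<close>
  have K: "?c z \<in> ?K \<longleftrightarrow> tg z \<in> g.cod.TK" if z: "Poly_Mapping.keys z \<subseteq> carrier N \<times> carrier B" for z
  proof
    assume "?c z \<in> ?K"
    then obtain z' where z': "z - z' \<in> f.cod.TK" "tg z' \<in> g.cod.TK"
      by (simp only: mem_Collect_eq f.cod.TK_coset_eq) blast
    then have "tg z - tg z' \<in> g.cod.TK"
      using g.tf_TK by (simp add: tg_def frag_extend_diff[symmetric])
    then show "tg z \<in> g.cod.TK"
      using z'(2) g.cod.TK_cong by blast
  qed (use z in blast)
  have "?I \<subseteq> ?K \<longleftrightarrow> ?R1"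
    unfolding setcompr_subset_iff B'_def using K[unfolded B'_def] f.tf_keys unfolding tf_def
    by (simp only: cong: imp_cong)
  moreover have "?K \<subseteq> ?I \<longleftrightarrow> ?R2"
    unfolding setcompr_subset_iff I B'_def by (simp only: imp_conjL)
  ultimately show ?thesis
    unfolding L R by (simp only: set_eq_subset)
qed

section \<open>The equational criterion for faithful flatness\<close>

text \<open>
  The equational criterion for flatness without coordinates: the finitely many linear relations
  that hold among the elements of \<open>G\<close> (those recorded by \<^const>\<open>partial_linear\<close>) come from
  relations over \<open>A\<close>. In this form it is visibly stable under composition.
\<close>

definition flat_lifting :: "('a, 'u) ring_scheme \<Rightarrow> ('b, 'v) ring_scheme \<Rightarrow> ('a \<Rightarrow> 'b) \<Rightarrow> bool"
  where "flat_lifting A B h \<longleftrightarrow>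
    (\<forall>G Q. finite G \<longrightarrow> G \<subseteq> carrier B \<longrightarrow> finite Q \<longrightarrow> Q \<subseteq> carrier A \<longrightarrow>
      (\<exists>ps. set ps \<subseteq> partial_linear A B h G Q \<times> carrier B \<and>
        (\<forall>b\<in>G. lsum B (\<lambda>p. h (fst p b) \<otimes>\<^bsub>B\<^esub> snd p) ps = b)))"

text \<open>Contrapositively, proper ideals of A have proper extensions to B. This is what
  faithfulness adds to flatness.\<close>

definition detects_unit :: "('a, 'u) ring_scheme \<Rightarrow> ('b, 'v) ring_scheme \<Rightarrow> ('a \<Rightarrow> 'b) \<Rightarrow> bool"
  where "detects_unit A B h \<longleftrightarrow>
    (\<forall>J. ideal J A \<longrightarrow> \<one>\<^bsub>B\<^esub> \<in> ext_ideal B h J \<longrightarrow> \<one>\<^bsub>A\<^esub> \<in> J)"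

text \<open>The relations to be respected come from \<open>G\<close>, the elements to be
  reconstructed from \<open>F\<close>. Applying the criterion to the union and discarding surplus
  linearity separates the two roles.\<close>

lemma flat_liftingD:
  assumes "flat_lifting A B h" "finite G" "G \<subseteq> carrier B" "finite F" "F \<subseteq> carrier B"
    "finite Q" "Q \<subseteq> carrier A"
  obtains ps where "set ps \<subseteq> partial_linear A B h G Q \<times> carrier B"
    "\<And>b. b \<in> F \<Longrightarrow> lsum B (\<lambda>p. h (fst p b) \<otimes>\<^bsub>B\<^esub> snd p) ps = b"
proof -
  have "finite (G \<union> F)" "G \<union> F \<subseteq> carrier B"
    using assms by auto
  with assms(1,6,7) obtain ps where "set ps \<subseteq> partial_linear A B h (G \<union> F) Q \<times> carrier B"
    "\<forall>b\<in>G \<union> F. lsum B (\<lambda>p. h (fst p b) \<otimes>\<^bsub>B\<^esub> snd p) ps = b"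
    unfolding flat_lifting_def by meson
  moreover have "partial_linear A B h (G \<union> F) Q \<subseteq> partial_linear A B h G Q"
    by (rule partial_linear_antimono) auto
  ultimately show ?thesis
    by (intro that[of ps]) auto
qed

section \<open>Sufficiency of the elementary conditions for faithful flatness\<close>

lemma (in ideal) lsum_mem: "(\<And>x. x \<in> set xs \<Longrightarrow> f x \<in> I) \<Longrightarrow> lsum R f xs \<in> I"
  by (induction xs) (auto simp: additive_subgroup.zero_closed additive_subgroup.a_closed is_additive_subgroup)

lemma (in ring_hom_cring) ext_ideal_ideal: "I \<subseteq> carrier R \<Longrightarrow> ideal (ext_ideal S h I) S"
  unfolding ext_ideal_def by (intro S.genideal_ideal) auto

lemma (in ring_hom_cring) ext_ideal_hom: "\<lbrakk>I \<subseteq> carrier R; a \<in> I\<rbrakk> \<Longrightarrow> h a \<in> ext_ideal S h I"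
  unfolding ext_ideal_def using S.genideal_self[of "h ` I"] by auto

text \<open>The lifting criterion reconstructs 1 as a sum of terms h(c_i(1)) b_i. If every c_i(1)
  lies in \<open>J\<close>, then 1 lies in JS, and detection of units pulls it back. In this way a
  claim known after multiplication by each c(1) becomes a claim about 1.\<close>

lemma (in ring_hom_cring) unit_mem_of_functionals:
  assumes "flat_lifting R S h" "detects_unit R S h" and J: "ideal J R"
    and "finite G" "G \<subseteq> carrier S" "finite Q" "Q \<subseteq> carrier R"
    and functionals: "\<And>c. c \<in> partial_linear R S h G Q \<Longrightarrow> c \<one>\<^bsub>S\<^esub> \<in> J"
  shows "\<one> \<in> J"
proof -
  obtain ps where ps: "set ps \<subseteq> partial_linear R S h G Q \<times> carrier S"
    "lsum S (\<lambda>p. h (fst p \<one>\<^bsub>S\<^esub>) \<otimes>\<^bsub>S\<^esub> snd p) ps = \<one>\<^bsub>S\<^esub>"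
    using flat_liftingD[OF assms(1,4,5), of "{\<one>\<^bsub>S\<^esub>}" Q] assms(6,7) by auto
  interpret J: ideal J R by fact
  have JR: "J \<subseteq> carrier R"
    using J.a_subset .
  interpret E: ideal "ext_ideal S h J" S
    using JR by (rule ext_ideal_ideal)
  have "lsum S (\<lambda>p. h (fst p \<one>\<^bsub>S\<^esub>) \<otimes>\<^bsub>S\<^esub> snd p) ps \<in> ext_ideal S h J"
    using ps(1) functionals ext_ideal_hom[OF JR]
    by (intro E.lsum_mem E.I_r_closed) auto
  then show ?thesis
    using assms(2) J ps(2) by (simp add: detects_unit_def)
qed

text \<open>Negatives come from the scalar -1. As 1 belongs to this ideal exactly when
  \<open>n\<close> belongs to \<open>L\<close>, it tests membership in the zero submodule and in the
  image of a map.\<close>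

lemma (in module) colon_ideal:
  assumes "n \<in> carrier M" "\<zero>\<^bsub>M\<^esub> \<in> L"
    and add: "\<And>x y. \<lbrakk>x \<in> L; y \<in> L\<rbrakk> \<Longrightarrow> x \<oplus>\<^bsub>M\<^esub> y \<in> L"
    and smult: "\<And>a x. \<lbrakk>a \<in> carrier R; x \<in> L\<rbrakk> \<Longrightarrow> a \<odot>\<^bsub>M\<^esub> x \<in> L"
  shows "ideal {a \<in> carrier R. a \<odot>\<^bsub>M\<^esub> n \<in> L} R" (is "ideal ?J R")
proof (rule idealI)
  show "ring R"
    by (rule R.ring_axioms)
  have mult: "b \<otimes> a \<in> ?J" if "a \<in> ?J" "b \<in> carrier R" for a b
    using that assms by (auto simp: smult_assoc1)
  show "b \<otimes> a \<in> ?J" "a \<otimes> b \<in> ?J" if "a \<in> ?J" "b \<in> carrier R" for a b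
    using mult[OF that] that R.m_comm by auto
  show "subgroup ?J (add_monoid R)"
  proof (rule group.subgroupI[OF R.a_group], goal_cases)
    case 2
    have "\<zero> \<in> ?J"
      using assms by simp
    then show ?case by blast
  next
    case (3 a)
    then have "(\<ominus> \<one>) \<otimes> a \<in> ?J"
      by (intro mult) auto
    then show ?case
      using 3 by (simp add: R.l_minus a_inv_def[symmetric])
  next
    case (4 a b)
    then show ?case
      using assms(1) by (auto simp: smult_l_distr add)
  qed auto
qed

context algebra_tensor
begin

text \<open>Replacing b by the sum of the h(c_i(b)) b_i lets the coefficients cross to the left
  factor, so x \<otimes> b becomes the sum of the c_i(b) x \<otimes> b_i. Regrouping by i leaves one
  simple tensor for each b_i.\<close>

lemma TK_lift:
  assumes zs: "set zs \<subseteq> carrier M \<times> carrier B"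
    and ps: "set ps \<subseteq> (carrier B \<rightarrow> carrier A) \<times> carrier B"
    and lift: "\<And>z. z \<in> set zs \<Longrightarrow> lsum B (\<lambda>p. h (fst p (snd z)) \<otimes>\<^bsub>B\<^esub> snd p) ps = snd z"
  shows "(\<Sum>z\<leftarrow>zs. frag_of z)
    - (\<Sum>p\<leftarrow>ps. frag_of (lsum M (\<lambda>z. fst p (snd z) \<odot>\<^bsub>M\<^esub> fst z) zs, snd p)) \<in> TK"
proof (rule TK_trans)
  have closed: "fst p b \<in> carrier A" if "p \<in> set ps" "b \<in> carrier B" for p b
    using that ps by (auto simp: Pi_iff)
  have closed_B: "snd p \<in> carrier B" if "p \<in> set ps" for p
    using that ps by auto
  have closed': "fst z \<in> carrier M" "snd z \<in> carrier B" if "z \<in> set zs" for z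
    using that zs by auto
  show "(\<Sum>z\<leftarrow>zs. frag_of z)
    - (\<Sum>z\<leftarrow>zs. \<Sum>p\<leftarrow>ps. frag_of (fst p (snd z) \<odot>\<^bsub>M\<^esub> fst z, snd p)) \<in> TK"
  proof (rule TK_sum_list, rule TK_trans)
    fix z assume z: "z \<in> set zs"
    have "frag_of (fst z, lsum B (\<lambda>p. h (fst p (snd z)) \<otimes>\<^bsub>B\<^esub> snd p) ps)
        - (\<Sum>p\<leftarrow>ps. frag_of (fst z, h (fst p (snd z)) \<otimes>\<^bsub>B\<^esub> snd p)) \<in> TK"
      by (intro TK_lsum_right) (simp_all add: closed closed_B closed'[OF z])
    then show "frag_of z - (\<Sum>p\<leftarrow>ps. frag_of (fst z, h (fst p (snd z)) \<otimes>\<^bsub>B\<^esub> snd p)) \<in> TK"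
      using lift[OF z] by simp
    show "(\<Sum>p\<leftarrow>ps. frag_of (fst z, h (fst p (snd z)) \<otimes>\<^bsub>B\<^esub> snd p))
        - (\<Sum>p\<leftarrow>ps. frag_of (fst p (snd z) \<odot>\<^bsub>M\<^esub> fst z, snd p)) \<in> TK"
      by (intro TK_sum_list TK_sym[OF TK_smult]) (simp_all add: closed closed_B closed'[OF z])
  qed
  show "(\<Sum>z\<leftarrow>zs. \<Sum>p\<leftarrow>ps. frag_of (fst p (snd z) \<odot>\<^bsub>M\<^esub> fst z, snd p))
    - (\<Sum>p\<leftarrow>ps. frag_of (lsum M (\<lambda>z. fst p (snd z) \<odot>\<^bsub>M\<^esub> fst z) zs, snd p)) \<in> TK"
    by (intro TK_lsum_swap_left) (simp_all add: closed closed_B closed')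
qed

end

lemma (in algebra_tensor_hom) tf_frags_map:
  "tf (\<Sum>p\<leftarrow>ps. frag_of p) = (\<Sum>p\<leftarrow>map (\<lambda>p. (f (fst p), snd p)) ps. frag_of p)"
  by (induction ps) (auto simp: frag_extend_add case_prod_beta)

text \<open>Lifting of relations carries exactness to the tensored sequence. For the converse, a
  relation involving x \<otimes> 1 is pushed to the original modules by functionals, and
  \<open>unit_mem_of_functionals\<close> removes the factors c(1).\<close>

theorem faithfully_flatI:
  fixes B :: "('b, 'v) ring_scheme"
  assumes hom: "ring_hom_cring A B h" and lift: "flat_lifting A B h" and detect: "detects_unit A B h"
  shows "faithfully_flat TYPE('m) A B h"
  unfolding faithfully_flat_def Let_def
proof (intro allI impI)
  fix M N P :: "('a, 'm) module" and f g
  assume modules: "module A M" "module A N" "module A P"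
    and f: "f \<in> mod_hom A M N" and g: "g \<in> mod_hom A N P"
  interpret ring_hom_cring A B h by fact
  have homs: "algebra_tensor_hom A B h M N f" "algebra_tensor_hom A B h N P g"
    using hom modules f g
    by (auto intro!: algebra_tensor_hom.intro algebra_tensor.intro algebra_tensor_hom_axioms.intro)
  interpret f: algebra_tensor_hom A B h M N f by fact
  interpret g: algebra_tensor_hom A B h N P g by fact
  have kernel: "a_kernel N P g = {x \<in> carrier N. g x = \<zero>\<^bsub>P\<^esub>}"
    by (simp add: a_kernel_def')
  show "f ` carrier M = a_kernel N P g \<longleftrightarrow>
    tensor_map A N (algebra_module B h) f ` carrier (tensor_product A M (algebra_module B h)) =
      kernel (tensor_product A N (algebra_module B h)) (tensor_product A P (algebra_module B h))
        (tensor_map A P (algebra_module B h) g)"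
    unfolding tensor_exact_iff[OF homs] kernel
  proof (intro iffI conjI allI impI)
    fix w :: "'m \<times> 'b \<Rightarrow>\<^sub>0 int"
    assume exact: "f ` carrier M = {x \<in> carrier N. g x = \<zero>\<^bsub>P\<^esub>}"
      and "Poly_Mapping.keys w \<subseteq> carrier M \<times> carrier B"
    from this(2) show "g.tf (f.tf w) \<in> g.cod.TK"
    proof (induction w rule: free_Abelian_group_induct[consumes 1, case_names zero diff one])
      case (one p)
      then have "g (f (fst p)) = \<zero>\<^bsub>P\<^esub>"
        using exact by (auto simp: image_def)
      then show ?case
        using one g.cod.TK_zero_left by (auto simp: case_prod_beta)
    qed (simp_all add: frag_extend_diff g.cod.TK_diff)
  next
    fix z :: "'m \<times> 'b \<Rightarrow>\<^sub>0 int"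
    assume exact: "f ` carrier M = {x \<in> carrier N. g x = \<zero>\<^bsub>P\<^esub>}"
      and z: "Poly_Mapping.keys z \<subseteq> carrier N \<times> carrier B" "g.tf z \<in> g.cod.TK"
    obtain zs where zs: "set zs \<subseteq> carrier N \<times> carrier B" "z - (\<Sum>p\<leftarrow>zs. frag_of p) \<in> f.cod.TK"
      using f.cod.tensor_list_repr[OF z(1)] .
    let ?gzs = "map (\<lambda>p. (g (fst p), snd p)) zs"
    have gzs: "set ?gzs \<subseteq> carrier P \<times> carrier B"
      using zs(1) g.f_closed by auto
    have "g.tf z - (\<Sum>p\<leftarrow>?gzs. frag_of p) \<in> g.cod.TK"
      using g.tf_TK[OF zs(2)] by (simp only: frag_extend_diff g.tf_frags_map)
    \<comment> \<open>Comparison with the empty list expresses that this sum of simple tensors is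
      zero, in the form that \<open>TK_functional_lists\<close> expects.\<close>
    then have gzs_TK: "(\<Sum>p\<leftarrow>?gzs. frag_of p) - (\<Sum>p\<leftarrow>[]. frag_of p) \<in> g.cod.TK"
      using z(2) g.cod.TK_cong by simp
    obtain G Q where GQ: "finite G" "G \<subseteq> carrier B" "finite Q" "Q \<subseteq> carrier A"
      and vanish: "\<And>c. c \<in> partial_linear A B h G Q
        \<Longrightarrow> lsum P (\<lambda>(x, b). c b \<odot>\<^bsub>P\<^esub> x) ?gzs = lsum P (\<lambda>(x, b). c b \<odot>\<^bsub>P\<^esub> x) []"
      by (rule g.cod.TK_functional_lists[OF gzs _ gzs_TK]) (simp, rule that)
    have "finite (snd ` set zs)" "snd ` set zs \<subseteq> carrier B"
      using zs(1) by auto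
    then obtain ps where ps: "set ps \<subseteq> partial_linear A B h G Q \<times> carrier B"
      and ps_lift: "\<And>b. b \<in> snd ` set zs \<Longrightarrow> lsum B (\<lambda>p. h (fst p b) \<otimes>\<^bsub>B\<^esub> snd p) ps = b"
      by (rule flat_liftingD[OF lift GQ(1,2) _ _ GQ(3,4)]) (rule that)
    have ps': "set ps \<subseteq> (carrier B \<rightarrow> carrier A) \<times> carrier B"
      using ps by (auto simp: partial_linear_def)
    \<comment> \<open>\<open>?n p\<close> is what the functional \<open>fst p\<close> extracts from
      \<open>zs\<close>. Its image under \<open>g\<close> is the same combination of the entries of
      \<open>?gzs\<close>, which is zero, so exactness yields a preimage in
      \<open>M\<close>.\<close>
    let ?n = "\<lambda>p. lsum N (\<lambda>z. fst p (snd z) \<odot>\<^bsub>N\<^esub> fst z) zs"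
    have "\<exists>x. x \<in> carrier M \<and> f x = ?n p" if p: "p \<in> set ps" for p
    proof -
      have "fst p \<in> carrier B \<rightarrow> carrier A"
        using subsetD[OF ps' p] by (simp only: mem_Times_iff)
      then have closed: "fst p (snd z) \<in> carrier A" "fst z \<in> carrier N" if "z \<in> set zs" for z
        using subsetD[OF zs(1) that] by (auto simp: mem_Times_iff Pi_iff)
      have "g (?n p) = lsum P (\<lambda>z. g (fst p (snd z) \<odot>\<^bsub>N\<^esub> fst z)) zs"
        using closed by (intro g.f_lsum) auto
      also have "\<dots> = lsum P (\<lambda>(x, b). fst p b \<odot>\<^bsub>P\<^esub> x) ?gzs"
        unfolding lsum_map using closed by (intro lsum_cong) (auto simp: g.f_smult)
      also have "\<dots> = \<zero>\<^bsub>P\<^esub>"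
        using vanish ps p by auto
      finally have "?n p \<in> f ` carrier M"
        unfolding exact using closed by (auto intro!: f.cod.M.lsum_closed)
      then show ?thesis by force
    qed
    then obtain x where x: "\<And>p. p \<in> set ps \<Longrightarrow> x p \<in> carrier M \<and> f (x p) = ?n p"
      by metis
    let ?w = "\<Sum>p\<leftarrow>map (\<lambda>p. (x p, snd p)) ps. frag_of p"
    have "f.tf ?w = (\<Sum>p\<leftarrow>ps. frag_of (?n p, snd p))"
      unfolding f.tf_frags_map using x by (auto simp: comp_def intro!: arg_cong[where f = sum_list])
    then have "(\<Sum>p\<leftarrow>zs. frag_of p) - f.tf ?w \<in> f.cod.TK"
      using f.cod.TK_lift[OF zs(1) ps'] ps_lift by simp
    then have "z - f.tf ?w \<in> f.cod.TK"
      using zs(2) f.cod.TK_trans by blast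
    moreover have "Poly_Mapping.keys ?w \<subseteq> carrier M \<times> carrier B"
      using x ps by (intro f.dom.keys_frags) auto
    ultimately show "\<exists>w. Poly_Mapping.keys w \<subseteq> carrier M \<times> carrier B \<and> z - f.tf w \<in> f.cod.TK"
      by blast
  next
    assume exact: "(\<forall>w. Poly_Mapping.keys w \<subseteq> carrier M \<times> carrier B \<longrightarrow> g.tf (f.tf w) \<in> g.cod.TK) \<and>
      (\<forall>z. Poly_Mapping.keys z \<subseteq> carrier N \<times> carrier B \<longrightarrow> g.tf z \<in> g.cod.TK \<longrightarrow>
        (\<exists>w. Poly_Mapping.keys w \<subseteq> carrier M \<times> carrier B \<and> z - f.tf w \<in> f.cod.TK))"
    have "g (f x) = \<zero>\<^bsub>P\<^esub>" if x: "x \<in> carrier M" for x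
    proof -
      let ?y = "g (f x)"
      have y: "?y \<in> carrier P"
        using x f.f_closed g.f_closed by blast
      have "g.tf (f.tf (frag_of (x, \<one>\<^bsub>B\<^esub>))) \<in> g.cod.TK"
        using exact x by (intro exact[THEN conjunct1, rule_format]) (simp add: keys_frag_of)
      then have y_TK: "(\<Sum>p\<leftarrow>[(?y, \<one>\<^bsub>B\<^esub>)]. frag_of p) - (\<Sum>p\<leftarrow>[]. frag_of p) \<in> g.cod.TK"
        by simp
      obtain G Q where GQ: "finite G" "G \<subseteq> carrier B" "finite Q" "Q \<subseteq> carrier A"
        and eq: "\<And>c. c \<in> partial_linear A B h G Q
          \<Longrightarrow> lsum P (\<lambda>(x, b). c b \<odot>\<^bsub>P\<^esub> x) [(?y, \<one>\<^bsub>B\<^esub>)] = lsum P (\<lambda>(x, b). c b \<odot>\<^bsub>P\<^esub> x) []"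
        by (rule g.cod.TK_functional_lists[OF _ _ y_TK]) (simp add: y, simp, rule that)
      \<comment> \<open>Each admissible \<open>c\<close> turns ?y \<otimes> 1 = 0 into c(1) ?y = 0,
        so c(1) lies in the annihilator of \<open>?y\<close>.\<close>
      have vanish: "c \<one>\<^bsub>B\<^esub> \<in> {a \<in> carrier A. a \<odot>\<^bsub>P\<^esub> ?y \<in> {\<zero>\<^bsub>P\<^esub>}}"
        if c: "c \<in> partial_linear A B h G Q" for c
      proof -
        have "c \<one>\<^bsub>B\<^esub> \<in> carrier A"
          using c by (auto simp: partial_linear_def)
        then show ?thesis
          using eq[OF c] y by simp
      qed
      have "ideal {a \<in> carrier A. a \<odot>\<^bsub>P\<^esub> ?y \<in> {\<zero>\<^bsub>P\<^esub>}} A"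
        using y by (intro g.cod.M.colon_ideal) auto
      then have "\<one>\<^bsub>A\<^esub> \<in> {a \<in> carrier A. a \<odot>\<^bsub>P\<^esub> ?y \<in> {\<zero>\<^bsub>P\<^esub>}}"
        by (rule unit_mem_of_functionals[OF lift detect _ GQ]) (rule vanish)
      with y show ?thesis
        by simp
    qed
    moreover have "n \<in> f ` carrier M" if n: "n \<in> carrier N" "g n = \<zero>\<^bsub>P\<^esub>" for n
    proof -
      have "g.tf (frag_of (n, \<one>\<^bsub>B\<^esub>)) \<in> g.cod.TK"
        using n g.cod.TK_zero_left by simp
      then obtain w where w: "Poly_Mapping.keys w \<subseteq> carrier M \<times> carrier B"
        "frag_of (n, \<one>\<^bsub>B\<^esub>) - f.tf w \<in> f.cod.TK"
        using exact[THEN conjunct2, rule_format, of "frag_of (n, \<one>\<^bsub>B\<^esub>)"] n by (auto simp: keys_frag_of)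
      obtain ws where ws: "set ws \<subseteq> carrier M \<times> carrier B" "w - (\<Sum>p\<leftarrow>ws. frag_of p) \<in> f.dom.TK"
        using f.dom.tensor_list_repr[OF w(1)] .
      let ?fws = "map (\<lambda>p. (f (fst p), snd p)) ws"
      have fws: "set ?fws \<subseteq> carrier N \<times> carrier B" "set [(n, \<one>\<^bsub>B\<^esub>)] \<subseteq> carrier N \<times> carrier B"
        using ws(1) f.f_closed n by auto
      have "f.tf w - (\<Sum>p\<leftarrow>?fws. frag_of p) \<in> f.cod.TK"
        using f.tf_TK[OF ws(2)] by (simp only: frag_extend_diff f.tf_frags_map)
      with w(2) have "frag_of (n, \<one>\<^bsub>B\<^esub>) - (\<Sum>p\<leftarrow>?fws. frag_of p) \<in> f.cod.TK"
        by (rule f.cod.TK_trans)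
      then have fws_TK: "(\<Sum>p\<leftarrow>[(n, \<one>\<^bsub>B\<^esub>)]. frag_of p) - (\<Sum>p\<leftarrow>?fws. frag_of p) \<in> f.cod.TK"
        by simp
      obtain G Q where GQ: "finite G" "G \<subseteq> carrier B" "finite Q" "Q \<subseteq> carrier A"
        and eq: "\<And>c. c \<in> partial_linear A B h G Q
          \<Longrightarrow> lsum N (\<lambda>(x, b). c b \<odot>\<^bsub>N\<^esub> x) [(n, \<one>\<^bsub>B\<^esub>)] = lsum N (\<lambda>(x, b). c b \<odot>\<^bsub>N\<^esub> x) ?fws"
        by (rule f.cod.TK_functional_lists[OF fws(2,1) fws_TK]) (rule that)
      \<comment> \<open>Applying \<open>c\<close> to the equation of n \<otimes> 1 with a sum of
        terms f(x) \<otimes> b shows that c(1) n is the image under \<open>f\<close> of the sum of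
        the c(b) x.\<close>
      have mem: "c \<one>\<^bsub>B\<^esub> \<in> {a \<in> carrier A. a \<odot>\<^bsub>N\<^esub> n \<in> f ` carrier M}"
        if c: "c \<in> partial_linear A B h G Q" for c
      proof -
        have closed: "c b \<in> carrier A" if "b \<in> carrier B" for b
          using that c by (auto simp: partial_linear_def)
        have "c \<one>\<^bsub>B\<^esub> \<odot>\<^bsub>N\<^esub> n = lsum N (\<lambda>(x, b). c b \<odot>\<^bsub>N\<^esub> x) ?fws"
          using eq[OF c] n closed by simp
        also have "\<dots> = lsum N (\<lambda>p. f (c (snd p) \<odot>\<^bsub>M\<^esub> fst p)) ws"
          unfolding lsum_map using ws(1) closed by (intro lsum_cong) (auto simp: f.f_smult)
        also have "\<dots> = f (lsum M (\<lambda>p. c (snd p) \<odot>\<^bsub>M\<^esub> fst p) ws)"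
          using ws(1) closed by (intro f.f_lsum[symmetric]) auto
        finally have "c \<one>\<^bsub>B\<^esub> \<odot>\<^bsub>N\<^esub> n = f (lsum M (\<lambda>p. c (snd p) \<odot>\<^bsub>M\<^esub> fst p) ws)" .
        moreover have "lsum M (\<lambda>p. c (snd p) \<odot>\<^bsub>M\<^esub> fst p) ws \<in> carrier M"
          using ws(1) closed by (intro f.dom.M.lsum_closed) auto
        ultimately show ?thesis
          using closed by auto
      qed
      have "ideal {a \<in> carrier A. a \<odot>\<^bsub>N\<^esub> n \<in> f ` carrier M} A"
      proof (rule f.cod.M.colon_ideal)
        show "\<zero>\<^bsub>N\<^esub> \<in> f ` carrier M"
          using f.f_zero by (metis f.dom.M.zero_closed imageI)
        show "x \<oplus>\<^bsub>N\<^esub> y \<in> f ` carrier M" if "x \<in> f ` carrier M" "y \<in> f ` carrier M" for x y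
          using that by (auto simp: f.f_add[symmetric])
        show "a \<odot>\<^bsub>N\<^esub> x \<in> f ` carrier M" if "a \<in> carrier A" "x \<in> f ` carrier M" for a x
          using that by (auto simp: f.f_smult[symmetric])
      qed fact
      then have "\<one>\<^bsub>A\<^esub> \<in> {a \<in> carrier A. a \<odot>\<^bsub>N\<^esub> n \<in> f ` carrier M}"
        by (rule unit_mem_of_functionals[OF lift detect _ GQ]) (rule mem)
      with n show ?thesis
        by simp
    qed
    ultimately show "f ` carrier M = {x \<in> carrier N. g x = \<zero>\<^bsub>P\<^esub>}"
      using f.f_closed by blast
  qed
qed

text \<open>
  Vectors in \<open>A\<^sup>n\<close> are extended by zeros to sequences, so that submodules of all \<open>A\<^sup>n\<close> live in
  one type.
\<close>

definition vecs :: "('a, 'u) ring_scheme \<Rightarrow> nat \<Rightarrow> (nat \<Rightarrow> 'a) set"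
  where "vecs A n = {p. \<forall>i. p i \<in> carrier A \<and> (i \<ge> n \<longrightarrow> p i = \<zero>\<^bsub>A\<^esub>)}"

text \<open>With the carrier as a parameter, a submodule and its ambient A^n share their operations,
  so the inclusion is literally \<open>id\<close>.\<close>

definition coord_module :: "('a, 'u) ring_scheme \<Rightarrow> (nat \<Rightarrow> 'a) set \<Rightarrow> ('a, nat \<Rightarrow> 'a) module"
  where "coord_module A L =
    \<lparr>carrier = L, monoid.mult = (\<lambda>p q. p), one = (\<lambda>i. \<zero>\<^bsub>A\<^esub>), ring.zero = (\<lambda>i. \<zero>\<^bsub>A\<^esub>),
     add = (\<lambda>p q i. p i \<oplus>\<^bsub>A\<^esub> q i), smult = (\<lambda>a p i. a \<otimes>\<^bsub>A\<^esub> p i)\<rparr>"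

lemma coord_module_simps [simp]:
  "carrier (coord_module A L) = L"
  "\<zero>\<^bsub>coord_module A L\<^esub> = (\<lambda>i. \<zero>\<^bsub>A\<^esub>)"
  "p \<oplus>\<^bsub>coord_module A L\<^esub> q = (\<lambda>i. p i \<oplus>\<^bsub>A\<^esub> q i)"
  "a \<odot>\<^bsub>coord_module A L\<^esub> p = (\<lambda>i. a \<otimes>\<^bsub>A\<^esub> p i)"
  by (simp_all add: coord_module_def)

lemma lsum_coord_module: "lsum (coord_module A L) u xs i = lsum A (\<lambda>x. u x i) xs"
  by (induction xs) auto

lemma (in cring) coord_module_module:
  assumes "L \<subseteq> vecs R n" "(\<lambda>i. \<zero>) \<in> L"
    and add: "\<And>p q. \<lbrakk>p \<in> L; q \<in> L\<rbrakk> \<Longrightarrow> (\<lambda>i. p i \<oplus> q i) \<in> L"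
    and smult: "\<And>a p. \<lbrakk>a \<in> carrier R; p \<in> L\<rbrakk> \<Longrightarrow> (\<lambda>i. a \<otimes> p i) \<in> L"
  shows "module R (coord_module R L)"
proof -
  have L: "p i \<in> carrier R" if "p \<in> L" for p i
    using that assms(1) by (auto simp: vecs_def)
  show ?thesis
  proof (rule moduleI)
    show "abelian_group (coord_module R L)"
    proof (rule abelian_groupI)
      fix p assume p: "p \<in> carrier (coord_module R L)"
      have "(\<lambda>i. (\<ominus> \<one>) \<otimes> p i) \<in> L"
        using p by (intro smult) auto
      moreover have "(\<ominus> \<one>) \<otimes> p i \<oplus> p i = \<zero>" for i
        using p L by (simp add: l_minus l_neg)
      ultimately show "\<exists>q\<in>carrier (coord_module R L). q \<oplus>\<^bsub>coord_module R L\<^esub> p = \<zero>\<^bsub>coord_module R L\<^esub>"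
        by (intro bexI[of _ "\<lambda>i. (\<ominus> \<one>) \<otimes> p i"]) auto
    qed (use assms L in \<open>auto simp: a_ac\<close>)
  qed (use assms L in \<open>auto simp: cring_axioms l_distr r_distr m_assoc\<close>)
qed

lemma (in cring) vecs_module: "module R (coord_module R (vecs R n))"
  by (rule coord_module_module[of _ n]) (auto simp: vecs_def)

definition unit_vec :: "('a, 'u) ring_scheme \<Rightarrow> nat \<Rightarrow> nat \<Rightarrow> 'a"
  where "unit_vec A i = (\<lambda>j. if j = i then \<one>\<^bsub>A\<^esub> else \<zero>\<^bsub>A\<^esub>)"

lemma (in cring) unit_vec_mem: "i < n \<Longrightarrow> unit_vec R i \<in> vecs R n"
  by (auto simp: unit_vec_def vecs_def)

lemma (in cring) vecs_expand:
  assumes "p \<in> vecs R n"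
  shows "lsum (coord_module R L) (\<lambda>i. p i \<odot>\<^bsub>coord_module R L\<^esub> unit_vec R i) [0..<n] = p"
proof
  fix j
  have p: "p i \<in> carrier R" "i \<ge> n \<Longrightarrow> p i = \<zero>" for i
    using assms by (auto simp: vecs_def)
  have "lsum (coord_module R L) (\<lambda>i. p i \<odot>\<^bsub>coord_module R L\<^esub> unit_vec R i) [0..<n] j
      = lsum R (\<lambda>i. if i = j then p i else \<zero>) [0..<n]"
    unfolding lsum_coord_module using p by (intro lsum_cong) (auto simp: unit_vec_def)
  also have "\<dots> = p j"
  proof (cases "j < n")
    case True
    then show ?thesis using p by (intro lsum_delta) auto
  next
    case False
    then have "lsum R (\<lambda>i. if i = j then p i else \<zero>) [0..<n] = \<zero>"
      by (intro lsum_zero) auto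
    then show ?thesis using False p by simp
  qed
  finally show "lsum (coord_module R L) (\<lambda>i. p i \<odot>\<^bsub>coord_module R L\<^esub> unit_vec R i) [0..<n] j = p j" .
qed

section \<open>Necessity of the elementary conditions for faithful flatness\<close>

context ring_hom_cring
begin

lemma algebra_tensor_vecs: "algebra_tensor R S h (coord_module R (vecs R n))"
  using R.vecs_module ring_hom_cring_axioms by (intro algebra_tensor.intro)

text \<open>Injectivity of R^m \<otimes> S \<rightarrow> S^m. Each left entry is expanded in unit
  vectors and its coordinates move to the right, so the tensor equals the sum of the e_i \<otimes>
  s_i, where s_i is the i-th coordinate of its image.\<close>

lemma vecs_tensor_zero:
  assumes ps: "set ps \<subseteq> vecs R m \<times> carrier S"
    and zero: "\<And>r. r < m \<Longrightarrow> lsum S (\<lambda>p. h (fst p r) \<otimes>\<^bsub>S\<^esub> snd p) ps = \<zero>\<^bsub>S\<^esub>"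
  shows "(\<Sum>p\<leftarrow>ps. frag_of p) \<in> tensor_kernel R (coord_module R (vecs R m)) (algebra_module S h)"
proof -
  let ?M = "coord_module R (vecs R m)"
  interpret T: algebra_tensor R S h ?M
    by (rule algebra_tensor_vecs)
  have closed: "fst p \<in> vecs R m" "fst p i \<in> carrier R" "snd p \<in> carrier S" if "p \<in> set ps" for p i
    using subsetD[OF ps that] by (auto simp: mem_Times_iff vecs_def)
  have unit: "unit_vec R i \<in> vecs R m" if "i \<in> set [0..<m]" for i
    using that by (intro R.unit_vec_mem) simp
  have "(\<Sum>p\<leftarrow>ps. frag_of p)
      - (\<Sum>p\<leftarrow>ps. \<Sum>i\<leftarrow>[0..<m]. frag_of (unit_vec R i, h (fst p i) \<otimes>\<^bsub>S\<^esub> snd p)) \<in> T.TK"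
  proof (rule T.TK_sum_list, rule T.TK_trans)
    fix p assume p: "p \<in> set ps"
    have "frag_of (lsum ?M (\<lambda>i. fst p i \<odot>\<^bsub>?M\<^esub> unit_vec R i) [0..<m], snd p)
        - (\<Sum>i\<leftarrow>[0..<m]. frag_of (fst p i \<odot>\<^bsub>?M\<^esub> unit_vec R i, snd p)) \<in> T.TK"
      using closed[OF p] unit by (intro T.TK_lsum_left T.M.smult_closed) auto
    then show "frag_of p - (\<Sum>i\<leftarrow>[0..<m]. frag_of (fst p i \<odot>\<^bsub>?M\<^esub> unit_vec R i, snd p)) \<in> T.TK"
      unfolding R.vecs_expand[OF closed(1)[OF p]] by simp
    show "(\<Sum>i\<leftarrow>[0..<m]. frag_of (fst p i \<odot>\<^bsub>?M\<^esub> unit_vec R i, snd p))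
        - (\<Sum>i\<leftarrow>[0..<m]. frag_of (unit_vec R i, h (fst p i) \<otimes>\<^bsub>S\<^esub> snd p)) \<in> T.TK"
      using closed[OF p] unit by (intro T.TK_sum_list T.TK_smult) auto
  qed
  moreover have "(\<Sum>p\<leftarrow>ps. \<Sum>i\<leftarrow>[0..<m]. frag_of (unit_vec R i, h (fst p i) \<otimes>\<^bsub>S\<^esub> snd p))
      - (\<Sum>i\<leftarrow>[0..<m]. frag_of (unit_vec R i, lsum S (\<lambda>p. h (fst p i) \<otimes>\<^bsub>S\<^esub> snd p) ps)) \<in> T.TK"
    using unit by (intro T.TK_lsum_swap_right) (simp_all add: closed)
  ultimately have "(\<Sum>p\<leftarrow>ps. frag_of p)
      - (\<Sum>i\<leftarrow>[0..<m]. frag_of (unit_vec R i, lsum S (\<lambda>p. h (fst p i) \<otimes>\<^bsub>S\<^esub> snd p) ps)) \<in> T.TK"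
    by (rule T.TK_trans)
  moreover have "(\<Sum>i\<leftarrow>[0..<m]. frag_of (unit_vec R i, lsum S (\<lambda>p. h (fst p i) \<otimes>\<^bsub>S\<^esub> snd p) ps))
      - (\<Sum>i\<leftarrow>[0..<m]. 0) \<in> T.TK"
    using unit zero T.TK_zero_right by (intro T.TK_sum_list) simp
  ultimately show ?thesis
    using T.TK_trans by fastforce
qed

text \<open>Give each element x_i that occurs in the relations a coordinate, let \<open>g\<close> be
  the matrix of the relations and \<open>K\<close> its kernel. The sum of the e_i \<otimes> x_i is
  killed by \<open>g\<close>, so exactness rewrites it with left entries in \<open>K\<close>. A
  vector in \<open>K\<close> is the table of values of a functional that respects the
  relations.\<close>

lemma flat_lifting_if_faithfully_flat:
  assumes ff: "faithfully_flat TYPE(nat \<Rightarrow> 'a) R S h"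
  shows "flat_lifting R S h"
  unfolding flat_lifting_def
proof (intro allI impI)
  fix G Q
  assume G: "finite G" "G \<subseteq> carrier S" and Q: "finite Q" "Q \<subseteq> carrier R"
  have Gc: "b \<in> carrier S" if "b \<in> G" for b
    using that G(2) by blast
  have Qc: "a \<in> carrier R" if "a \<in> Q" for a
    using that Q(2) by blast
  define rel where "rel = (\<lambda>(a, b, b'). h a \<otimes>\<^bsub>S\<^esub> b \<oplus>\<^bsub>S\<^esub> b')"
  \<comment> \<open>A functional also needs a coordinate for the value of each combination, hence
    the image of \<open>rel\<close> is adjoined to \<open>G\<close>.\<close>
  define Y where "Y = G \<union> rel ` (Q \<times> G \<times> G)"
  have Y: "finite Y" "Y \<subseteq> carrier S"
    using G Q by (auto simp: Y_def rel_def Gc Qc)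
  obtain xs where xs: "set xs = Y" "distinct xs"
    using finite_distinct_list[OF Y(1)] by blast
  obtain rs where rs: "set rs = Q \<times> G \<times> G"
    using finite_list[of "Q \<times> G \<times> G"] G Q by auto
  define n where "n = length xs"
  define m where "m = length rs"
  have "\<forall>b\<in>Y. \<exists>i<n. xs ! i = b"
    using xs(1) by (auto simp: in_set_conv_nth n_def)
  then obtain idx where idx: "\<And>b. b \<in> Y \<Longrightarrow> idx b < n" "\<And>b. b \<in> Y \<Longrightarrow> xs ! idx b = b"
    by metis
  have xs_closed: "xs ! i \<in> carrier S" if "i < n" for i
    using that xs(1) Y(2) nth_mem by (force simp: n_def)
  have rs_mem: "rs ! r \<in> Q \<times> G \<times> G" if "r < m" for r
    using that rs nth_mem by (force simp: m_def)
  \<comment> \<open>The defect of the relation (a, b, b') at the table of values \<open>p\<close>.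
    Writing \<ominus> \<one> as a coefficient instead of a subtraction makes linearity and the
    application of \<open>h\<close> uniform in all three terms.\<close>
  define val where "val = (\<lambda>(p :: nat \<Rightarrow> 'a) (a, b, b').
    a \<otimes> p (idx b) \<oplus> p (idx b') \<oplus> (\<ominus> \<one>) \<otimes> p (idx (rel (a, b, b'))))"
  define g where "g = (\<lambda>p r. if r < m then val p (rs ! r) else \<zero>)"
  define K where "K = {p \<in> vecs R n. g p = (\<lambda>i. \<zero>)}"
  \<comment> \<open>The table \<open>p\<close> as a total function on S, with value zero outside
    \<open>Y\<close>; all recorded relations take place inside \<open>Y\<close>.\<close>
  define cf where "cf = (\<lambda>(p :: nat \<Rightarrow> 'a) b. if b \<in> Y then p (idx b) else \<zero>)"
  let ?M = "coord_module R K" and ?N = "coord_module R (vecs R n)" and ?P = "coord_module R (vecs R m)"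
  have val_closed: "val p q \<in> carrier R" if "p \<in> vecs R n" "q \<in> Q \<times> G \<times> G" for p q
    using that by (auto simp: val_def vecs_def Qc)
  have g_closed: "g p \<in> vecs R m" if "p \<in> vecs R n" for p
    using that val_closed rs_mem by (auto simp: g_def vecs_def)
  have val_add: "val (\<lambda>i. p i \<oplus> p' i) q = val p q \<oplus> val p' q"
    if "p \<in> vecs R n" "p' \<in> vecs R n" "q \<in> Q \<times> G \<times> G" for p p' q
  proof -
    have lin: "a \<otimes> (u \<oplus> u') \<oplus> (v \<oplus> v') \<oplus> e \<otimes> (w \<oplus> w')
        = a \<otimes> u \<oplus> v \<oplus> e \<otimes> w \<oplus> (a \<otimes> u' \<oplus> v' \<oplus> e \<otimes> w')"
      if "{a, e, u, v, w, u', v', w'} \<subseteq> carrier R" for a e u v w u' v' w'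
      using that by (simp add: R.r_distr R.a_ac)
    show ?thesis
      using that by (auto simp: val_def vecs_def Qc intro!: lin)
  qed
  have val_smult: "val (\<lambda>i. a \<otimes> p i) q = a \<otimes> val p q"
    if "a \<in> carrier R" "p \<in> vecs R n" "q \<in> Q \<times> G \<times> G" for a p q
  proof -
    have lin: "b \<otimes> (a \<otimes> u) \<oplus> a \<otimes> v \<oplus> e \<otimes> (a \<otimes> w) = a \<otimes> (b \<otimes> u \<oplus> v \<oplus> e \<otimes> w)"
      if "{a, b, e, u, v, w} \<subseteq> carrier R" for a b e u v w
      using that by (simp add: R.r_distr R.m_lcomm)
    show ?thesis
      using that by (auto simp: val_def vecs_def Qc intro!: lin)
  qed
  have g_add: "g (\<lambda>i. p i \<oplus> p' i) = (\<lambda>r. g p r \<oplus> g p' r)"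
    if "p \<in> vecs R n" "p' \<in> vecs R n" for p p'
    using that rs_mem by (auto simp: g_def val_add)
  have g_smult: "g (\<lambda>i. a \<otimes> p i) = (\<lambda>r. a \<otimes> g p r)"
    if "a \<in> carrier R" "p \<in> vecs R n" for a p
    using that rs_mem by (auto simp: g_def val_smult)
  have vecs_add: "(\<lambda>i. p i \<oplus> p' i) \<in> vecs R k" if "p \<in> vecs R k" "p' \<in> vecs R k" for p p' k
    using that by (auto simp: vecs_def)
  have vecs_smult: "(\<lambda>i. a \<otimes> p i) \<in> vecs R k" if "a \<in> carrier R" "p \<in> vecs R k" for a p k
    using that by (auto simp: vecs_def)
  have vecs_zero: "(\<lambda>i. \<zero>) \<in> vecs R k" for k
    by (auto simp: vecs_def)
  have g_zero: "g (\<lambda>i. \<zero>) = (\<lambda>i. \<zero>)"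
    using g_smult[OF R.zero_closed vecs_zero] g_closed[OF vecs_zero] by (auto simp: vecs_def)
  have modM: "module R ?M"
    by (rule R.coord_module_module[of _ n])
      (auto simp: K_def g_zero g_add g_smult vecs_add vecs_smult vecs_zero)
  have f: "id \<in> mod_hom R ?M ?N" and g: "g \<in> mod_hom R ?N ?P"
    using g_closed by (auto simp: mod_hom_def K_def g_add g_smult)
  have homs: "algebra_tensor_hom R S h ?M ?N id" "algebra_tensor_hom R S h ?N ?P g"
    using modM R.vecs_module f g ring_hom_cring_axioms
    by (auto intro!: algebra_tensor_hom.intro algebra_tensor.intro algebra_tensor_hom_axioms.intro)
  interpret f: algebra_tensor_hom R S h ?M ?N id by fact
  interpret g: algebra_tensor_hom R S h ?N ?P g by fact
  have "id ` carrier ?M = a_kernel ?N ?P g"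
    by (auto simp: a_kernel_def' K_def)
  with ff modM f g have exact: "tensor_map R ?N (algebra_module S h) id ` carrier (tensor_product R ?M (algebra_module S h)) =
      kernel (tensor_product R ?N (algebra_module S h)) (tensor_product R ?P (algebra_module S h))
        (tensor_map R ?P (algebra_module S h) g)"
    unfolding faithfully_flat_def Let_def by (metis R.vecs_module)
  \<comment> \<open>The tautological tensor, whose j-th coordinate is x_j itself.\<close>
  define zs where "zs = map (\<lambda>i. (unit_vec R i, xs ! i)) [0..<n]"
  have zs: "set zs \<subseteq> carrier ?N \<times> carrier S"
    using xs_closed by (auto simp: zs_def R.unit_vec_mem)
  have coord: "lsum S (\<lambda>i. h (unit_vec R i j) \<otimes>\<^bsub>S\<^esub> xs ! i) [0..<n] = xs ! j" if "j < n" for j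
  proof -
    have "lsum S (\<lambda>i. h (unit_vec R i j) \<otimes>\<^bsub>S\<^esub> xs ! i) [0..<n]
        = lsum S (\<lambda>i. if i = j then xs ! i else \<zero>\<^bsub>S\<^esub>) [0..<n]"
      using xs_closed by (intro lsum_cong) (auto simp: unit_vec_def)
    also have "\<dots> = xs ! j"
      using that xs_closed by (intro S.lsum_delta) auto
    finally show ?thesis .
  qed
  have "g.tf (\<Sum>p\<leftarrow>zs. frag_of p) \<in> g.cod.TK"
    unfolding g.tf_frags_map
  proof (rule vecs_tensor_zero)
    show "set (map (\<lambda>p. (g (fst p), snd p)) zs) \<subseteq> vecs R m \<times> carrier S"
      using zs g_closed by auto
    fix r assume r: "r < m"
    obtain a b b' where q: "rs ! r = (a, b, b')" "a \<in> Q" "b \<in> G" "b' \<in> G"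
      using rs_mem[OF r] by auto
    have mem: "b \<in> Y" "b' \<in> Y" "rel (a, b, b') \<in> Y"
      using q by (auto simp: Y_def)
    have a: "a \<in> carrier R"
      using q Qc by auto
    have u: "unit_vec R i j \<in> carrier R" for i j
      by (simp add: unit_vec_def)
    let ?s = "\<lambda>c. lsum S (\<lambda>i. h (unit_vec R i (idx c)) \<otimes>\<^bsub>S\<^esub> xs ! i) [0..<n]"
    have closed: "h (unit_vec R i j) \<otimes>\<^bsub>S\<^esub> xs ! i \<in> carrier S" if "i \<in> set [0..<n]" for i j
      using that u xs_closed by simp
    have mult: "lsum S (\<lambda>i. c \<otimes>\<^bsub>S\<^esub> (h (unit_vec R i j) \<otimes>\<^bsub>S\<^esub> xs ! i)) [0..<n]
        = c \<otimes>\<^bsub>S\<^esub> lsum S (\<lambda>i. h (unit_vec R i j) \<otimes>\<^bsub>S\<^esub> xs ! i) [0..<n]" if "c \<in> carrier S" for c j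
      using that closed by (intro lsum_hom[symmetric]) (auto simp: S.r_distr S.abelian_monoid_axioms)
    have "lsum S (\<lambda>p. h (fst p r) \<otimes>\<^bsub>S\<^esub> snd p) (map (\<lambda>p. (g (fst p), snd p)) zs)
        = lsum S (\<lambda>i. h a \<otimes>\<^bsub>S\<^esub> (h (unit_vec R i (idx b)) \<otimes>\<^bsub>S\<^esub> xs ! i)
            \<oplus>\<^bsub>S\<^esub> h (unit_vec R i (idx b')) \<otimes>\<^bsub>S\<^esub> xs ! i
            \<oplus>\<^bsub>S\<^esub> h (\<ominus> \<one>) \<otimes>\<^bsub>S\<^esub> (h (unit_vec R i (idx (rel (a, b, b')))) \<otimes>\<^bsub>S\<^esub> xs ! i)) [0..<n]"
      unfolding zs_def map_map lsum_map using r u a xs_closed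
      by (intro lsum_cong) (simp add: g_def val_def q(1) lsum_map S.l_distr S.m_assoc)
    also have "\<dots> = h a \<otimes>\<^bsub>S\<^esub> ?s b \<oplus>\<^bsub>S\<^esub> ?s b' \<oplus>\<^bsub>S\<^esub> h (\<ominus> \<one>) \<otimes>\<^bsub>S\<^esub> ?s (rel (a, b, b'))"
      using closed a by (simp add: S.lsum_add mult del: set_upt)
    also have "\<dots> = h a \<otimes>\<^bsub>S\<^esub> b \<oplus>\<^bsub>S\<^esub> b' \<oplus>\<^bsub>S\<^esub> h (\<ominus> \<one>) \<otimes>\<^bsub>S\<^esub> rel (a, b, b')"
      using mem by (simp add: coord idx)
    also have "\<dots> = \<zero>\<^bsub>S\<^esub>"
      using a q(3,4) by (simp add: rel_def Gc S.l_minus S.r_neg)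
    finally show "lsum S (\<lambda>p. h (fst p r) \<otimes>\<^bsub>S\<^esub> snd p) (map (\<lambda>p. (g (fst p), snd p)) zs) = \<zero>\<^bsub>S\<^esub>" .
  qed
  then obtain w where w: "Poly_Mapping.keys w \<subseteq> carrier ?M \<times> carrier S"
    "(\<Sum>p\<leftarrow>zs. frag_of p) - f.tf w \<in> f.cod.TK"
    using exact f.cod.keys_frags[OF zs] unfolding tensor_exact_iff[OF homs] by blast
  obtain ws where ws: "set ws \<subseteq> carrier ?M \<times> carrier S" "w - (\<Sum>p\<leftarrow>ws. frag_of p) \<in> f.dom.TK"
    using f.dom.tensor_list_repr[OF w(1)] .
  have ws': "set ws \<subseteq> carrier ?N \<times> carrier S"
    using ws(1) by (auto simp: K_def)
  have "f.tf w - (\<Sum>p\<leftarrow>ws. frag_of p) \<in> f.cod.TK"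
    using f.tf_TK[OF ws(2)] by (simp only: frag_extend_diff f.tf_frags_map) simp
  with w(2) have diff: "(\<Sum>p\<leftarrow>zs. frag_of p) - (\<Sum>p\<leftarrow>ws. frag_of p) \<in> f.cod.TK"
    by (rule f.cod.TK_trans)
  \<comment> \<open>The j-th coordinate of both representations. For \<open>zs\<close> and j = idx b
    it is b, so \<open>ws\<close> reconstructs every element of \<open>Y\<close> from tables in
    \<open>K\<close>.\<close>
  have eq: "lsum S (\<lambda>(x, b). h (x j) \<otimes>\<^bsub>S\<^esub> b) zs = lsum S (\<lambda>(x, b). h (x j) \<otimes>\<^bsub>S\<^esub> b) ws" for j
    by (rule f.cod.TK_balanced[OF S.abelian_group_axioms _ _ _ _ zs ws' diff])
      (auto simp: vecs_def S.l_distr S.r_distr S.m_ac)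
  let ?ps = "map (\<lambda>p. (cf (fst p), snd p)) ws"
  show "\<exists>ps. set ps \<subseteq> partial_linear R S h G Q \<times> carrier S \<and>
    (\<forall>b\<in>G. lsum S (\<lambda>p. h (fst p b) \<otimes>\<^bsub>S\<^esub> snd p) ps = b)"
  proof (intro exI[of _ ?ps] conjI ballI)
    fix b assume "b \<in> G"
    then have b: "b \<in> Y" by (simp add: Y_def)
    have "lsum S (\<lambda>p. h (fst p b) \<otimes>\<^bsub>S\<^esub> snd p) ?ps = lsum S (\<lambda>(x, y). h (x (idx b)) \<otimes>\<^bsub>S\<^esub> y) ws"
      unfolding lsum_map using b by (intro lsum_cong) (auto simp: cf_def)
    also have "\<dots> = b"
      unfolding eq[symmetric] zs_def lsum_map using coord[OF idx(1)[OF b]] idx(2)[OF b] by simp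
    finally show "lsum S (\<lambda>p. h (fst p b) \<otimes>\<^bsub>S\<^esub> snd p) ?ps = b" .
  next
    have "cf p \<in> partial_linear R S h G Q" if p: "p \<in> K" for p
      unfolding partial_linear_def mem_Collect_eq
    proof (intro conjI ballI)
      have p_closed: "p i \<in> carrier R" for i
        using p by (auto simp: K_def vecs_def)
      then show "cf p \<in> carrier S \<rightarrow> carrier R"
        by (auto simp: cf_def)
      fix a b b' assume q: "a \<in> Q" "b \<in> G" "b' \<in> G"
      then obtain r where r: "r < m" "rs ! r = (a, b, b')"
        using rs by (metis SigmaI in_set_conv_nth m_def)
      have "g p r = \<zero>"
        using p by (simp add: K_def)
      then have "a \<otimes> p (idx b) \<oplus> p (idx b') \<ominus> p (idx (rel (a, b, b'))) = \<zero>"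
        using r Qc[OF q(1)] p_closed by (simp add: g_def val_def R.l_minus R.minus_eq)
      then have "a \<otimes> p (idx b) \<oplus> p (idx b') = p (idx (rel (a, b, b')))"
        by (rule R.minus_zero_imp_eq) (simp_all add: Qc[OF q(1)] p_closed)
      moreover have "b \<in> Y" "b' \<in> Y" "rel (a, b, b') \<in> Y"
        using q by (auto simp: Y_def)
      ultimately show "cf p (h a \<otimes>\<^bsub>S\<^esub> b \<oplus>\<^bsub>S\<^esub> b') = a \<otimes> cf p b \<oplus> cf p b'"
        by (simp add: cf_def rel_def)
    qed
    then show "set ?ps \<subseteq> partial_linear R S h G Q \<times> carrier S"
      using ws(1) by auto
  qed
qed

text \<open>The test sequence is J \<rightarrow> R \<rightarrow> R with second map zero. If 1 lies
  in JS, then J \<otimes> S \<rightarrow> R \<otimes> S is onto and the tensored sequence is exact;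
  faithfulness then makes J \<rightarrow> R onto.\<close>

lemma detects_unit_if_faithfully_flat:
  assumes ff: "faithfully_flat TYPE(nat \<Rightarrow> 'a) R S h"
  shows "detects_unit R S h"
  unfolding detects_unit_def
proof (intro allI impI)
  fix J assume J: "ideal J R" and one: "\<one>\<^bsub>S\<^esub> \<in> ext_ideal S h J"
  interpret J: ideal J R by fact
  \<comment> \<open>\<open>J\<close> and R are realized by vectors of length one, to have the
    element type of the test modules.\<close>
  define K where "K = {p \<in> vecs R (Suc 0). p 0 \<in> J}"
  define g where "g = (\<lambda>(p :: nat \<Rightarrow> 'a) (i :: nat). \<zero>)"
  let ?M = "coord_module R K" and ?N = "coord_module R (vecs R (Suc 0))"
  let ?e = "unit_vec R 0"
  have modM: "module R ?M"
    by (rule R.coord_module_module[of _ "Suc 0"]) (auto simp: K_def vecs_def J.I_l_closed)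
  have f: "id \<in> mod_hom R ?M ?N" and g: "g \<in> mod_hom R ?N ?N"
    by (auto simp: mod_hom_def K_def g_def vecs_def)
  have homs: "algebra_tensor_hom R S h ?M ?N id" "algebra_tensor_hom R S h ?N ?N g"
    using modM R.vecs_module f g ring_hom_cring_axioms
    by (auto intro!: algebra_tensor_hom.intro algebra_tensor.intro algebra_tensor_hom_axioms.intro)
  interpret f: algebra_tensor_hom R S h ?M ?N id by fact
  interpret g: algebra_tensor_hom R S h ?N ?N g by fact
  have e: "?e \<in> vecs R (Suc 0)"
    by (simp add: R.unit_vec_mem)
  define Im where "Im = {z. \<exists>w. Poly_Mapping.keys w \<subseteq> carrier ?M \<times> carrier S \<and> z - f.tf w \<in> f.cod.TK}"
  have Im_frag: "frag_of (p, b) \<in> Im" if "p \<in> K" "b \<in> carrier S" for p b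
    unfolding Im_def using that by (intro CollectI exI[of _ "frag_of (p, b)"]) (simp add: keys_frag_of)
  have Im_add: "x + y \<in> Im" if "x \<in> Im" "y \<in> Im" for x y
  proof -
    obtain v w where v: "Poly_Mapping.keys v \<subseteq> carrier ?M \<times> carrier S" "x - f.tf v \<in> f.cod.TK"
      and w: "Poly_Mapping.keys w \<subseteq> carrier ?M \<times> carrier S" "y - f.tf w \<in> f.cod.TK"
      using \<open>x \<in> Im\<close> \<open>y \<in> Im\<close> by (auto simp: Im_def)
    have "Poly_Mapping.keys (v + w) \<subseteq> carrier ?M \<times> carrier S"
      using keys_add[of v w] v(1) w(1) by (meson Un_least subset_trans)
    moreover have "(x + y) - f.tf (v + w) \<in> f.cod.TK"
      using f.cod.TK_add[OF v(2) w(2)] by (simp add: frag_extend_add algebra_simps)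
    ultimately show ?thesis
      unfolding Im_def by blast
  qed
  have Im_cong: "x \<in> Im" if "x - y \<in> f.cod.TK" "y \<in> Im" for x y
    using that f.cod.TK_trans unfolding Im_def by blast
  \<comment> \<open>The extra factor \<open>b'\<close> builds closure under multiplication into
    \<open>L\<close>. Once \<open>L\<close> is an ideal containing h(J), it contains JS and in
    particular 1.\<close>
  define L where "L = {b \<in> carrier S. \<forall>b'\<in>carrier S. frag_of (?e, b \<otimes>\<^bsub>S\<^esub> b') \<in> Im}"
  have L_mult: "b \<otimes>\<^bsub>S\<^esub> c \<in> L" "c \<otimes>\<^bsub>S\<^esub> b \<in> L" if "b \<in> L" "c \<in> carrier S" for b c
  proof -
    show "b \<otimes>\<^bsub>S\<^esub> c \<in> L"
      using that by (auto simp: L_def S.m_assoc)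
    then show "c \<otimes>\<^bsub>S\<^esub> b \<in> L"
      using that S.m_comm by (auto simp: L_def)
  qed
  have hJ: "h a \<in> L" if a: "a \<in> J" for a
  proof -
    have aR: "a \<in> carrier R" using a J.a_subset by auto
    have "frag_of (?e, h a \<otimes>\<^bsub>S\<^esub> b) \<in> Im" if b: "b \<in> carrier S" for b
    proof (rule Im_cong)
      show "frag_of (?e, h a \<otimes>\<^bsub>S\<^esub> b) - frag_of (a \<odot>\<^bsub>?N\<^esub> ?e, b) \<in> f.cod.TK"
        using f.cod.TK_smult[of a ?e b] aR b e f.cod.TK_sym by simp
      show "frag_of (a \<odot>\<^bsub>?N\<^esub> ?e, b) \<in> Im"
        using a aR b by (intro Im_frag) (auto simp: K_def vecs_def unit_vec_def)
    qed
    then show ?thesis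
      using aR by (auto simp: L_def)
  qed
  have "ideal L S"
  proof (rule idealI)
    show "ring S" by (rule S.ring_axioms)
    show "subgroup L (add_monoid S)"
    proof (rule group.subgroupI[OF S.a_group], goal_cases)
      case 1
      show ?case by (auto simp: L_def)
    next
      case 2
      have "h \<zero> \<in> L" by (rule hJ) simp
      then show ?case by blast
    next
      case (3 b)
      then have "(\<ominus>\<^bsub>S\<^esub> \<one>\<^bsub>S\<^esub>) \<otimes>\<^bsub>S\<^esub> b \<in> L"
        by (intro L_mult) auto
      moreover have "b \<in> carrier S"
        using 3 by (auto simp: L_def)
      ultimately show ?case
        by (simp add: S.l_minus a_inv_def[symmetric])
    next
      case (4 b c)
      have "frag_of (?e, (b \<oplus>\<^bsub>S\<^esub> c) \<otimes>\<^bsub>S\<^esub> b') \<in> Im" if b': "b' \<in> carrier S" for b'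
      proof (rule Im_cong)
        show "frag_of (?e, (b \<oplus>\<^bsub>S\<^esub> c) \<otimes>\<^bsub>S\<^esub> b')
            - (frag_of (?e, b \<otimes>\<^bsub>S\<^esub> b') + frag_of (?e, c \<otimes>\<^bsub>S\<^esub> b')) \<in> f.cod.TK"
          using 4 b' e f.cod.TK_add_right[of ?e "b \<otimes>\<^bsub>S\<^esub> b'" "c \<otimes>\<^bsub>S\<^esub> b'"]
          by (simp add: L_def S.l_distr)
        show "frag_of (?e, b \<otimes>\<^bsub>S\<^esub> b') + frag_of (?e, c \<otimes>\<^bsub>S\<^esub> b') \<in> Im"
          using 4 b' by (intro Im_add) (auto simp: L_def)
      qed
      then show ?case
        using 4 by (auto simp: L_def)
    qed
  qed (use L_mult in auto)
  then have "ext_ideal S h J \<subseteq> L"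
    unfolding ext_ideal_def using hJ by (intro S.genideal_minimal) auto
  with one have "\<one>\<^bsub>S\<^esub> \<in> L" by blast
  then have eIm: "frag_of (?e, b) \<in> Im" if "b \<in> carrier S" for b
    using that by (auto simp: L_def)
  \<comment> \<open>Every vector of length one is a multiple of \<open>?e\<close>, and the scalar
    can be moved to the right factor.\<close>
  have all_Im: "frag_of (p, b) \<in> Im" if p: "p \<in> vecs R (Suc 0)" and b: "b \<in> carrier S" for p b
  proof (rule Im_cong)
    have p0: "p 0 \<in> carrier R" using p by (auto simp: vecs_def)
    have "p 0 \<odot>\<^bsub>?N\<^esub> ?e = p"
    proof
      show "(p 0 \<odot>\<^bsub>?N\<^esub> ?e) i = p i" for i
        using p by (cases i) (auto simp: vecs_def unit_vec_def)
    qed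
    then show "frag_of (p, b) - frag_of (?e, h (p 0) \<otimes>\<^bsub>S\<^esub> b) \<in> f.cod.TK"
      using f.cod.TK_smult[of "p 0" ?e b] p0 b e by simp
    show "frag_of (?e, h (p 0) \<otimes>\<^bsub>S\<^esub> b) \<in> Im"
      using p0 b by (intro eIm) simp
  qed
  have "tensor_map R ?N (algebra_module S h) id ` carrier (tensor_product R ?M (algebra_module S h)) =
      kernel (tensor_product R ?N (algebra_module S h)) (tensor_product R ?N (algebra_module S h))
        (tensor_map R ?N (algebra_module S h) g)"
    unfolding tensor_exact_iff[OF homs]
  proof (intro conjI allI impI)
    fix w :: "(nat \<Rightarrow> 'a) \<times> 'c \<Rightarrow>\<^sub>0 int"
    assume "Poly_Mapping.keys w \<subseteq> carrier ?M \<times> carrier S"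
    then show "g.tf (f.tf w) \<in> f.cod.TK"
    proof (induction w rule: free_Abelian_group_induct[consumes 1, case_names zero diff one])
      case (one p)
      then show ?case
        using f.cod.TK_zero_left by (auto simp: case_prod_beta g_def)
    qed (simp_all add: frag_extend_diff f.cod.TK_diff)
  next
    fix z :: "(nat \<Rightarrow> 'a) \<times> 'c \<Rightarrow>\<^sub>0 int"
    assume "Poly_Mapping.keys z \<subseteq> carrier ?N \<times> carrier S"
    then obtain zs where zs: "set zs \<subseteq> carrier ?N \<times> carrier S" "z - (\<Sum>p\<leftarrow>zs. frag_of p) \<in> f.cod.TK"
      using f.cod.tensor_list_repr by blast
    have "(\<Sum>p\<leftarrow>zs. frag_of p) \<in> Im"
      using zs(1)
    proof (induction zs)
      case Nil
      show ?case
        unfolding Im_def by (intro CollectI exI[of _ 0]) simp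
    next
      case (Cons p zs)
      then show ?case
        using all_Im[of "fst p" "snd p"] by (auto intro!: Im_add)
    qed
    then have "z \<in> Im"
      using zs(2) Im_cong by blast
    then show "\<exists>w. Poly_Mapping.keys w \<subseteq> carrier ?M \<times> carrier S \<and> z - f.tf w \<in> f.cod.TK"
      unfolding Im_def by blast
  qed
  with ff modM f g have "id ` carrier ?M = a_kernel ?N ?N g"
    unfolding faithfully_flat_def Let_def by (metis R.vecs_module)
  then have "?e \<in> K"
    using e by (auto simp: a_kernel_def' g_def)
  then show "\<one> \<in> J"
    by (simp add: K_def unit_vec_def)
qed

end

section \<open>Localization\<close>

locale mult_set = cring R + submonoid W R for R (structure) and W
begin

abbreviation "lfrac \<equiv> loc_frac R W"

lemma W_carrier [simp, intro]: "s \<in> W \<Longrightarrow> s \<in> carrier R"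
  using subset by blast

lemma W_mult [simp, intro]: "\<lbrakk>s \<in> W; t \<in> W\<rbrakk> \<Longrightarrow> s \<otimes> t \<in> W"
  and W_one [simp, intro]: "\<one> \<in> W"
  by (auto intro: m_closed one_closed)

lemma loc_rel_iff:
  "((a, s), (b, t)) \<in> loc_rel R W \<longleftrightarrow>
    a \<in> carrier R \<and> s \<in> W \<and> b \<in> carrier R \<and> t \<in> W \<and>
    (\<exists>v\<in>W. v \<otimes> (a \<otimes> t) = v \<otimes> (b \<otimes> s))"
proof -
  have "v \<otimes> (a \<otimes> t \<ominus> b \<otimes> s) = \<zero> \<longleftrightarrow> v \<otimes> (a \<otimes> t) = v \<otimes> (b \<otimes> s)"
    if "a \<in> carrier R" "s \<in> W" "b \<in> carrier R" "t \<in> W" "v \<in> W" for v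
  proof -
    have "v \<otimes> (a \<otimes> t \<ominus> b \<otimes> s) = v \<otimes> (a \<otimes> t) \<ominus> v \<otimes> (b \<otimes> s)"
      using that by (simp add: minus_eq r_distr r_minus)
    then show ?thesis
      using that by simp
  qed
  then show ?thesis
    by (auto simp: loc_rel_def)
qed

lemma loc_rel_equiv: "equiv (carrier R \<times> W) (loc_rel R W)"
proof (rule equivI)
  show "loc_rel R W \<subseteq> (carrier R \<times> W) \<times> (carrier R \<times> W)"
    by (auto simp: loc_rel_def)
  show "refl_on (carrier R \<times> W) (loc_rel R W)"
    by (auto simp: refl_on_def loc_rel_iff)
  show "sym (loc_rel R W)"
    by (rule symI) (clarsimp simp: loc_rel_iff, metis)
  show "trans (loc_rel R W)"
  proof (rule transI, clarsimp simp: loc_rel_iff)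
    fix a s b t c u v w
    assume *: "a \<in> carrier R" "b \<in> carrier R" "c \<in> carrier R" "s \<in> W" "t \<in> W" "u \<in> W" "v \<in> W" "w \<in> W"
      and 1: "v \<otimes> (a \<otimes> t) = v \<otimes> (b \<otimes> s)" and 2: "w \<otimes> (b \<otimes> u) = w \<otimes> (c \<otimes> t)"
    \<comment> \<open>Besides \<open>v\<close> and \<open>w\<close> the multiplier contains the
      middle denominator \<open>t\<close>: only after multiplication by it can the two equations be
      chained.\<close>
    have "(v \<otimes> w \<otimes> t) \<otimes> (a \<otimes> u) = (v \<otimes> (a \<otimes> t)) \<otimes> (w \<otimes> u)"
      using * by (simp add: m_ac)
    also have "\<dots> = (w \<otimes> (b \<otimes> u)) \<otimes> (v \<otimes> s)"
      unfolding 1 using * by (simp add: m_ac)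
    also have "\<dots> = (v \<otimes> w \<otimes> t) \<otimes> (c \<otimes> s)"
      unfolding 2 using * by (simp add: m_ac)
    finally show "\<exists>v\<in>W. v \<otimes> (a \<otimes> u) = v \<otimes> (c \<otimes> s)"
      using * by (intro bexI[of _ "v \<otimes> w \<otimes> t"]) auto
  qed
qed

lemma frac_eq_iff:
  assumes "a \<in> carrier R" "s \<in> W" "b \<in> carrier R" "t \<in> W"
  shows "lfrac a s = lfrac b t \<longleftrightarrow> (\<exists>v\<in>W. v \<otimes> (a \<otimes> t) = v \<otimes> (b \<otimes> s))"
  using assms eq_equiv_class_iff[OF loc_rel_equiv, of "(a, s)" "(b, t)"]
  by (simp add: loc_frac_def loc_rel_iff)

lemma frac_eqI:
  assumes "a \<in> carrier R" "s \<in> W" "b \<in> carrier R" "t \<in> W" "a \<otimes> t = b \<otimes> s"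
  shows "lfrac a s = lfrac b t"
  using assms by (auto simp: frac_eq_iff)

lemma frac_mem_iff:
  assumes "a \<in> carrier R" "s \<in> W"
  shows "(b, t) \<in> lfrac a s \<longleftrightarrow> b \<in> carrier R \<and> t \<in> W \<and> lfrac a s = lfrac b t"
proof -
  have "(b, t) \<in> lfrac a s \<longleftrightarrow> ((a, s), (b, t)) \<in> loc_rel R W"
    by (simp add: loc_frac_def)
  then show ?thesis
    using assms frac_eq_iff[of a s b t] by (auto simp: loc_rel_iff)
qed

abbreviation "L \<equiv> localization R W"

lemma carrier_L: "carrier L = {lfrac a s | a s. a \<in> carrier R \<and> s \<in> W}"
  by (auto simp: localization_def quotient_def loc_frac_def)

lemma frac_closed [simp, intro]: "\<lbrakk>a \<in> carrier R; s \<in> W\<rbrakk> \<Longrightarrow> lfrac a s \<in> carrier L"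
  by (auto simp: carrier_L)

lemma zero_L: "\<zero>\<^bsub>L\<^esub> = lfrac \<zero> \<one>" and one_L: "\<one>\<^bsub>L\<^esub> = lfrac \<one> \<one>"
  by (simp_all add: localization_def)

text \<open>The operations of the localization are unions over all representatives. A formula that
  is constant on the two classes makes such a union collapse to a single value.\<close>

lemma frac_UN:
  assumes a: "a \<in> carrier R" "s \<in> W" "b \<in> carrier R" "t \<in> W"
    and F: "\<And>a' s' b' t'. \<lbrakk>a' \<in> carrier R; s' \<in> W; b' \<in> carrier R; t' \<in> W;
      lfrac a s = lfrac a' s'; lfrac b t = lfrac b' t'\<rbrakk> \<Longrightarrow> F a' s' b' t' = F a s b t"
  shows "(\<Union>(a, s)\<in>lfrac a s. \<Union>(b, t)\<in>lfrac b t. F a s b t) = F a s b t"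
proof -
  have "(a, s) \<in> lfrac a s" "(b, t) \<in> lfrac b t"
    using a by (auto simp: frac_mem_iff)
  moreover have "F a' s' b' t' = F a s b t" if "(a', s') \<in> lfrac a s" "(b', t') \<in> lfrac b t" for a' s' b' t'
    by (rule F) (use that frac_mem_iff[OF a(1,2)] frac_mem_iff[OF a(3,4)] in blast)+
  ultimately show ?thesis
    by blast
qed

lemma frac_mult:
  assumes "a \<in> carrier R" "s \<in> W" "b \<in> carrier R" "t \<in> W"
  shows "lfrac a s \<otimes>\<^bsub>L\<^esub> lfrac b t = lfrac (a \<otimes> b) (s \<otimes> t)"
proof -
  have "lfrac (a' \<otimes> b') (s' \<otimes> t') = lfrac (a \<otimes> b) (s \<otimes> t)"
    if *: "a' \<in> carrier R" "s' \<in> W" "b' \<in> carrier R" "t' \<in> W"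
      and eq: "lfrac a s = lfrac a' s'" "lfrac b t = lfrac b' t'" for a' s' b' t'
  proof -
    obtain v w where v: "v \<in> W" "v \<otimes> (a \<otimes> s') = v \<otimes> (a' \<otimes> s)"
      and w: "w \<in> W" "w \<otimes> (b \<otimes> t') = w \<otimes> (b' \<otimes> t)"
      using eq assms * by (auto simp: frac_eq_iff)
    have "(v \<otimes> w) \<otimes> ((a' \<otimes> b') \<otimes> (s \<otimes> t)) = (v \<otimes> (a' \<otimes> s)) \<otimes> (w \<otimes> (b' \<otimes> t))"
      using assms * v(1) w(1) by (simp add: m_ac)
    also have "\<dots> = (v \<otimes> w) \<otimes> ((a \<otimes> b) \<otimes> (s' \<otimes> t'))"
      unfolding v(2)[symmetric] w(2)[symmetric] using assms * v(1) w(1) by (simp add: m_ac)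
    finally show ?thesis
      using assms * v(1) w(1) by (subst frac_eq_iff) (auto intro!: bexI[of _ "v \<otimes> w"])
  qed
  then show ?thesis
    using frac_UN[OF assms, of "\<lambda>a s b t. lfrac (a \<otimes> b) (s \<otimes> t)"]
    by (simp add: localization_def)
qed

lemma frac_add:
  assumes "a \<in> carrier R" "s \<in> W" "b \<in> carrier R" "t \<in> W"
  shows "lfrac a s \<oplus>\<^bsub>L\<^esub> lfrac b t = lfrac (a \<otimes> t \<oplus> b \<otimes> s) (s \<otimes> t)"
proof -
  have "lfrac (a' \<otimes> t' \<oplus> b' \<otimes> s') (s' \<otimes> t') = lfrac (a \<otimes> t \<oplus> b \<otimes> s) (s \<otimes> t)"
    if *: "a' \<in> carrier R" "s' \<in> W" "b' \<in> carrier R" "t' \<in> W"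
      and eq: "lfrac a s = lfrac a' s'" "lfrac b t = lfrac b' t'" for a' s' b' t'
  proof -
    obtain v w where v: "v \<in> W" "v \<otimes> (a \<otimes> s') = v \<otimes> (a' \<otimes> s)"
      and w: "w \<in> W" "w \<otimes> (b \<otimes> t') = w \<otimes> (b' \<otimes> t)"
      using eq assms * by (auto simp: frac_eq_iff)
    have "(v \<otimes> w) \<otimes> ((a' \<otimes> t' \<oplus> b' \<otimes> s') \<otimes> (s \<otimes> t))
        = (v \<otimes> (a' \<otimes> s)) \<otimes> (w \<otimes> t \<otimes> t') \<oplus> (w \<otimes> (b' \<otimes> t)) \<otimes> (v \<otimes> s \<otimes> s')"
      using assms * v(1) w(1) by (simp add: m_ac l_distr r_distr)
    also have "\<dots> = (v \<otimes> w) \<otimes> ((a \<otimes> t \<oplus> b \<otimes> s) \<otimes> (s' \<otimes> t'))"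
      unfolding v(2)[symmetric] w(2)[symmetric]
      using assms * v(1) w(1) by (simp add: m_ac l_distr r_distr)
    finally show ?thesis
      using assms * v(1) w(1) by (subst frac_eq_iff) (auto intro!: bexI[of _ "v \<otimes> w"])
  qed
  then show ?thesis
    using frac_UN[OF assms, of "\<lambda>a s b t. lfrac (a \<otimes> t \<oplus> b \<otimes> s) (s \<otimes> t)"]
    by (simp add: localization_def)
qed

lemma L_cring: "cring L"
proof (rule cringI)
  show "abelian_group L"
  proof (rule abelian_groupI)
    show "x \<oplus>\<^bsub>L\<^esub> y \<in> carrier L" if "x \<in> carrier L" "y \<in> carrier L" for x y
      using that by (auto simp: carrier_L frac_add) blast
    show "\<zero>\<^bsub>L\<^esub> \<in> carrier L"
      by (simp add: zero_L)
    show "x \<oplus>\<^bsub>L\<^esub> y \<oplus>\<^bsub>L\<^esub> z = x \<oplus>\<^bsub>L\<^esub> (y \<oplus>\<^bsub>L\<^esub> z)"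
      if "x \<in> carrier L" "y \<in> carrier L" "z \<in> carrier L" for x y z
      using that by (auto simp: carrier_L frac_add l_distr r_distr m_ac a_ac)
    show "x \<oplus>\<^bsub>L\<^esub> y = y \<oplus>\<^bsub>L\<^esub> x" if "x \<in> carrier L" "y \<in> carrier L" for x y
      using that by (auto simp: carrier_L frac_add m_ac a_ac)
    show "\<zero>\<^bsub>L\<^esub> \<oplus>\<^bsub>L\<^esub> x = x" if "x \<in> carrier L" for x
      using that by (auto simp: carrier_L frac_add zero_L)
    show "\<exists>y\<in>carrier L. y \<oplus>\<^bsub>L\<^esub> x = \<zero>\<^bsub>L\<^esub>" if x': "x \<in> carrier L" for x
    proof -
      obtain a s where x: "x = lfrac a s" "a \<in> carrier R" "s \<in> W"
        using x' by (auto simp: carrier_L)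
      have "lfrac (\<ominus> a) s \<oplus>\<^bsub>L\<^esub> x = \<zero>\<^bsub>L\<^esub>"
      proof -
        have "lfrac \<zero> (s \<otimes> s) = lfrac \<zero> \<one>"
          using x by (intro frac_eqI) auto
        then show ?thesis
          using x by (simp add: frac_add zero_L l_minus l_neg)
      qed
      then show ?thesis
        using x by (intro bexI[of _ "lfrac (\<ominus> a) s"]) auto
    qed
  qed
  show "comm_monoid L"
  proof (rule comm_monoidI)
    show "x \<otimes>\<^bsub>L\<^esub> y \<in> carrier L" if "x \<in> carrier L" "y \<in> carrier L" for x y
      using that by (auto simp: carrier_L frac_mult) blast
    show "\<one>\<^bsub>L\<^esub> \<in> carrier L"
      by (simp add: one_L)
    show "x \<otimes>\<^bsub>L\<^esub> y \<otimes>\<^bsub>L\<^esub> z = x \<otimes>\<^bsub>L\<^esub> (y \<otimes>\<^bsub>L\<^esub> z)"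
      if "x \<in> carrier L" "y \<in> carrier L" "z \<in> carrier L" for x y z
      using that by (auto simp: carrier_L frac_mult m_ac)
    show "\<one>\<^bsub>L\<^esub> \<otimes>\<^bsub>L\<^esub> x = x" if "x \<in> carrier L" for x
      using that by (auto simp: carrier_L frac_mult one_L)
    show "x \<otimes>\<^bsub>L\<^esub> y = y \<otimes>\<^bsub>L\<^esub> x" if "x \<in> carrier L" "y \<in> carrier L" for x y
      using that by (auto simp: carrier_L frac_mult m_ac)
  qed
  show "(x \<oplus>\<^bsub>L\<^esub> y) \<otimes>\<^bsub>L\<^esub> z = x \<otimes>\<^bsub>L\<^esub> z \<oplus>\<^bsub>L\<^esub> y \<otimes>\<^bsub>L\<^esub> z"
    if xyz: "x \<in> carrier L" "y \<in> carrier L" "z \<in> carrier L" for x y z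
  proof -
    obtain a s b t c u where x: "x = lfrac a s" "y = lfrac b t" "z = lfrac c u"
      and closed: "a \<in> carrier R" "s \<in> W" "b \<in> carrier R" "t \<in> W" "c \<in> carrier R" "u \<in> W"
      using xyz by (auto simp: carrier_L)
    have "lfrac ((a \<otimes> t \<oplus> b \<otimes> s) \<otimes> c) (s \<otimes> t \<otimes> u)
        = lfrac ((a \<otimes> c) \<otimes> (t \<otimes> u) \<oplus> (b \<otimes> c) \<otimes> (s \<otimes> u)) ((s \<otimes> u) \<otimes> (t \<otimes> u))"
      using closed by (intro frac_eqI) (auto simp: l_distr r_distr m_ac)
    then show ?thesis
      using closed by (simp add: x frac_add frac_mult)
  qed
qed

text \<open>Fractions with numerator in \<open>I\<close> are closed under sums, by a common
  denominator, and under multiplication by any fraction; conversely a/s is the generator a/1 times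
  1/s.\<close>

lemma loc_ideal_eq:
  assumes I: "ideal I R"
  shows "loc_ideal R W I = {lfrac a s | a s. a \<in> I \<and> s \<in> W}" (is "_ = ?E")
proof -
  interpret I: ideal I R by fact
  interpret L: cring L by (rule L_cring)
  have IR: "a \<in> carrier R" if "a \<in> I" for a
    using that I.a_subset by blast
  have mult: "x \<otimes>\<^bsub>L\<^esub> y \<in> ?E" if xy: "x \<in> ?E" "y \<in> carrier L" for x y
  proof -
    obtain a s b t where "x = lfrac a s" "a \<in> I" "s \<in> W" "y = lfrac b t" "b \<in> carrier R" "t \<in> W"
      using xy by (auto simp: carrier_L)
    then show ?thesis
      using IR I.I_r_closed by (auto simp: frac_mult)
  qed
  have E: "ideal ?E L"
  proof (rule idealI)
    show "ring L" by (rule L.ring_axioms)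
    show "subgroup ?E (add_monoid L)"
    proof (rule group.subgroupI[OF L.a_group], goal_cases)
      case 1
      show ?case using IR by auto
    next
      case 2
      show ?case using W_one I.zero_closed by blast
    next
      case (3 x)
      have "x \<in> carrier L" using 3 IR by auto
      moreover have "x \<otimes>\<^bsub>L\<^esub> (\<ominus>\<^bsub>L\<^esub> \<one>\<^bsub>L\<^esub>) \<in> ?E"
        using 3 by (intro mult) auto
      ultimately show ?case
        unfolding a_inv_def[symmetric] by (simp add: L.r_minus)
    next
      case (4 x y)
      obtain a s b t where "x = lfrac a s" "a \<in> I" "s \<in> W" "y = lfrac b t" "b \<in> I" "t \<in> W"
        using 4 by auto
      moreover from this have "a \<otimes> t \<oplus> b \<otimes> s \<in> I"
        by (intro I.a_closed I.I_r_closed) auto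
      ultimately show ?case
        using IR by (auto simp: frac_add)
    qed
    show "x \<otimes>\<^bsub>L\<^esub> a \<in> ?E" "a \<otimes>\<^bsub>L\<^esub> x \<in> ?E" if "a \<in> ?E" "x \<in> carrier L" for a x
    proof -
      show "a \<otimes>\<^bsub>L\<^esub> x \<in> ?E" by (rule mult[OF that])
      moreover have "a \<in> carrier L" using that IR by auto
      ultimately show "x \<otimes>\<^bsub>L\<^esub> a \<in> ?E"
        using L.m_comm that(2) by simp
    qed
  qed
  have gen: "(\<lambda>a. lfrac a \<one>) ` I \<subseteq> carrier L"
    using IR by auto
  interpret G: ideal "Idl\<^bsub>L\<^esub> ((\<lambda>a. lfrac a \<one>) ` I)" L
    by (rule L.genideal_ideal[OF gen])
  show ?thesis
    unfolding loc_ideal_def ext_ideal_def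
  proof (rule equalityI)
    show "Idl\<^bsub>L\<^esub> ((\<lambda>a. lfrac a \<one>) ` I) \<subseteq> ?E"
      by (intro L.genideal_minimal[OF E]) auto
    have "lfrac a s \<in> Idl\<^bsub>L\<^esub> ((\<lambda>a. lfrac a \<one>) ` I)" if "a \<in> I" "s \<in> W" for a s
    proof -
      have "lfrac a \<one> \<otimes>\<^bsub>L\<^esub> lfrac \<one> s \<in> Idl\<^bsub>L\<^esub> ((\<lambda>a. lfrac a \<one>) ` I)"
        using that L.genideal_self[OF gen] by (intro G.I_r_closed) auto
      then show ?thesis
        using that IR by (simp add: frac_mult)
    qed
    then show "?E \<subseteq> Idl\<^bsub>L\<^esub> ((\<lambda>a. lfrac a \<one>) ` I)"
      by auto
  qed
qed

text \<open>Fractions are equal only up to a multiplier, so a/s may lie in the extended ideal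
  although \<open>a\<close> is not in \<open>I\<close>. From a/s = b/t with multiplier v, the
  product v t a equals v s b, which is in \<open>I\<close>.\<close>

lemma frac_mem_loc_ideal_iff:
  assumes I: "ideal I R" and "a \<in> carrier R" "s \<in> W"
  shows "lfrac a s \<in> loc_ideal R W I \<longleftrightarrow> (\<exists>v\<in>W. v \<otimes> a \<in> I)"
proof -
  interpret I: ideal I R by fact
  have IR: "b \<in> carrier R" if "b \<in> I" for b
    using that I.a_subset by blast
  show ?thesis
    unfolding loc_ideal_eq[OF I]
  proof safe
    fix b t assume b: "lfrac a s = lfrac b t" "b \<in> I" "t \<in> W"
    then obtain v where v: "v \<in> W" "v \<otimes> (a \<otimes> t) = v \<otimes> (b \<otimes> s)"
      using assms IR by (auto simp: frac_eq_iff)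
    have "v \<otimes> (b \<otimes> s) \<in> I"
      using b v assms by (intro I.I_l_closed I.I_r_closed) auto
    then have "(v \<otimes> t) \<otimes> a \<in> I"
      using v b(3) assms by (simp add: m_ac)
    then show "\<exists>v\<in>W. v \<otimes> a \<in> I"
      using v b(3) by blast
  next
    fix v assume v: "v \<in> W" "v \<otimes> a \<in> I"
    have "lfrac a s = lfrac (v \<otimes> a) (v \<otimes> s)"
      using v assms by (intro frac_eqI) (auto simp: m_ac)
    then show "\<exists>b t. lfrac a s = lfrac b t \<and> b \<in> I \<and> t \<in> W"
      using v assms by blast
  qed
qed

lemma loc_ideal_eq_carrier_iff:
  assumes I: "ideal I R"
  shows "loc_ideal R W I = carrier L \<longleftrightarrow> (\<exists>v\<in>W. v \<in> I)"
proof -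
  interpret I: ideal I R by fact
  have sub: "loc_ideal R W I \<subseteq> carrier L"
    unfolding loc_ideal_eq[OF I] using I.a_subset by auto
  have all: "lfrac a s \<in> loc_ideal R W I" if "v \<in> W" "v \<in> I" "a \<in> carrier R" "s \<in> W" for v a s
    using that I.I_r_closed by (auto simp: frac_mem_loc_ideal_iff[OF I])
  show ?thesis
  proof
    assume "loc_ideal R W I = carrier L"
    then have "lfrac \<one> \<one> \<in> loc_ideal R W I"
      using W_one by simp
    then show "\<exists>v\<in>W. v \<in> I"
      using frac_mem_loc_ideal_iff[OF I cring_simprules(6) W_one] by (metis W_carrier r_one)
  next
    assume "\<exists>v\<in>W. v \<in> I"
    then have "carrier L \<subseteq> loc_ideal R W I"
      using all unfolding carrier_L by blast
    with sub show "loc_ideal R W I = carrier L"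
      by (rule equalityI)
  qed
qed

lemma loc_ideal_subset_iff:
  assumes I: "ideal I R" and J: "ideal J R"
  shows "loc_ideal R W I \<subseteq> loc_ideal R W J \<longleftrightarrow> (\<forall>a\<in>I. \<exists>v\<in>W. v \<otimes> a \<in> J)"
proof -
  interpret I: ideal I R by fact
  have "a \<in> carrier R" if "a \<in> I" for a
    using that I.a_subset by blast
  then show ?thesis
    unfolding loc_ideal_eq[OF I] using frac_mem_loc_ideal_iff[OF J] by blast
qed

text \<open>The contraction of the localized ideal to R; for sums, the product of the two
  multipliers works. Being an ideal of R, it can serve as an upper bound for a content.\<close>

lemma saturation_ideal:
  assumes I: "ideal I R"
  shows "ideal {r \<in> carrier R. \<exists>v\<in>W. v \<otimes> r \<in> I} R" (is "ideal ?J R")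
proof (rule idealI)
  interpret I: ideal I R by fact
  show "ring R" by (rule ring_axioms)
  have mult: "b \<otimes> a \<in> ?J" if a: "a \<in> ?J" and b: "b \<in> carrier R" for a b
  proof -
    obtain v where v: "v \<in> W" "v \<otimes> a \<in> I"
      using a by blast
    have "b \<otimes> (v \<otimes> a) \<in> I"
      using v(2) b by (rule I.I_l_closed)
    then have "v \<otimes> (b \<otimes> a) \<in> I"
      using a b v by (simp add: m_lcomm)
    then show ?thesis
      using a b v by blast
  qed
  show "b \<otimes> a \<in> ?J" "a \<otimes> b \<in> ?J" if "a \<in> ?J" "b \<in> carrier R" for a b
    using mult[OF that] that m_comm[of a b] by auto
  show "subgroup ?J (add_monoid R)"
  proof (rule group.subgroupI[OF a_group], goal_cases)
    case 2
    have "\<zero> \<in> ?J"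
      using W_one I.zero_closed by (auto intro!: bexI[of _ \<one>])
    then show ?case by blast
  next
    case (3 a)
    then have "(\<ominus> \<one>) \<otimes> a \<in> ?J"
      by (intro mult) auto
    moreover have "a \<in> carrier R"
      using 3 by blast
    ultimately show ?case
      unfolding a_inv_def[symmetric] by (simp add: l_minus)
  next
    case (4 a b)
    then obtain v w where v: "v \<in> W" "v \<otimes> a \<in> I" and w: "w \<in> W" "w \<otimes> b \<in> I"
      and ab: "a \<in> carrier R" "b \<in> carrier R"
      by blast
    have "w \<otimes> (v \<otimes> a) \<oplus> v \<otimes> (w \<otimes> b) \<in> I"
      using I.I_l_closed[OF v(2) W_carrier[OF w(1)]] I.I_l_closed[OF w(2) W_carrier[OF v(1)]]
      by (rule I.a_closed)
    then have "(v \<otimes> w) \<otimes> (a \<oplus> b) \<in> I"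
      using v w ab by (simp add: r_distr m_ac)
    then show ?case
      using v w ab by auto
  qed auto
qed

end

text \<open>Krull's lemma. Let \<open>p\<close> be maximal among the ideals that contain
  \<open>J\<close> and avoid \<open>W\<close>. If a and b lie outside \<open>p\<close>, both p + (a)
  and p + (b) meet \<open>W\<close>; with ab in \<open>p\<close>, the product of two such elements
  of \<open>W\<close> would lie in \<open>p\<close>.\<close>

lemma (in cring) exists_prime_disjoint:
  assumes J: "ideal J R" and W: "submonoid W R" and disjoint: "J \<inter> W = {}"
  obtains p where "primeideal p R" "J \<subseteq> p" "p \<inter> W = {}"
proof -
  interpret mult_set R W
    using W cring_axioms by (simp add: mult_set_def)
  define \<A> where "\<A> = {I. ideal I R \<and> J \<subseteq> I \<and> I \<inter> W = {}}"
  have "\<exists>p\<in>\<A>. \<forall>I\<in>\<A>. p \<subseteq> I \<longrightarrow> I = p"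
  proof (rule subset_Zorn_nonempty)
    show "\<A> \<noteq> {}"
      using J disjoint by (auto simp: \<A>_def)
    fix C assume C: "C \<noteq> {}" "subset.chain \<A> C"
    then have sub: "C \<subseteq> \<A>" and "subset.chain {I. ideal I R} C"
      by (auto simp: pred_on.chain_def \<A>_def)
    with C(1) have "ideal (\<Union>C) R"
      using chain_Union_is_ideal[of C] by simp
    moreover have "J \<subseteq> \<Union>C" "\<Union>C \<inter> W = {}"
      using C(1) sub by (auto simp: \<A>_def)
    ultimately show "\<Union>C \<in> \<A>"
      by (simp add: \<A>_def)
  qed
  then obtain p where pA: "p \<in> \<A>" and pmax: "\<forall>I\<in>\<A>. p \<subseteq> I \<longrightarrow> I = p"
    by blast
  from pA have p: "ideal p R" "J \<subseteq> p" "p \<inter> W = {}"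
    by (simp_all add: \<A>_def)
  have max: "I = p" if I: "ideal I R" "p \<subseteq> I" "I \<inter> W = {}" for I
  proof -
    have "I \<in> \<A>"
      using I subset_trans[OF p(2) I(2)] by (simp add: \<A>_def)
    then show ?thesis
      using pmax I(2) by simp
  qed
  interpret p: ideal p R by fact
  have pR: "x \<in> carrier R" if "x \<in> p" for x
    using that p.a_subset by blast
  have meets: "\<exists>x\<in>p. \<exists>r\<in>carrier R. x \<oplus> r \<otimes> a \<in> W" if a: "a \<in> carrier R" "a \<notin> p" for a
  proof -
    have "ideal (p <+>\<^bsub>R\<^esub> PIdl a) R"
      using a p(1) by (intro add_ideals cgenideal_ideal)
    moreover have "p \<subseteq> p <+>\<^bsub>R\<^esub> PIdl a"
    proof
      fix x assume x: "x \<in> p"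
      have "x = x \<oplus> \<zero> \<otimes> a" using x pR a by simp
      then show "x \<in> p <+>\<^bsub>R\<^esub> PIdl a"
        using x unfolding set_add_def' cgenideal_def by blast
    qed
    moreover have "p <+>\<^bsub>R\<^esub> PIdl a \<noteq> p"
    proof -
      have "a = \<zero> \<oplus> \<one> \<otimes> a" using a by simp
      then have "a \<in> p <+>\<^bsub>R\<^esub> PIdl a"
        using p.zero_closed unfolding set_add_def' cgenideal_def by blast
      then show ?thesis using a(2) by blast
    qed
    ultimately have "(p <+>\<^bsub>R\<^esub> PIdl a) \<inter> W \<noteq> {}"
      using max by blast
    then show ?thesis
      unfolding set_add_def' cgenideal_def by blast
  qed
  have "primeideal p R"
  proof (rule primeidealI)
    show "carrier R \<noteq> p"
      using p(3) W_one W_carrier by blast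
    fix a b assume ab: "a \<in> carrier R" "b \<in> carrier R" "a \<otimes> b \<in> p"
    show "a \<in> p \<or> b \<in> p"
    proof (rule ccontr)
      assume "\<not> (a \<in> p \<or> b \<in> p)"
      then obtain x r y t where x: "x \<in> p" "r \<in> carrier R" "x \<oplus> r \<otimes> a \<in> W"
        and y: "y \<in> p" "t \<in> carrier R" "y \<oplus> t \<otimes> b \<in> W"
        using meets ab by meson
      have "(x \<oplus> r \<otimes> a) \<otimes> (y \<oplus> t \<otimes> b)
          = x \<otimes> (y \<oplus> t \<otimes> b) \<oplus> ((r \<otimes> a) \<otimes> y \<oplus> (r \<otimes> t) \<otimes> (a \<otimes> b))"
        using x(1,2) y(1,2) ab pR by (simp add: l_distr r_distr m_ac a_ac)
      also have "\<dots> \<in> p"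
        using x(1,2) y(1,2) ab pR by (simp add: p.a_closed p.I_l_closed p.I_r_closed)
      finally show False
        using x(3) y(3) p(3) W_mult by blast
    qed
  qed (use p in \<open>auto simp: cring_axioms\<close>)
  then show ?thesis
    using p that by blast
qed

lemma (in primeideal) complement_submonoid: "submonoid (carrier R - I) R"
proof
  show "\<one> \<in> carrier R - I"
    using I_notcarr one_imp_carrier by auto
  show "x \<otimes> y \<in> carrier R - I" if "x \<in> carrier R - I" "y \<in> carrier R - I" for x y
    using that I_prime by blast
qed auto

section \<open>Contents\<close>

text \<open>The colon ideal (I : a). It avoids a multiplicative set W precisely when no multiple of
  \<open>a\<close> by an element of W lies in \<open>I\<close>, which is how a failure of the
  semicontent property produces a prime.\<close>

lemma (in cring) quotient_ideal:
  assumes I: "ideal I R" and a: "a \<in> carrier R"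
  shows "ideal {r \<in> carrier R. r \<otimes> a \<in> I} R"
proof (rule idealI)
  interpret I: ideal I R by fact
  show "ring R" by (rule ring_axioms)
  show "subgroup {r \<in> carrier R. r \<otimes> a \<in> I} (add_monoid R)"
  proof (rule group.subgroupI[OF a_group], goal_cases)
    case 2
    have "\<zero> \<in> {r \<in> carrier R. r \<otimes> a \<in> I}"
      using a by simp
    then show ?case by blast
  next
    case (3 r)
    then show ?case
      unfolding a_inv_def[symmetric] using a by (simp add: l_minus)
  next
    case (4 r s)
    then show ?case
      using a by (simp add: l_distr)
  qed auto
  show "x \<otimes> r \<in> {r \<in> carrier R. r \<otimes> a \<in> I}" "r \<otimes> x \<in> {r \<in> carrier R. r \<otimes> a \<in> I}"
    if "r \<in> {r \<in> carrier R. r \<otimes> a \<in> I}" "x \<in> carrier R" for r x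
    using that a I.I_l_closed[of "r \<otimes> a" x] m_comm[of r x] by (auto simp: m_assoc)
qed

context ring_hom_cring
begin

abbreviation "content \<equiv> ohm_rush_content R S h"
abbreviation "ext \<equiv> ext_ideal S h"

lemma ext_mono: "\<lbrakk>I \<subseteq> J; J \<subseteq> carrier R\<rbrakk> \<Longrightarrow> ext I \<subseteq> ext J"
  unfolding ext_ideal_def by (intro S.subset_Idl_subset) auto

lemma ext_carrier: "f \<in> carrier S \<Longrightarrow> f \<in> ext (carrier R)"
proof -
  assume f: "f \<in> carrier S"
  interpret E: ideal "ext (carrier R)" S
    by (rule ext_ideal_ideal) simp
  have "h \<one> \<in> ext (carrier R)"
    by (rule ext_ideal_hom) auto
  then show ?thesis
    using E.one_imp_carrier f by simp
qed

text \<open>The unit ideal belongs to the family, so the intersection is taken over a nonempty set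
  of ideals; an empty one would give the whole type.\<close>

lemma content_ideal:
  assumes "f \<in> carrier S"
  shows "ideal (content f) R"
  unfolding ohm_rush_content_def
proof (rule R.i_Intersect)
  show "{I. ideal I R \<and> f \<in> ext I} \<noteq> {}"
    using ext_carrier[OF assms] R.oneideal by blast
qed simp

lemma content_carrier: "f \<in> carrier S \<Longrightarrow> content f \<subseteq> carrier R"
  using ideal.Icarr[OF content_ideal] by blast

lemma content_minimal: "\<lbrakk>ideal I R; f \<in> ext I\<rbrakk> \<Longrightarrow> content f \<subseteq> I"
  by (auto simp: ohm_rush_content_def)

lemma mem_ext_content: "\<lbrakk>ohm_rush R S h; f \<in> carrier S\<rbrakk> \<Longrightarrow> f \<in> ext (content f)"
  by (simp add: ohm_rush_def)

text \<open>As g lies in the extension of its own content, so does fg. One inclusion in the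
  semicontent equation is thus automatic.\<close>

lemma content_mult_subset:
  assumes "ohm_rush R S h" "f \<in> carrier S" "g \<in> carrier S"
  shows "content (f \<otimes>\<^bsub>S\<^esub> g) \<subseteq> content g"
proof (rule content_minimal[OF content_ideal[OF assms(3)]])
  interpret E: ideal "ext (content g)" S
    using content_carrier[OF assms(3)] by (rule ext_ideal_ideal)
  show "f \<otimes>\<^bsub>S\<^esub> g \<in> ext (content g)"
    using mem_ext_content assms by (intro E.I_l_closed) auto
qed

text \<open>Removes localization: \<Omega>(f)_W = A_W says that W meets \<Omega>(f), and since
  \<Omega>(fg) \<subseteq> \<Omega>(g), the equation of localized contents reduces to the inclusion
  that can fail.\<close>

lemma semicontent_iff:
  "semicontent U R S h \<longleftrightarrow> ohm_rush R S h \<and> faithfully_flat U R S h \<and>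
    (\<forall>W f g. submonoid W R \<longrightarrow> f \<in> carrier S \<longrightarrow> g \<in> carrier S \<longrightarrow> (\<exists>v\<in>W. v \<in> content f) \<longrightarrow>
      (\<forall>a\<in>content g. \<exists>v\<in>W. v \<otimes> a \<in> content (f \<otimes>\<^bsub>S\<^esub> g)))"
proof -
  have eq: "(loc_ideal R W (content f) = carrier (localization R W) \<longrightarrow>
      loc_ideal R W (content (f \<otimes>\<^bsub>S\<^esub> g)) = loc_ideal R W (content g)) \<longleftrightarrow>
    ((\<exists>v\<in>W. v \<in> content f) \<longrightarrow> (\<forall>a\<in>content g. \<exists>v\<in>W. v \<otimes> a \<in> content (f \<otimes>\<^bsub>S\<^esub> g)))"
    if "ohm_rush R S h" "submonoid W R" "f \<in> carrier S" "g \<in> carrier S" for W f g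
  proof -
    interpret W: mult_set R W
      using that R.cring_axioms by (simp add: mult_set_def)
    have ideals: "ideal (content f) R" "ideal (content g) R" "ideal (content (f \<otimes>\<^bsub>S\<^esub> g)) R"
      using that by (auto intro: content_ideal)
    have "content (f \<otimes>\<^bsub>S\<^esub> g) \<subseteq> content g"
      using content_mult_subset that by blast
    then have "\<forall>a\<in>content (f \<otimes>\<^bsub>S\<^esub> g). \<exists>v\<in>W. v \<otimes> a \<in> content g"
      using ideal.I_l_closed[OF ideals(2)] W.W_one by blast
    then have "loc_ideal R W (content (f \<otimes>\<^bsub>S\<^esub> g)) \<subseteq> loc_ideal R W (content g)"
      using ideals by (simp add: W.loc_ideal_subset_iff)
    then have "loc_ideal R W (content (f \<otimes>\<^bsub>S\<^esub> g)) = loc_ideal R W (content g) \<longleftrightarrow>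
        loc_ideal R W (content g) \<subseteq> loc_ideal R W (content (f \<otimes>\<^bsub>S\<^esub> g))"
      by (auto simp only: set_eq_subset)
    then show ?thesis
      using ideals by (simp only: W.loc_ideal_subset_iff W.loc_ideal_eq_carrier_iff)
  qed
  show ?thesis
    unfolding semicontent_def
    by (rule conj_cong[OF refl], rule conj_cong[OF refl], (rule iff_allI)+, (rule imp_cong[OF refl], rule imp_cong[OF refl], rule imp_cong[OF refl]), rule eq)
qed

end

section \<open>Extended ideals and the flatness criterion for composites\<close>

lemma (in ring_hom_cring) ext_ideal_comp:
  assumes "ring_hom_cring S T k" and I: "I \<subseteq> carrier R"
  shows "ext_ideal T (k \<circ> h) I = ext_ideal T k (ext_ideal S h I)"
proof -
  interpret ST: ring_hom_cring S T k by fact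
  have sub: "(k \<circ> h) ` I \<subseteq> carrier T"
    using I by auto
  have ideal: "ideal (ext_ideal T (k \<circ> h) I) T"
    unfolding ext_ideal_def using sub by (rule ST.S.genideal_ideal)
  interpret E: ideal "ext_ideal S h I" S
    using I by (rule ext_ideal_ideal)
  \<comment> \<open>The preimage of IT under \<open>k\<close> is an ideal of S that contains h(I),
    hence IS; this gives (IS)T \<subseteq> IT.\<close>
  have "ideal {s \<in> carrier S. k s \<in> ext_ideal T (k \<circ> h) I} S"
    using ST.ring.ideal_vimage[OF ideal] .
  moreover have "h ` I \<subseteq> {s \<in> carrier S. k s \<in> ext_ideal T (k \<circ> h) I}"
    using I ST.S.genideal_self[OF sub] by (auto simp: ext_ideal_def)
  ultimately have "ext_ideal S h I \<subseteq> {s \<in> carrier S. k s \<in> ext_ideal T (k \<circ> h) I}"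
    unfolding ext_ideal_def[of S] by (rule S.genideal_minimal)
  then have "ext_ideal T k (ext_ideal S h I) \<subseteq> ext_ideal T (k \<circ> h) I"
    unfolding ext_ideal_def[of T k] using ideal by (intro ST.S.genideal_minimal) auto
  moreover have "(k \<circ> h) ` I \<subseteq> k ` ext_ideal S h I"
    using ext_ideal_hom[OF I] by auto
  then have "ext_ideal T (k \<circ> h) I \<subseteq> ext_ideal T k (ext_ideal S h I)"
    unfolding ext_ideal_def[of T] using E.a_subset by (intro ST.S.subset_Idl_subset) auto
  ultimately show ?thesis by blast
qed

text \<open>A composite of d : T \<rightarrow> S and c : S \<rightarrow> R is partially linear if d
  respects the scalars h(Q) and c respects the relations among the values d(G). Expanding t over S,
  and then each coefficient d(t) over R, gives the required reconstruction.\<close>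

lemma flat_lifting_comp:
  assumes hom: "ring_hom_cring R S h" "ring_hom_cring S T k"
    and RS: "flat_lifting R S h" and ST: "flat_lifting S T k"
  shows "flat_lifting R T (k \<circ> h)"
  unfolding flat_lifting_def
proof (intro allI impI)
  fix G Q
  assume G: "finite G" "G \<subseteq> carrier T" and Q: "finite Q" "Q \<subseteq> carrier R"
  interpret RS: ring_hom_cring R S h by fact
  interpret ST: ring_hom_cring S T k by fact
  have Qc: "a \<in> carrier R" if "a \<in> Q" for a
    using that Q(2) by blast
  have Gc: "t \<in> carrier T" if "t \<in> G" for t
    using that G(2) by blast
  have "finite (h ` Q)" "h ` Q \<subseteq> carrier S"
    using Q by (auto simp: Qc)
  then obtain ps where ps: "set ps \<subseteq> partial_linear S T k G (h ` Q) \<times> carrier T"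
    and lift: "\<And>t. t \<in> G \<Longrightarrow> lsum T (\<lambda>p. k (fst p t) \<otimes>\<^bsub>T\<^esub> snd p) ps = t"
    by (rule flat_liftingD[OF ST G G]) (rule that)
  have ps_mem: "fst p \<in> partial_linear S T k G (h ` Q)" "snd p \<in> carrier T" if "p \<in> set ps" for p
    using subsetD[OF ps that] by (simp_all add: mem_Times_iff)
  have ps_closed: "fst p t \<in> carrier S" if "p \<in> set ps" "t \<in> carrier T" for p t
    using ps_mem(1)[OF that(1)] that(2) by (auto simp: partial_linear_def)
  \<comment> \<open>The values to be handled over R depend on the functional \<open>fst p\<close>,
    so each \<open>p\<close> receives its own list \<open>qs\<close>.\<close>
  have "\<forall>p\<in>set ps. \<exists>qs. set qs \<subseteq> partial_linear R S h (fst p ` G) Q \<times> carrier S \<and>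
      (\<forall>s\<in>fst p ` G. lsum S (\<lambda>q. h (fst q s) \<otimes>\<^bsub>S\<^esub> snd q) qs = s)"
    (is "\<forall>p\<in>set ps. ?ex p")
  proof
    fix p assume p: "p \<in> set ps"
    have "finite (fst p ` G)" "fst p ` G \<subseteq> carrier S"
      using G(1) ps_closed[OF p Gc] by auto
    then show "?ex p"
      by (rule RS[unfolded flat_lifting_def, rule_format, OF _ _ Q])
  qed
  from bchoice[OF this] obtain qs where qs_all: "\<forall>p\<in>set ps.
      set (qs p) \<subseteq> partial_linear R S h (fst p ` G) Q \<times> carrier S \<and>
      (\<forall>s\<in>fst p ` G. lsum S (\<lambda>q. h (fst q s) \<otimes>\<^bsub>S\<^esub> snd q) (qs p) = s)" ..
  have qs: "set (qs p) \<subseteq> partial_linear R S h (fst p ` G) Q \<times> carrier S" if "p \<in> set ps" for p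
    using bspec[OF qs_all that] by (rule conjunct1)
  have qs_lift: "lsum S (\<lambda>q. h (fst q s) \<otimes>\<^bsub>S\<^esub> snd q) (qs p) = s" if "p \<in> set ps" "s \<in> fst p ` G" for p s
    using bspec[OF conjunct2[OF bspec[OF qs_all that(1)]] that(2)] .
  have qs_mem: "fst q \<in> partial_linear R S h (fst p ` G) Q" "snd q \<in> carrier S"
    if "p \<in> set ps" "q \<in> set (qs p)" for p q
    using subsetD[OF qs[OF that(1)] that(2)] by (simp_all add: mem_Times_iff)
  have qs_closed: "fst q s \<in> carrier R" if "p \<in> set ps" "q \<in> set (qs p)" "s \<in> carrier S" for p q s
    using qs_mem(1)[OF that(1,2)] that(3) by (auto simp: partial_linear_def)
  \<comment> \<open>A composed functional is paired with the product of the right entries of the two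
    stages.\<close>
  define l where "l = (\<lambda>p. map (\<lambda>q. (fst q \<circ> fst p, k (snd q) \<otimes>\<^bsub>T\<^esub> snd p)) (qs p))"
  let ?rs = "concat (map l ps)"
  show "\<exists>rs. set rs \<subseteq> partial_linear R T (k \<circ> h) G Q \<times> carrier T \<and>
    (\<forall>t\<in>G. lsum T (\<lambda>r. (k \<circ> h) (fst r t) \<otimes>\<^bsub>T\<^esub> snd r) rs = t)"
  proof (intro exI[of _ ?rs] conjI ballI)
    have "fst q \<circ> fst p \<in> partial_linear R T (k \<circ> h) G Q" if p: "p \<in> set ps" and q: "q \<in> set (qs p)" for p q
      unfolding partial_linear_def mem_Collect_eq
    proof (intro conjI ballI)
      show "fst q \<circ> fst p \<in> carrier T \<rightarrow> carrier R"
        using ps_closed[OF p] qs_closed[OF p q] by auto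
      fix a t t' assume a: "a \<in> Q" and t: "t \<in> G" "t' \<in> G"
      have "fst p ((k \<circ> h) a \<otimes>\<^bsub>T\<^esub> t \<oplus>\<^bsub>T\<^esub> t') = h a \<otimes>\<^bsub>S\<^esub> fst p t \<oplus>\<^bsub>S\<^esub> fst p t'"
        using ps_mem(1)[OF p] a t by (simp add: partial_linear_def)
      then show "(fst q \<circ> fst p) ((k \<circ> h) a \<otimes>\<^bsub>T\<^esub> t \<oplus>\<^bsub>T\<^esub> t')
          = a \<otimes>\<^bsub>R\<^esub> (fst q \<circ> fst p) t \<oplus>\<^bsub>R\<^esub> (fst q \<circ> fst p) t'"
        using qs_mem(1)[OF p q] a t by (simp add: partial_linear_def)
    qed
    moreover have "k (snd q) \<otimes>\<^bsub>T\<^esub> snd p \<in> carrier T" if "p \<in> set ps" "q \<in> set (qs p)" for p q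
      using ps_mem(2) qs_mem(2) that by simp
    ultimately show "set ?rs \<subseteq> partial_linear R T (k \<circ> h) G Q \<times> carrier T"
      by (auto simp: l_def)
  next
    fix t assume t: "t \<in> G"
    then have tT: "t \<in> carrier T" using G by blast
    have closed: "(k \<circ> h) (fst q (fst p t)) \<otimes>\<^bsub>T\<^esub> (k (snd q) \<otimes>\<^bsub>T\<^esub> snd p) \<in> carrier T"
      if "p \<in> set ps" "q \<in> set (qs p)" for p q
      using that ps_mem(2) qs_mem(2) qs_closed ps_closed tT by simp
    have "lsum T (\<lambda>r. (k \<circ> h) (fst r t) \<otimes>\<^bsub>T\<^esub> snd r) ?rs
        = lsum T (\<lambda>p. lsum T (\<lambda>r. (k \<circ> h) (fst r t) \<otimes>\<^bsub>T\<^esub> snd r) (l p)) ps"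
      using closed by (intro ST.S.lsum_concat) (auto simp: l_def)
    also have "\<dots> = lsum T (\<lambda>p. k (fst p t) \<otimes>\<^bsub>T\<^esub> snd p) ps"
    proof (rule lsum_cong)
      fix p assume p: "p \<in> set ps"
      have qc: "h (fst q (fst p t)) \<in> carrier S" "snd q \<in> carrier S" if "q \<in> set (qs p)" for q
        using that p qs_mem(2) qs_closed ps_closed tT by simp_all
      have "lsum T (\<lambda>r. (k \<circ> h) (fst r t) \<otimes>\<^bsub>T\<^esub> snd r) (l p)
          = lsum T (\<lambda>q. k (h (fst q (fst p t)) \<otimes>\<^bsub>S\<^esub> snd q) \<otimes>\<^bsub>T\<^esub> snd p) (qs p)"
        unfolding l_def lsum_map using qc ps_mem(2)[OF p]
        by (intro lsum_cong) (simp add: ST.S.m_assoc)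
      also have "\<dots> = lsum T (\<lambda>q. k (h (fst q (fst p t)) \<otimes>\<^bsub>S\<^esub> snd q)) (qs p) \<otimes>\<^bsub>T\<^esub> snd p"
        using qc ps_mem(2)[OF p] by (intro ST.S.lsum_rdistr[symmetric]) simp_all
      also have "lsum T (\<lambda>q. k (h (fst q (fst p t)) \<otimes>\<^bsub>S\<^esub> snd q)) (qs p)
          = k (lsum S (\<lambda>q. h (fst q (fst p t)) \<otimes>\<^bsub>S\<^esub> snd q) (qs p))"
        using qc by (intro lsum_hom[symmetric]) (simp_all add: RS.S.abelian_monoid_axioms)
      also have "lsum S (\<lambda>q. h (fst q (fst p t)) \<otimes>\<^bsub>S\<^esub> snd q) (qs p) = fst p t"
        using p t by (intro qs_lift) auto
      finally show "lsum T (\<lambda>r. (k \<circ> h) (fst r t) \<otimes>\<^bsub>T\<^esub> snd r) (l p) = k (fst p t) \<otimes>\<^bsub>T\<^esub> snd p" .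
    qed
    also have "\<dots> = t"
      using lift[OF t] .
    finally show "lsum T (\<lambda>r. (k \<circ> h) (fst r t) \<otimes>\<^bsub>T\<^esub> snd r) ?rs = t" .
  qed
qed

lemma detects_unit_comp:
  assumes hom: "ring_hom_cring R S h" "ring_hom_cring S T k"
    and RS: "detects_unit R S h" and ST: "detects_unit S T k"
  shows "detects_unit R T (k \<circ> h)"
  unfolding detects_unit_def
proof (intro allI impI)
  fix J assume J: "ideal J R" "\<one>\<^bsub>T\<^esub> \<in> ext_ideal T (k \<circ> h) J"
  interpret RS: ring_hom_cring R S h by fact
  have JR: "J \<subseteq> carrier R"
    using ideal.Icarr[OF J(1)] by blast
  have "\<one>\<^bsub>S\<^esub> \<in> ext_ideal S h J"
    using ST J(2) RS.ext_ideal_ideal[OF JR] unfolding RS.ext_ideal_comp[OF hom(2) JR] detects_unit_def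
    by blast
  then show "\<one>\<^bsub>R\<^esub> \<in> J"
    using RS J(1) unfolding detects_unit_def by blast
qed

section \<open>Contents in a tower of Ohm-Rush algebras\<close>

locale ohm_rush_tower = RS: ring_hom_cring R S h + ST: ring_hom_cring S T k
  for R :: "('r, 'u) ring_scheme" and S :: "('s, 'v) ring_scheme" and h
    and T :: "('t, 'w) ring_scheme" and k +
  assumes RS_ohm_rush: "ohm_rush R S h" and ST_ohm_rush: "ohm_rush S T k"
begin

sublocale RT: ring_hom_cring R T "k \<circ> h"
proof
  show "k \<circ> h \<in> ring_hom R T"
    by (auto simp: ring_hom_def)
qed

text \<open>If f lies in JT = (JS)T, then JS is an upper bound for the content of f over S. So s
  lies in JS, and J is an upper bound for the content of s.\<close>

lemma content_tower_subset:
  assumes f: "f \<in> carrier T" and s: "s \<in> ST.content f"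
  shows "RS.content s \<subseteq> RT.content f"
  unfolding ohm_rush_content_def[of R T]
proof (rule Inter_greatest, clarify)
  fix J r assume J: "ideal J R" "f \<in> RT.ext J" and r: "r \<in> RS.content s"
  have JR: "J \<subseteq> carrier R"
    using ideal.Icarr[OF J(1)] by blast
  have "ST.content f \<subseteq> RS.ext J"
    using J(2) RS.ext_ideal_ideal[OF JR] RS.ext_ideal_comp[OF ST.ring_hom_cring_axioms JR]
    by (intro ST.content_minimal) simp_all
  then show "r \<in> J"
    using RS.content_minimal[OF J(1)] s r by blast
qed

text \<open>Each s in \<Omega>_TS(f) lies in \<Omega>_SR(s)S \<subseteq> JS, so f lies in
  \<Omega>_TS(f)T \<subseteq> (JS)T = JT. Working with an arbitrary upper bound J avoids forming the
  sum of the ideals \<Omega>_SR(s).\<close>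

lemma content_tower_minimal:
  assumes f: "f \<in> carrier T" and J: "ideal J R"
    and sub: "\<And>s. s \<in> ST.content f \<Longrightarrow> RS.content s \<subseteq> J"
  shows "f \<in> RT.ext J"
proof -
  have JR: "J \<subseteq> carrier R"
    using ideal.Icarr[OF J(1)] by blast
  have "s \<in> RS.ext J" if s: "s \<in> ST.content f" for s
  proof -
    have "s \<in> carrier S"
      using s ST.content_carrier[OF f] by blast
    then have "s \<in> RS.ext (RS.content s)"
      by (rule RS.mem_ext_content[OF RS_ohm_rush])
    then show ?thesis
      using RS.ext_mono[OF sub[OF s] JR] by blast
  qed
  then have "ST.content f \<subseteq> RS.ext J" ..
  moreover have "RS.ext J \<subseteq> carrier S"
    using ideal.Icarr[OF RS.ext_ideal_ideal[OF JR]] by blast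
  ultimately have "ST.ext (ST.content f) \<subseteq> ST.ext (RS.ext J)"
    by (rule ST.ext_mono)
  then show ?thesis
    unfolding RS.ext_ideal_comp[OF ST.ring_hom_cring_axioms JR]
    using ST.mem_ext_content[OF ST_ohm_rush f] by (rule subsetD)
qed

text \<open>The content of f over R is itself an upper bound for all the \<Omega>_SR(s), so it can
  be taken for \<open>J\<close>.\<close>

lemma ohm_rush_comp: "ohm_rush R T (k \<circ> h)"
  unfolding ohm_rush_def
proof (intro conjI ballI)
  show "f \<in> RT.ext (RT.content f)" if f: "f \<in> carrier T" for f
    using f RT.content_ideal[OF f] content_tower_subset[OF f] by (rule content_tower_minimal)
qed (rule RT.ring_hom_cring_axioms)

end

theorem theorem3p10:
  fixes R :: "('r, 'u) ring_scheme" and S :: "('s, 'v) ring_scheme" and T :: "('t, 'w) ring_scheme"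
    and h :: "'r \<Rightarrow> 's" and k :: "'s \<Rightarrow> 't"
  assumes "ring_hom_cring R S h" and "ring_hom_cring S T k"
    and "semicontent TYPE(nat \<Rightarrow> 's) S T k"
    and "semicontent TYPE(nat \<Rightarrow> 'r) R S h"
  shows "semicontent TYPE('m) R T (k \<circ> h)"
proof -
  interpret RS: ring_hom_cring R S h by fact
  interpret ST: ring_hom_cring S T k by fact
  from assms(3) have ST: "ohm_rush S T k" "faithfully_flat TYPE(nat \<Rightarrow> 's) S T k"
    and ST_semi: "\<And>W f g s. \<lbrakk>submonoid W S; f \<in> carrier T; g \<in> carrier T; \<exists>v\<in>W. v \<in> ST.content f;
      s \<in> ST.content g\<rbrakk> \<Longrightarrow> \<exists>v\<in>W. v \<otimes>\<^bsub>S\<^esub> s \<in> ST.content (f \<otimes>\<^bsub>T\<^esub> g)"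
    unfolding ST.semicontent_iff by blast+
  from assms(4) have RS: "ohm_rush R S h" "faithfully_flat TYPE(nat \<Rightarrow> 'r) R S h"
    and RS_semi: "\<And>W f g s. \<lbrakk>submonoid W R; f \<in> carrier S; g \<in> carrier S; \<exists>v\<in>W. v \<in> RS.content f;
      s \<in> RS.content g\<rbrakk> \<Longrightarrow> \<exists>v\<in>W. v \<otimes>\<^bsub>R\<^esub> s \<in> RS.content (f \<otimes>\<^bsub>S\<^esub> g)"
    unfolding RS.semicontent_iff by blast+
  interpret ohm_rush_tower R S h T k
    by unfold_locales (fact RS ST)+
  note RS_flat = RS.flat_lifting_if_faithfully_flat[OF RS(2)] RS.detects_unit_if_faithfully_flat[OF RS(2)]
  note ST_flat = ST.flat_lifting_if_faithfully_flat[OF ST(2)] ST.detects_unit_if_faithfully_flat[OF ST(2)]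
  have ff: "faithfully_flat TYPE('m) R T (k \<circ> h)"
    using flat_lifting_comp[OF assms(1,2) RS_flat(1) ST_flat(1)]
      detects_unit_comp[OF assms(1,2) RS_flat(2) ST_flat(2)]
    by (rule faithfully_flatI[OF RT.ring_hom_cring_axioms])
  have "\<exists>v\<in>W. v \<otimes>\<^bsub>R\<^esub> a \<in> RT.content (f \<otimes>\<^bsub>T\<^esub> g)"
    if W: "submonoid W R" and f: "f \<in> carrier T" and g: "g \<in> carrier T"
      and w: "w \<in> W" "w \<in> RT.content f" and a: "a \<in> RT.content g" for W f g w a
  proof (rule ccontr)
    let ?I = "RT.content (f \<otimes>\<^bsub>T\<^esub> g)"
    assume none: "\<not> (\<exists>v\<in>W. v \<otimes>\<^bsub>R\<^esub> a \<in> ?I)"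
    have fg: "f \<otimes>\<^bsub>T\<^esub> g \<in> carrier T"
      using f g by simp
    have I: "ideal ?I R"
      using fg by (rule RT.content_ideal)
    have aR: "a \<in> carrier R"
      using a RT.content_carrier[OF g] by blast
    have "ideal {r \<in> carrier R. r \<otimes>\<^bsub>R\<^esub> a \<in> ?I} R"
      using RS.R.quotient_ideal[OF I aR] .
    \<comment> \<open>By \<open>none\<close> the ideal (I : a) avoids \<open>W\<close>. A prime
      above it preserves the failure after localization at \<open>p\<close>, where the content of
      \<open>f\<close> is still the unit ideal because w is not in \<open>p\<close>.\<close>
    then obtain p where p: "primeideal p R" "{r \<in> carrier R. r \<otimes>\<^bsub>R\<^esub> a \<in> ?I} \<subseteq> p" "p \<inter> W = {}"
      using RS.R.exists_prime_disjoint[OF _ W] none by blast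
    interpret p: primeideal p R by fact
    define W' where "W' = carrier R - p"
    have W': "submonoid W' R"
      unfolding W'_def by (rule p.complement_submonoid)
    interpret W': mult_set R W'
      using W' RS.R.cring_axioms by (simp add: mult_set_def)
    define V where "V = {s \<in> carrier S. \<exists>v\<in>W'. v \<in> RS.content s}"
    have V: "submonoid V S"
    proof
      show "V \<subseteq> carrier S"
        by (auto simp: V_def)
      \<comment> \<open>The unit of S lies in the extension of its own content, and detection of
        units brings the unit of R into that content.\<close>
      have "\<one>\<^bsub>R\<^esub> \<in> RS.content \<one>\<^bsub>S\<^esub>"
        using RS_flat(2) RS.content_ideal RS.mem_ext_content[OF RS(1)] by (simp add: detects_unit_def)
      then show "\<one>\<^bsub>S\<^esub> \<in> V"
        using W'.W_one by (auto simp: V_def)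
      fix s s' assume "s \<in> V" "s' \<in> V"
      then obtain v v' where s: "s \<in> carrier S" "v \<in> W'" "v \<in> RS.content s"
        and s': "s' \<in> carrier S" "v' \<in> W'" "v' \<in> RS.content s'"
        by (auto simp: V_def)
      \<comment> \<open>As the content of \<open>s\<close> meets \<open>W'\<close>, some
        \<open>u\<close> outside \<open>p\<close> multiplies \<open>v'\<close> into the content of
        the product, and u v' stays outside \<open>p\<close> because \<open>p\<close> is
        prime.\<close>
      then obtain u where "u \<in> W'" "u \<otimes>\<^bsub>R\<^esub> v' \<in> RS.content (s \<otimes>\<^bsub>S\<^esub> s')"
        using RS_semi[OF W', of s s' v'] by blast
      then show "s \<otimes>\<^bsub>S\<^esub> s' \<in> V"
        using s s' W'.W_mult by (auto simp: V_def)
    qed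
    \<comment> \<open>Otherwise \<open>p\<close> would bound all \<Omega>_SR(s) with s in
      \<Omega>_TS(f), hence also the content of \<open>f\<close> over R, which contains
      \<open>w\<close>.\<close>
    have "\<exists>s\<in>V. s \<in> ST.content f"
    proof (rule ccontr)
      assume *: "\<not> (\<exists>s\<in>V. s \<in> ST.content f)"
      have sub: "RS.content s \<subseteq> p" if s: "s \<in> ST.content f" for s
      proof -
        have sS: "s \<in> carrier S"
          using s ST.content_carrier[OF f] by blast
        then have "s \<notin> V"
          using * s by blast
        then show ?thesis
          using sS RS.content_carrier[OF sS] unfolding V_def W'_def by blast
      qed
      have "RT.content f \<subseteq> p"
        by (rule RT.content_minimal[OF p.ideal_axioms content_tower_minimal[OF f p.ideal_axioms]]) (rule sub)
      then show False
        using w p(3) by blast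
    qed
    then have ST_V: "\<exists>x\<in>V. x \<otimes>\<^bsub>S\<^esub> s \<in> ST.content (f \<otimes>\<^bsub>T\<^esub> g)" if "s \<in> ST.content g" for s
      using ST_semi[OF V f g _ that] by blast
    \<comment> \<open>The contraction of \<open>?I\<close> localized at \<open>p\<close>. The
      multiplier may vary with the element, yet \<open>?J\<close> is an ideal and can bound the
      content of \<open>g\<close>.\<close>
    let ?J = "{r \<in> carrier R. \<exists>v\<in>W'. v \<otimes>\<^bsub>R\<^esub> r \<in> ?I}"
    have J: "ideal ?J R"
      using I by (rule W'.saturation_ideal)
    have sub: "RS.content s \<subseteq> ?J" if s: "s \<in> ST.content g" for s
    proof
      fix b assume b: "b \<in> RS.content s"
      have sS: "s \<in> carrier S"
        using s ST.content_carrier[OF g] by blast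
      obtain x where x: "x \<in> V" "x \<otimes>\<^bsub>S\<^esub> s \<in> ST.content (f \<otimes>\<^bsub>T\<^esub> g)"
        using ST_V[OF s] by blast
      \<comment> \<open>The property over R is used for the pair \<open>x\<close>, \<open>s\<close>:
        membership of \<open>x\<close> in \<open>V\<close> says that its content meets
        \<open>W'\<close>.\<close>
      then obtain v where "v \<in> W'" "v \<otimes>\<^bsub>R\<^esub> b \<in> RS.content (x \<otimes>\<^bsub>S\<^esub> s)"
        using RS_semi[OF W' _ sS _ b, of x] by (auto simp: V_def)
      then show "b \<in> ?J"
        using content_tower_subset[OF fg x(2)] RS.content_carrier[OF sS] b by blast
    qed
    have "RT.content g \<subseteq> ?J"
      by (rule RT.content_minimal[OF J content_tower_minimal[OF g J]]) (rule sub)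
    \<comment> \<open>Such a \<open>v\<close> lies in the colon ideal of \<open>a\<close>, hence in
      \<open>p\<close>, although it was taken outside \<open>p\<close>.\<close>
    then obtain v where v: "v \<in> W'" "v \<otimes>\<^bsub>R\<^esub> a \<in> ?I"
      using a by blast
    then have "v \<in> p"
      using p(2) W'.W_carrier by blast
    then show False
      using v(1) by (simp add: W'_def)
  qed
  then show ?thesis
    unfolding RT.semicontent_iff using ohm_rush_comp ff by blast
qed

end
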